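(* Let $k$ be a field, let $d\ge 0$ be an integer, let $G=(V,E)$ be a finite simple $d$-degenerate graph with maximal degree $D$, and let $(W,\langle\cdot,\cdot\rangle)$ be a finite-dimensional symplectic vector space over $k$. If $\dim(W)\ge D+d$, then $\widetilde{X}(G,W)$ is smooth if and only if $G$ is a forest.
   Context: A symplectic vector space is a vector space with a non-degenerate alternating bilinear form. $\widetilde{X}(G,W)$ (the projective graph variety) is the closed subscheme of $\mathbb{P}(W)^V$ (where $\mathbb{P}(W)$ is the space of lines in $W$) defined by the equations $\langle w(v),w(u)\rangle=0$ for $\{v,u\}\in E$. A graph is $d$-degenerate if its vertex set admits a linear ordering $>$ such that every vertex $v$ has at most $d$ neighbors $u$ with $u>v$. *)

theory Defs
  imports
    "HOL-Analysis.Abstract_Topology"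
    "HOL-Library.Poly_Mapping"
    "HOL-Algebra.QuotRing"
    "Jordan_Normal_Form.Determinant"
begin

section \<open>Graphs\<close>

definition simple_graph :: "'v set \<Rightarrow> 'v set set \<Rightarrow> bool" where
  "simple_graph V E \<longleftrightarrow> finite V \<and> (\<forall>e\<in>E. e \<subseteq> V \<and> card e = 2)"

definition neighbours :: "'v set set \<Rightarrow> 'v \<Rightarrow> 'v set" where
  "neighbours E v = {u. {v, u} \<in> E}"

text \<open>The graph without vertices has maximal degree \<open>0\<close>.\<close>

definition max_degree :: "'v set \<Rightarrow> 'v set set \<Rightarrow> nat" where
  "max_degree V E = Max (insert 0 ((\<lambda>v. card (neighbours E v)) ` V))"

text \<open>Here \<open>(v, u) \<in> r\<close> means \<open>u > v\<close>.\<close>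

definition degenerate :: "nat \<Rightarrow> 'v set \<Rightarrow> 'v set set \<Rightarrow> bool" where
  "degenerate d V E \<longleftrightarrow>
     (\<exists>r. strict_linear_order_on V r \<and> (\<forall>v\<in>V. card {u \<in> neighbours E v. (v, u) \<in> r} \<le> d))"

definition is_cycle :: "'v set set \<Rightarrow> 'v list \<Rightarrow> bool" where
  "is_cycle E xs \<longleftrightarrow> 3 \<le> length xs \<and> distinct xs \<and>
     (\<forall>i<length xs. {xs ! i, xs ! (Suc i mod length xs)} \<in> E)"

definition forest :: "'v set set \<Rightarrow> bool" where
  "forest E \<longleftrightarrow> (\<nexists>xs. is_cycle E xs)"


section \<open>Symplectic vector spaces\<close>

text \<open>The space \<open>W\<close> is the type \<open>'w\<close>, and \<open>Basis\<close> is an arbitrary basis of it.\<close>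

locale symplectic_space = finite_dimensional_vector_space scale Basis
  for scale :: "'k::field \<Rightarrow> 'w::ab_group_add \<Rightarrow> 'w" and Basis :: "'w set" +
  fixes form :: "'w \<Rightarrow> 'w \<Rightarrow> 'k"
  assumes linear_left: "Vector_Spaces.linear scale (*) (\<lambda>x. form x y)"
    and linear_right: "Vector_Spaces.linear scale (*) (\<lambda>y. form x y)"
    and alternating: "form x x = 0"
    and nondegenerate: "(\<And>y. form x y = 0) \<Longrightarrow> x = 0"


section \<open>Polynomials in several variables\<close>

text \<open>A polynomial maps monomials (exponent vectors of finite support) to coefficients.\<close>

type_synonym ('x, 'k) mpoly = "('x \<Rightarrow>\<^sub>0 nat) \<Rightarrow>\<^sub>0 'k"

definition mconst :: "'k::zero \<Rightarrow> ('x, 'k) mpoly" where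
  "mconst c = Poly_Mapping.single 0 c"

definition mvar :: "'x \<Rightarrow> ('x, 'k::zero_neq_one) mpoly" where
  "mvar x = Poly_Mapping.single (Poly_Mapping.single x 1) 1"

text \<open>The partial derivative with respect to \<open>x\<close>; the truncated subtraction of exponents is
  harmless because the coefficient vanishes if \<open>x\<close> does not occur in \<open>m\<close>.\<close>

definition mpderiv :: "'x \<Rightarrow> ('x, 'k::comm_ring_1) mpoly \<Rightarrow> ('x, 'k) mpoly" where
  "mpderiv x f = (\<Sum>m\<in>Poly_Mapping.keys f.
     Poly_Mapping.single (m - Poly_Mapping.single x 1)
       (of_nat (Poly_Mapping.lookup m x) * Poly_Mapping.lookup f m))"

definition mpoly_ring :: "'x set \<Rightarrow> ('x, 'k::comm_ring_1) mpoly ring" where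
  "mpoly_ring N =
     \<lparr>carrier = {f. \<forall>m\<in>Poly_Mapping.keys f. Poly_Mapping.keys m \<subseteq> N},
      monoid.mult = (*), one = 1, zero = 0, add = (+)\<rparr>"


section \<open>Spaces with a sheaf of \<open>k\<close>-algebras\<close>

text \<open>\<open>Sec X U\<close> is the ring of sections over the open set \<open>U\<close>, \<open>Res X U U'\<close> is the restriction
  from \<open>U\<close> to \<open>U' \<subseteq> U\<close>, and \<open>Sca X U\<close> is the structure map from \<open>k\<close> to \<open>Sec X U\<close>.\<close>

record ('p, 's, 'k) ringed_space =
  Top :: "'p topology"
  Sec :: "'p set \<Rightarrow> 's ring"
  Res :: "'p set \<Rightarrow> 'p set \<Rightarrow> 's \<Rightarrow> 's"
  Sca :: "'p set \<Rightarrow> 'k \<Rightarrow> 's"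

definition open_subspace :: "('p, 's, 'k) ringed_space \<Rightarrow> 'p set \<Rightarrow> ('p, 's, 'k) ringed_space" where
  "open_subspace X U = X\<lparr>Top := subtopology (Top X) U\<rparr>"

text \<open>An isomorphism of ringed spaces over \<open>k\<close>. Between locally ringed spaces it automatically
  induces local homomorphisms of the stalks, hence is an isomorphism of locally ringed spaces.\<close>

definition isomorphic_spaces ::
    "('p, 's, 'k) ringed_space \<Rightarrow> ('q, 't, 'k) ringed_space \<Rightarrow> bool" where
  "isomorphic_spaces X Y \<longleftrightarrow>
     (\<exists>\<phi> \<eta>. homeomorphic_map (Top X) (Top Y) \<phi> \<and>
        (\<forall>V. openin (Top Y) V \<longrightarrow>
           \<eta> V \<in> ring_iso (Sec Y V) (Sec X {x \<in> topspace (Top X). \<phi> x \<in> V}) \<and>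
           (\<forall>c. \<eta> V (Sca Y V c) = Sca X {x \<in> topspace (Top X). \<phi> x \<in> V} c) \<and>
           (\<forall>V' s. openin (Top Y) V' \<and> V' \<subseteq> V \<and> s \<in> carrier (Sec Y V) \<longrightarrow>
              \<eta> V' (Res Y V V' s) =
                Res X {x \<in> topspace (Top X). \<phi> x \<in> V} {x \<in> topspace (Top X). \<phi> x \<in> V'} (\<eta> V s))))"


section \<open>Spectra of graded rings\<close>

text \<open>
  This section treats at once the spectrum of \<open>R/J\<close> and the multihomogeneous spectrum of \<open>R/J\<close>,
  for an ideal \<open>J\<close> of a polynomial ring \<open>R\<close>. The points are given as a set \<open>P\<close> of prime ideals of
  \<open>R\<close> that contain \<open>J\<close>. The set \<open>H\<close> consists of the homogeneous parts of \<open>R\<close>: in the affine case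
  it is \<open>{carrier R}\<close>, and in the multihomogeneous case there is one part for each multidegree.

  The stalk at \<open>p\<close> consists of the fractions \<open>a/b\<close> such that \<open>a\<close> and \<open>b\<close> have the same degree and
  \<open>b \<notin> p\<close>, where \<open>a/b = c/d\<close> if and only if \<open>t(ad - cb) \<in> J\<close> for some homogeneous \<open>t \<notin> p\<close>.
  The fraction \<open>a/b\<close> is represented by its equivalence class \<open>fraction H J p a b\<close>.
\<close>

definition fraction :: "'a::comm_ring_1 set set \<Rightarrow> 'a set \<Rightarrow> 'a set \<Rightarrow> 'a \<Rightarrow> 'a \<Rightarrow> ('a \<times> 'a) set" where
  "fraction H J p a b =
     {(c, d). (\<exists>h\<in>H. c \<in> h \<and> d \<in> h) \<and> d \<notin> p \<and>
              (\<exists>h\<in>H. \<exists>t\<in>h. t \<notin> p \<and> t * (a * d - c * b) \<in> J)}"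

text \<open>The unions in the next two definitions are taken over representatives; each is a union of
  copies of one and the same equivalence class.\<close>

definition fraction_add ::
    "'a::comm_ring_1 set set \<Rightarrow> 'a set \<Rightarrow> 'a set \<Rightarrow> ('a \<times> 'a) set \<Rightarrow> ('a \<times> 'a) set \<Rightarrow> ('a \<times> 'a) set" where
  "fraction_add H J p x y =
     (\<Union>(a, b)\<in>x. \<Union>(c, d)\<in>y. fraction H J p (a * d + c * b) (b * d))"

definition fraction_mult ::
    "'a::comm_ring_1 set set \<Rightarrow> 'a set \<Rightarrow> 'a set \<Rightarrow> ('a \<times> 'a) set \<Rightarrow> ('a \<times> 'a) set \<Rightarrow> ('a \<times> 'a) set" where
  "fraction_mult H J p x y =
     (\<Union>(a, b)\<in>x. \<Union>(c, d)\<in>y. fraction H J p (a * c) (b * d))"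

definition zariski_topology :: "'a ring \<Rightarrow> 'a set set \<Rightarrow> 'a set topology" where
  "zariski_topology R P = topology_generated_by {{p \<in> P. f \<notin> p} | f. f \<in> carrier R}"

text \<open>Sections over \<open>U\<close> are the functions on \<open>U\<close> with values in the stalks that are locally given
  by a single fraction.\<close>

definition fraction_sections ::
    "'a::comm_ring_1 set topology \<Rightarrow> 'a set set \<Rightarrow> 'a set \<Rightarrow> 'a set set
       \<Rightarrow> ('a set \<Rightarrow> ('a \<times> 'a) set) set" where
  "fraction_sections T H J U =
     {s \<in> extensional U. \<forall>p\<in>U. \<exists>U'. openin T U' \<and> p \<in> U' \<and> U' \<subseteq> U \<and>
        (\<exists>h\<in>H. \<exists>a\<in>h. \<exists>b\<in>h. \<forall>q\<in>U'. b \<notin> q \<and> s q = fraction H J q a b)}"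

type_synonym ('x, 'k) mpoly_space =
  "(('x, 'k) mpoly set, ('x, 'k) mpoly set \<Rightarrow> (('x, 'k) mpoly \<times> ('x, 'k) mpoly) set, 'k) ringed_space"

definition fraction_space ::
    "('x, 'k::comm_ring_1) mpoly ring \<Rightarrow> ('x, 'k) mpoly set set \<Rightarrow> ('x, 'k) mpoly set
       \<Rightarrow> ('x, 'k) mpoly set set \<Rightarrow> ('x, 'k) mpoly_space" where
  "fraction_space R H J P =
     \<lparr>Top = zariski_topology R P,
      Sec = (\<lambda>U. \<lparr>carrier = fraction_sections (zariski_topology R P) H J U,
                  monoid.mult = (\<lambda>s t. \<lambda>p\<in>U. fraction_mult H J p (s p) (t p)),
                  one = (\<lambda>p\<in>U. fraction H J p 1 1),
                  zero = (\<lambda>p\<in>U. fraction H J p 0 1),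
                  add = (\<lambda>s t. \<lambda>p\<in>U. fraction_add H J p (s p) (t p))\<rparr>),
      Res = (\<lambda>U U' s. restrict s U'),
      Sca = (\<lambda>U c. \<lambda>p\<in>U. fraction H J p (mconst c) 1)\<rparr>"

text \<open>\<open>Spec (k[x | x \<in> N] / (F))\<close>\<close>

definition affine_scheme :: "'x set \<Rightarrow> ('x, 'k::field) mpoly set \<Rightarrow> ('x, 'k) mpoly_space" where
  "affine_scheme N F =
     (let R = mpoly_ring N; J = genideal R F
      in fraction_space R {carrier R} J {p. primeideal p R \<and> J \<subseteq> p})"


section \<open>Closed subschemes of a product of projective spaces\<close>

text \<open>
  For \<open>W\<close> with basis \<open>B\<close>, the scheme \<open>P(W)\<^sup>V\<close> is the multihomogeneous spectrum of the ring
  \<open>k[x\<^bsub>v,b\<^esub> | v \<in> V, b \<in> B]\<close> with its grading by \<open>\<nat>\<^sup>V\<close>. Here \<open>x\<^bsub>v,b\<^esub>\<close> is the \<open>b\<close>-coordinate of the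
  vector \<open>w(v)\<close> that spans the line at \<open>v\<close>.
\<close>

definition multidegree :: "'b set \<Rightarrow> ('v \<times> 'b \<Rightarrow>\<^sub>0 nat) \<Rightarrow> 'v \<Rightarrow> nat" where
  "multidegree B m v = (\<Sum>b\<in>B. Poly_Mapping.lookup m (v, b))"

definition homogeneous_part ::
    "'v set \<Rightarrow> 'b set \<Rightarrow> ('v \<Rightarrow> nat) \<Rightarrow> ('v \<times> 'b, 'k::comm_ring_1) mpoly set" where
  "homogeneous_part V B \<delta> =
     {f \<in> carrier (mpoly_ring (V \<times> B)). \<forall>m\<in>Poly_Mapping.keys f. multidegree B m = \<delta>}"

text \<open>The closed subscheme of \<open>P(W)\<^sup>V\<close> defined by a set \<open>F\<close> of multihomogeneous equations. Its points
  are the multihomogeneous prime ideals that contain \<open>F\<close> and do not contain, for any \<open>v\<close>, all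
  coordinates of \<open>w(v)\<close>.\<close>

definition multiprojective_scheme ::
    "'v set \<Rightarrow> 'b set \<Rightarrow> ('v \<times> 'b, 'k::field) mpoly set \<Rightarrow> ('v \<times> 'b, 'k) mpoly_space" where
  "multiprojective_scheme V B F =
     (let R = mpoly_ring (V \<times> B); J = genideal R F
      in fraction_space R (range (homogeneous_part V B)) J
           {p. primeideal p R \<and> p = genideal R (p \<inter> (\<Union>\<delta>. homogeneous_part V B \<delta>)) \<and>
               J \<subseteq> p \<and> (\<forall>v\<in>V. \<exists>b\<in>B. mvar (v, b) \<notin> p)})"

text \<open>The equation \<open>\<langle>w(v), w(u)\<rangle> = 0\<close> in coordinates.\<close>

definition edge_equation ::
    "'w set \<Rightarrow> ('w \<Rightarrow> 'w \<Rightarrow> 'k::field) \<Rightarrow> 'v \<Rightarrow> 'v \<Rightarrow> ('v \<times> 'w, 'k) mpoly" where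
  "edge_equation B form v u =
     (\<Sum>b\<in>B. \<Sum>c\<in>B. mconst (form b c) * mvar (v, b) * mvar (u, c))"

definition projective_graph_variety ::
    "'v set \<Rightarrow> 'v set set \<Rightarrow> 'w set \<Rightarrow> ('w \<Rightarrow> 'w \<Rightarrow> 'k::field) \<Rightarrow> ('v \<times> 'w, 'k) mpoly_space" where
  "projective_graph_variety V E B form =
     multiprojective_scheme V B {edge_equation B form v u | v u. {v, u} \<in> E}"


section \<open>Smoothness\<close>

definition jacobian_minor :: "nat \<Rightarrow> (nat \<Rightarrow> (nat, 'k::field) mpoly) \<Rightarrow> (nat, 'k) mpoly" where
  "jacobian_minor c f = Determinant.det (mat c c (\<lambda>(i, j). mpderiv j (f i)))"

text \<open>
  A scheme over \<open>k\<close> is smooth if it is covered by open subschemes each of which is isomorphic over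
  \<open>k\<close> to an open subscheme of some \<open>Spec (k[x\<^sub>0, \<dots>, x\<^bsub>n-1\<^esub>] / (f\<^sub>0, \<dots>, f\<^bsub>c-1\<^esub>))\<close>, \<open>c \<le> n\<close>, on which
  the determinant of \<open>(\<partial>f\<^sub>i / \<partial>x\<^sub>j)\<^bsub>i,j<c\<^esub>\<close> is invertible. The relative dimension \<open>n - c\<close> may vary.
\<close>

definition smooth :: "('p, 's, 'k::field) ringed_space \<Rightarrow> bool" where
  "smooth X \<longleftrightarrow>
     (\<forall>x\<in>topspace (Top X). \<exists>U. openin (Top X) U \<and> x \<in> U \<and>
        (\<exists>n c f. c \<le> n \<and> (\<forall>i<c. f i \<in> carrier (mpoly_ring {..<n})) \<and>
           (let Y = (affine_scheme {..<n} (f ` {..<c}) :: (nat, 'k) mpoly_space)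
            in \<exists>Y'. openin (Top Y) Y' \<and> (\<forall>q\<in>Y'. jacobian_minor c f \<notin> q) \<and>
                 isomorphic_spaces (open_subspace X U) (open_subspace Y Y'))))"

end

theory Submission
  imports Defs
begin

text \<open>
  At a point \<open>w\<close> of the variety, the differential of the equations \<open>\<langle>w(v), w(u)\<rangle> = 0\<close> is
  \<open>\<langle>\<delta>w(v), w(u)\<rangle> + \<langle>w(v), \<delta>w(u)\<rangle>\<close>. By non-degeneracy of the form, it fails to be surjective if and only
  if there are weights \<open>a(v,u) = - a(u,v)\<close> on the edges, not all zero, such that the vectors
  \<open>a(v,u) w(u)\<close>, for \<open>u\<close> adjacent to \<open>v\<close>, add up to zero for each vertex \<open>v\<close>.

  For a forest, such weights vanish: a leaf \<open>v\<close> has a single neighbour \<open>u\<close>, and \<open>w(u) \<noteq> 0\<close>, so the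
  weight of its edge is zero and the leaf can be removed. In terms of matrices, the edges are
  enumerated in such a way that the \<open>i\<close>-th edge has an end that is in no earlier edge
  (\<open>forest_enumeration\<close>). Some coordinate of the vector at this end has the property that the
  derivative of the \<open>i\<close>-th equation with respect to it does not vanish at the given point
  (\<open>edge_functional_not_in_prime\<close>), and for these coordinates the Jacobian matrix is triangular. This
  computation takes place in a chart of \<open>P(W)\<^sup>V\<close> in which one coordinate of each \<open>w(v)\<close> is set to \<open>1\<close>. The
  greater part of the argument is the proof that the chart of the multihomogeneous spectrum is
  isomorphic, as a ringed space, to an affine scheme (\<open>chart_isomorphism\<close>).

  If there is a cycle, then the point at which all lines \<open>w(v)\<close> are equal to one line \<open>w\<^sub>0\<close> is singular,
  because the infinitesimal lifting property fails there. On a smooth scheme, two tangent vectors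
  at the same point, that is, two points with values in \<open>k[t]/t\<^sup>2\<close> and in \<open>k[e]/e\<^sup>2\<close> that agree modulo \<open>t\<close>
  and \<open>e\<close>, are the reductions of one point with values in \<open>k[t,e]/(t\<^sup>2,e\<^sup>2)\<close> (\<open>smooth_lifting\<close>): only the
  coefficients of \<open>t e\<close> are to be found, and they solve a linear system whose matrix is the Jacobian
  matrix. On the graph variety, take vectors \<open>x\<close> and \<open>y\<close> orthogonal to \<open>w\<^sub>0\<close> with \<open>\<langle>x, y\<rangle> = 1\<close> and an edge
  \<open>{u\<^sub>0, u\<^sub>1}\<close> of the cycle. The first tangent vector moves only \<open>w(u\<^sub>0)\<close>, to \<open>w\<^sub>0 + t x\<close>, and the second only
  \<open>w(u\<^sub>1)\<close>, to \<open>w\<^sub>0 + e y\<close>. If \<open>\<zeta>\<close> denotes the \<open>t e\<close>-part of a common lift, then the \<open>t e\<close>-parts of the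
  equations say that the number \<open>\<langle>\<zeta>(v), w\<^sub>0\<rangle>\<close> is the same at both ends of every other edge of the cycle,
  but changes by \<open>1\<close> along \<open>{u\<^sub>0, u\<^sub>1}\<close>. This is impossible (\<open>not_smooth_if_cycle\<close>). A cycle forces
  \<open>d \<ge> 2\<close> and \<open>D \<ge> 2\<close>, and then the bound on the dimension of \<open>W\<close> leaves room for \<open>w\<^sub>0\<close>, \<open>x\<close> and \<open>y\<close>
  (\<open>symplectic_coordinates\<close>).
\<close>


section \<open>Evaluation of polynomials\<close>

lemma comm_ring_homI:
  assumes "h 0 = 0" "h 1 = 1" "\<And>a b. h (a + b) = h a + h b" "\<And>a b. h (a * b) = h a * h b"
  shows "comm_ring_hom (h :: 'a::comm_ring_1 \<Rightarrow> 'b::comm_ring_1)"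
  using assms by unfold_locales auto

definition monomial_value :: "('x \<Rightarrow> 'a::comm_ring_1) \<Rightarrow> ('x \<Rightarrow>\<^sub>0 nat) \<Rightarrow> 'a" where
  "monomial_value \<alpha> m = (\<Prod>x\<in>Poly_Mapping.keys m. \<alpha> x ^ Poly_Mapping.lookup m x)"

text \<open>Evaluation along \<open>\<kappa>\<close> and \<open>\<alpha>\<close>. It is defined for polynomials in all variables of the type, so that it is a
  homomorphism between rings given by types even if only the values of \<open>\<alpha>\<close> on some set matter.\<close>

definition peval :: "('k::comm_ring_1 \<Rightarrow> 'a::comm_ring_1) \<Rightarrow> ('x \<Rightarrow> 'a) \<Rightarrow> ('x, 'k) mpoly \<Rightarrow> 'a" where
  "peval \<kappa> \<alpha> f = (\<Sum>m\<in>Poly_Mapping.keys f. \<kappa> (Poly_Mapping.lookup f m) * monomial_value \<alpha> m)"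

lemma monomial_value_superset:
  assumes "finite A" "Poly_Mapping.keys m \<subseteq> A"
  shows "monomial_value \<alpha> m = (\<Prod>x\<in>A. \<alpha> x ^ Poly_Mapping.lookup m x)"
  unfolding monomial_value_def
  by (rule prod.mono_neutral_left) (use assms in \<open>auto simp: in_keys_iff\<close>)

lemma monomial_value_0 [simp]: "monomial_value \<alpha> 0 = 1"
  by (simp add: monomial_value_def)

lemma monomial_value_add: "monomial_value \<alpha> (m + n) = monomial_value \<alpha> m * monomial_value \<alpha> n"
proof -
  let ?A = "Poly_Mapping.keys m \<union> Poly_Mapping.keys n"
  have "monomial_value \<alpha> (m + n) = (\<Prod>x\<in>?A. \<alpha> x ^ Poly_Mapping.lookup (m + n) x)"
    by (rule monomial_value_superset) (auto simp: in_keys_iff lookup_add)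
  also have "\<dots> = (\<Prod>x\<in>?A. \<alpha> x ^ Poly_Mapping.lookup m x) * (\<Prod>x\<in>?A. \<alpha> x ^ Poly_Mapping.lookup n x)"
    by (simp add: lookup_add power_add prod.distrib)
  also have "\<dots> = monomial_value \<alpha> m * monomial_value \<alpha> n"
    by (simp add: monomial_value_superset[symmetric])
  finally show ?thesis .
qed

lemma monomial_value_single [simp]: "monomial_value \<alpha> (Poly_Mapping.single x n) = \<alpha> x ^ n"
  by (cases "n = 0") (simp_all add: monomial_value_def)

lemma peval_superset:
  assumes "finite A" "Poly_Mapping.keys f \<subseteq> A" "\<kappa> 0 = 0"
  shows "peval \<kappa> \<alpha> f = (\<Sum>m\<in>A. \<kappa> (Poly_Mapping.lookup f m) * monomial_value \<alpha> m)"
  unfolding peval_def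
  by (rule sum.mono_neutral_left) (use assms in \<open>auto simp: in_keys_iff\<close>)

lemma peval_single: "\<kappa> 0 = 0 \<Longrightarrow> peval \<kappa> \<alpha> (Poly_Mapping.single m c) = \<kappa> c * monomial_value \<alpha> m"
  by (cases "c = 0") (simp_all add: peval_def)

lemma poly_mapping_single_add_induct [case_names zero single add]:
  fixes f :: "'a \<Rightarrow>\<^sub>0 'b::comm_monoid_add"
  assumes "P 0" "\<And>m c. P (Poly_Mapping.single m c)" "\<And>f g. P f \<Longrightarrow> P g \<Longrightarrow> P (f + g)"
  shows "P f"
proof -
  have "f = (\<Sum>m\<in>Poly_Mapping.keys f. Poly_Mapping.single m (Poly_Mapping.lookup f m))"
    by (rule poly_mapping_eqI)
      (auto simp: lookup_sum lookup_single when_def in_keys_iff sum.delta' cong: if_cong)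
  moreover have "finite A \<Longrightarrow> P (\<Sum>m\<in>A. Poly_Mapping.single m (Poly_Mapping.lookup f m))" for A
    by (induction A rule: finite_induct) (auto intro: assms)
  ultimately show ?thesis by (metis finite_keys)
qed

lemma comm_ring_hom_peval:
  fixes \<kappa> :: "'k::comm_ring_1 \<Rightarrow> 'a::comm_ring_1"
  assumes "comm_ring_hom \<kappa>"
  shows "comm_ring_hom (peval \<kappa> \<alpha>)"
proof (rule comm_ring_homI)
  interpret \<kappa>: comm_ring_hom \<kappa> by fact
  show "peval \<kappa> \<alpha> 0 = 0" by (simp add: peval_def)
  show "peval \<kappa> \<alpha> 1 = 1" by (simp add: peval_def)
  show add: "peval \<kappa> \<alpha> (f + g) = peval \<kappa> \<alpha> f + peval \<kappa> \<alpha> g" for f g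
  proof -
    let ?A = "Poly_Mapping.keys f \<union> Poly_Mapping.keys g"
    have "peval \<kappa> \<alpha> (f + g) = (\<Sum>m\<in>?A. \<kappa> (Poly_Mapping.lookup (f + g) m) * monomial_value \<alpha> m)"
      by (rule peval_superset) (auto simp: in_keys_iff lookup_add)
    also have "\<dots> = (\<Sum>m\<in>?A. \<kappa> (Poly_Mapping.lookup f m) * monomial_value \<alpha> m) +
        (\<Sum>m\<in>?A. \<kappa> (Poly_Mapping.lookup g m) * monomial_value \<alpha> m)"
      by (simp add: lookup_add \<kappa>.hom_add algebra_simps sum.distrib)
    also have "\<dots> = peval \<kappa> \<alpha> f + peval \<kappa> \<alpha> g"
      by (simp add: peval_superset[symmetric])
    finally show ?thesis .
  qed
  show "peval \<kappa> \<alpha> (f * g) = peval \<kappa> \<alpha> f * peval \<kappa> \<alpha> g" for f g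
  proof (induction f rule: poly_mapping_single_add_induct)
    case zero
    then show ?case by (simp add: peval_def)
  next
    case (single m c)
    show ?case
    proof (induction g rule: poly_mapping_single_add_induct)
      case zero
      then show ?case by (simp add: peval_def)
    next
      case (single n c')
      then show ?case
        by (simp add: mult_single peval_single monomial_value_add \<kappa>.hom_mult ac_simps)
    qed (simp add: algebra_simps add)
  qed (simp add: algebra_simps add)
qed

lemma peval_mconst [simp]: "\<kappa> 0 = 0 \<Longrightarrow> peval \<kappa> \<alpha> (mconst c) = \<kappa> c"
  by (simp add: mconst_def peval_single)

lemma peval_mvar [simp]: "\<kappa> 0 = 0 \<Longrightarrow> \<kappa> 1 = 1 \<Longrightarrow> peval \<kappa> \<alpha> (mvar x) = \<alpha> x"
  by (simp add: mvar_def peval_single)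

lemma mconst_0 [simp]: "mconst 0 = 0" by (simp add: mconst_def)
lemma mconst_1 [simp]: "mconst 1 = 1" by (simp add: mconst_def)
lemma mconst_add: "mconst (a + b) = mconst a + mconst b" by (simp add: mconst_def single_add)
lemma mconst_mult: "mconst (a * b) = mconst a * mconst b" by (simp add: mconst_def mult_single)

lemma comm_ring_hom_mconst: "comm_ring_hom (mconst :: 'k::comm_ring_1 \<Rightarrow> ('x, 'k) mpoly)"
  by (rule comm_ring_homI) (simp_all add: mconst_add mconst_mult)

section \<open>The polynomial ring\<close>

lemma carrier_mpoly_ring:
  "f \<in> carrier (mpoly_ring N) \<longleftrightarrow> (\<forall>m\<in>Poly_Mapping.keys f. Poly_Mapping.keys m \<subseteq> N)"
  by (simp add: mpoly_ring_def)

lemma mpoly_ring_simps [simp]: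
  "f \<otimes>\<^bsub>mpoly_ring N\<^esub> g = f * g" "f \<oplus>\<^bsub>mpoly_ring N\<^esub> g = f + g"
  "\<one>\<^bsub>mpoly_ring N\<^esub> = 1" "\<zero>\<^bsub>mpoly_ring N\<^esub> = 0"
  by (simp_all add: mpoly_ring_def)

lemma mpoly_closed_add:
  "f \<in> carrier (mpoly_ring N) \<Longrightarrow> g \<in> carrier (mpoly_ring N) \<Longrightarrow> f + g \<in> carrier (mpoly_ring N)"
  unfolding carrier_mpoly_ring using keys_add[of f g] by blast

lemma mpoly_closed_single:
  "Poly_Mapping.keys m \<subseteq> N \<Longrightarrow> Poly_Mapping.single m c \<in> carrier (mpoly_ring N)"
  by (auto simp: carrier_mpoly_ring split: if_splits)

lemma keys_nat_add: "Poly_Mapping.keys (m + n) = Poly_Mapping.keys m \<union> Poly_Mapping.keys (n :: 'x \<Rightarrow>\<^sub>0 nat)"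
  by (auto simp: in_keys_iff lookup_add)

lemma mpoly_closed_mult:
  "f \<in> carrier (mpoly_ring N) \<Longrightarrow> g \<in> carrier (mpoly_ring N) \<Longrightarrow> f * g \<in> carrier (mpoly_ring N)"
  unfolding carrier_mpoly_ring using keys_mult[of f g] by (fastforce simp: keys_nat_add)

lemma mpoly_closed_uminus: "f \<in> carrier (mpoly_ring N) \<Longrightarrow> - f \<in> carrier (mpoly_ring N)"
  by (simp add: carrier_mpoly_ring in_keys_iff)

lemma mpoly_closed_diff:
  "f \<in> carrier (mpoly_ring N) \<Longrightarrow> g \<in> carrier (mpoly_ring N) \<Longrightarrow> f - g \<in> carrier (mpoly_ring N)"
  using mpoly_closed_add[of f N "- g"] mpoly_closed_uminus by force

lemma mpoly_closed_mconst: "mconst c \<in> carrier (mpoly_ring N)"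
  unfolding mconst_def by (rule mpoly_closed_single) simp

lemma mpoly_closed_mvar: "x \<in> N \<Longrightarrow> mvar x \<in> carrier (mpoly_ring N)"
  unfolding mvar_def by (rule mpoly_closed_single) simp

lemma mpoly_closed_0: "0 \<in> carrier (mpoly_ring N)"
  by (simp add: carrier_mpoly_ring)

lemma mpoly_closed_1: "1 \<in> carrier (mpoly_ring N)"
  by (simp add: carrier_mpoly_ring)

lemma mpoly_closed_sum:
  "(\<And>i. i \<in> A \<Longrightarrow> f i \<in> carrier (mpoly_ring N)) \<Longrightarrow> sum f A \<in> carrier (mpoly_ring N)"
  by (induction A rule: infinite_finite_induct) (auto intro: mpoly_closed_add mpoly_closed_0)

lemma mpoly_closed_prod:
  "(\<And>i. i \<in> A \<Longrightarrow> f i \<in> carrier (mpoly_ring N)) \<Longrightarrow> prod f A \<in> carrier (mpoly_ring N)"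
  by (induction A rule: infinite_finite_induct) (auto intro: mpoly_closed_mult mpoly_closed_1)

lemma mpoly_closed_power:
  "f \<in> carrier (mpoly_ring N) \<Longrightarrow> f ^ n \<in> carrier (mpoly_ring N)"
  by (induction n) (auto intro: mpoly_closed_mult mpoly_closed_1)

lemmas mpoly_closed = mpoly_closed_add mpoly_closed_mult mpoly_closed_uminus mpoly_closed_diff
  mpoly_closed_mconst mpoly_closed_mvar mpoly_closed_0 mpoly_closed_1 mpoly_closed_sum
  mpoly_closed_prod mpoly_closed_power

lemma cring_mpoly_ring: "cring (mpoly_ring N :: ('x, 'k::comm_ring_1) mpoly ring)"
proof (rule cringI)
  show "abelian_group (mpoly_ring N :: ('x, 'k) mpoly ring)"
  proof (rule abelian_groupI)
    fix f :: "('x, 'k) mpoly" assume "f \<in> carrier (mpoly_ring N)"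
    then show "\<exists>g\<in>carrier (mpoly_ring N). g \<oplus>\<^bsub>mpoly_ring N\<^esub> f = \<zero>\<^bsub>mpoly_ring N\<^esub>"
      by (intro bexI[of _ "- f"]) (auto intro: mpoly_closed)
  qed (auto intro: mpoly_closed simp: algebra_simps)
  show "Group.comm_monoid (mpoly_ring N :: ('x, 'k) mpoly ring)"
    by (rule comm_monoidI) (auto intro: mpoly_closed simp: algebra_simps)
qed (auto simp: algebra_simps)

text \<open>The constants and the variables generate the polynomial ring, so that identities between
  homomorphisms and derivations need to be checked on them only.\<close>

lemma mpoly_induct [consumes 1, case_names mconst mvar add mult]:
  fixes f :: "('x, 'k::comm_ring_1) mpoly"
  assumes "f \<in> carrier (mpoly_ring N)"
    and const: "\<And>c. P (mconst c)" and var: "\<And>x. x \<in> N \<Longrightarrow> P (mvar x)"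
    and add: "\<And>f g. f \<in> carrier (mpoly_ring N) \<Longrightarrow> g \<in> carrier (mpoly_ring N) \<Longrightarrow> P f \<Longrightarrow> P g \<Longrightarrow> P (f + g)"
    and mult: "\<And>f g. f \<in> carrier (mpoly_ring N) \<Longrightarrow> g \<in> carrier (mpoly_ring N) \<Longrightarrow> P f \<Longrightarrow> P g \<Longrightarrow> P (f * g)"
  shows "P f"
proof -
  let ?Q = "\<lambda>f. f \<in> carrier (mpoly_ring N) \<and> P f"
  have one: "?Q 1" using const[of 1] by (auto intro: mpoly_closed)
  have power: "?Q (mvar x ^ n)" if "x \<in> N" for x n
    by (induction n) (use that one in \<open>auto intro!: mult var mpoly_closed\<close>)
  have prod: "finite A \<Longrightarrow> A \<subseteq> N \<Longrightarrow> ?Q (\<Prod>x\<in>A. mvar x ^ e x)" for A and e :: "'x \<Rightarrow> nat"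
  proof (induction A rule: finite_induct)
    case empty
    then show ?case using const[of 1] by (auto intro: mpoly_closed)
  next
    case (insert x A)
    then show ?case using power[of x "e x"] by (auto intro!: mult mpoly_closed)
  qed
  have mvar_power: "mvar x ^ n = (Poly_Mapping.single (Poly_Mapping.single x n) 1 :: ('x, 'k) mpoly)" for x n
    by (induction n) (simp_all add: mvar_def mult_single single_add[symmetric])
  have single_prod: "finite A \<Longrightarrow> (\<Prod>x\<in>A. mvar x ^ e x) =
      (Poly_Mapping.single (\<Sum>x\<in>A. Poly_Mapping.single x (e x)) 1 :: ('x, 'k) mpoly)" for A e
    by (induction A rule: finite_induct) (simp_all add: mvar_power mult_single)
  have monomial: "(\<Sum>x\<in>Poly_Mapping.keys m. Poly_Mapping.single x (Poly_Mapping.lookup m x)) = m"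
    for m :: "'x \<Rightarrow>\<^sub>0 nat"
    by (rule poly_mapping_eqI)
      (auto simp: lookup_sum lookup_single when_def in_keys_iff sum.delta' cong: if_cong)
  have single: "?Q (Poly_Mapping.single m c)" if "Poly_Mapping.keys m \<subseteq> N" for m c
  proof -
    have "Poly_Mapping.single m c = mconst c * (\<Prod>x\<in>Poly_Mapping.keys m. mvar x ^ Poly_Mapping.lookup m x)"
      by (simp add: single_prod monomial mconst_def mult_single)
    then show ?thesis using prod[of "Poly_Mapping.keys m"] that const by (auto intro!: mult mpoly_closed)
  qed
  have "finite A \<Longrightarrow> A \<subseteq> Poly_Mapping.keys f \<Longrightarrow>
      ?Q (\<Sum>m\<in>A. Poly_Mapping.single m (Poly_Mapping.lookup f m))" for A
  proof (induction A rule: finite_induct)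
    case empty
    then show ?case using const[of 0] by (auto intro: mpoly_closed)
  next
    case (insert m A)
    then have "Poly_Mapping.keys m \<subseteq> N" using assms(1) by (auto simp: carrier_mpoly_ring)
    with insert single[of m] show ?case by (auto intro!: add mpoly_closed)
  qed
  moreover have "f = (\<Sum>m\<in>Poly_Mapping.keys f. Poly_Mapping.single m (Poly_Mapping.lookup f m))"
    by (rule poly_mapping_eqI)
      (auto simp: lookup_sum lookup_single when_def in_keys_iff sum.delta' cong: if_cong)
  ultimately show ?thesis by (metis finite_keys order_refl)
qed

text \<open>The universal property of the polynomial ring; \<open>\<theta>\<close> need not be additive or multiplicative outside
  of it. Homomorphisms on rings of sections are identified with its help.\<close>

lemma peval_unique:
  fixes \<theta> :: "('x, 'k::comm_ring_1) mpoly \<Rightarrow> 'a::comm_ring_1"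
  assumes "comm_ring_hom \<kappa>" "f \<in> carrier (mpoly_ring N)"
    and "\<And>c. \<theta> (mconst c) = \<kappa> c" "\<And>x. x \<in> N \<Longrightarrow> \<theta> (mvar x) = \<alpha> x"
    and "\<And>f g. f \<in> carrier (mpoly_ring N) \<Longrightarrow> g \<in> carrier (mpoly_ring N) \<Longrightarrow> \<theta> (f + g) = \<theta> f + \<theta> g"
    and "\<And>f g. f \<in> carrier (mpoly_ring N) \<Longrightarrow> g \<in> carrier (mpoly_ring N) \<Longrightarrow> \<theta> (f * g) = \<theta> f * \<theta> g"
  shows "\<theta> f = peval \<kappa> \<alpha> f"
proof -
  interpret \<kappa>: comm_ring_hom \<kappa> by fact
  interpret e: comm_ring_hom "peval \<kappa> \<alpha>" by (rule comm_ring_hom_peval) fact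
  show ?thesis using assms(2)
    by (induction f rule: mpoly_induct) (simp_all add: assms(3-) e.hom_add e.hom_mult)
qed

lemma peval_compose:
  assumes "comm_ring_hom \<kappa>" "comm_ring_hom h"
  shows "h (peval \<kappa> \<alpha> f) = peval (h \<circ> \<kappa>) (h \<circ> \<alpha>) f"
proof -
  interpret \<kappa>: comm_ring_hom \<kappa> by fact
  interpret h: comm_ring_hom h by fact
  interpret e: comm_ring_hom "peval \<kappa> \<alpha>" by (rule comm_ring_hom_peval) fact
  have "comm_ring_hom (h \<circ> \<kappa>)"
    by (rule comm_ring_homI) (simp_all add: \<kappa>.hom_add \<kappa>.hom_mult h.hom_add h.hom_mult)
  then show ?thesis
    by (rule peval_unique[where N = UNIV])
      (simp_all add: carrier_mpoly_ring e.hom_add e.hom_mult h.hom_add h.hom_mult)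
qed

lemma peval_cong:
  assumes "comm_ring_hom \<kappa>" "f \<in> carrier (mpoly_ring N)" "\<And>x. x \<in> N \<Longrightarrow> \<alpha> x = \<beta> x"
  shows "peval \<kappa> \<alpha> f = peval \<kappa> \<beta> f"
proof -
  interpret \<kappa>: comm_ring_hom \<kappa> by fact
  interpret e: comm_ring_hom "peval \<kappa> \<alpha>" by (rule comm_ring_hom_peval) fact
  show ?thesis by (rule peval_unique[OF assms(1,2)]) (simp_all add: assms e.hom_add e.hom_mult)
qed

lemma peval_closed:
  assumes "comm_ring_hom \<kappa>" "f \<in> carrier (mpoly_ring N)" "\<And>c. \<kappa> c \<in> C" "\<And>x. x \<in> N \<Longrightarrow> \<alpha> x \<in> C"
    "\<And>a b. a \<in> C \<Longrightarrow> b \<in> C \<Longrightarrow> a + b \<in> C" "\<And>a b. a \<in> C \<Longrightarrow> b \<in> C \<Longrightarrow> a * b \<in> C"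
  shows "peval \<kappa> \<alpha> f \<in> C"
proof -
  interpret \<kappa>: comm_ring_hom \<kappa> by fact
  interpret e: comm_ring_hom "peval \<kappa> \<alpha>" by (rule comm_ring_hom_peval) fact
  show ?thesis using assms(2)
    by (induction f rule: mpoly_induct) (simp_all add: assms e.hom_add e.hom_mult)
qed


section \<open>Dual numbers and formal derivatives\<close>

text \<open>\<open>Dual a b\<close> stands for \<open>a + b t\<close> with \<open>t\<^sup>2 = 0\<close>. If the construction is iterated, the second infinitesimal
  is called \<open>e\<close>, and \<open>Dual (Dual a b) (Dual c d)\<close> stands for \<open>a + b t + c e + d t e\<close>. On this ring, \<open>real_part\<close> is
  the reduction modulo \<open>e\<close>, and \<open>map_dual real_part\<close> is the reduction modulo \<open>t\<close>.\<close>

datatype 'a dual = Dual (real_part: 'a) (inf_part: 'a)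

instantiation dual :: (comm_ring_1) comm_ring_1
begin
definition "0 = Dual 0 0"
definition "1 = Dual 1 0"
definition "a + b = Dual (real_part a + real_part b) (inf_part a + inf_part b)"
definition "a - b = Dual (real_part a - real_part b) (inf_part a - inf_part b)"
definition "- a = Dual (- real_part a) (- inf_part a)"
definition "a * b = Dual (real_part a * real_part b) (real_part a * inf_part b + inf_part a * real_part b)"
instance
  by standard (auto simp: zero_dual_def one_dual_def plus_dual_def minus_dual_def uminus_dual_def
      times_dual_def dual.expand algebra_simps)
end

lemma dual_simps [simp]:
  "real_part 0 = 0" "inf_part 0 = 0" "real_part 1 = 1" "inf_part 1 = 0"
  "real_part (a + b) = real_part a + real_part b" "inf_part (a + b) = inf_part a + inf_part b"
  "real_part (a - b) = real_part a - real_part b" "inf_part (a - b) = inf_part a - inf_part b"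
  "real_part (- a) = - real_part a" "inf_part (- a) = - inf_part a"
  "real_part (a * b) = real_part a * real_part b"
  "inf_part (a * b) = real_part a * inf_part b + inf_part a * real_part b"
  by (simp_all add: zero_dual_def one_dual_def plus_dual_def minus_dual_def uminus_dual_def times_dual_def)

lemma dual_sum [simp]:
  "real_part (sum f A) = (\<Sum>x\<in>A. real_part (f x))" "inf_part (sum f A) = (\<Sum>x\<in>A. inf_part (f x))"
  by (induction A rule: infinite_finite_induct) simp_all

definition dual_const :: "'a::comm_ring_1 \<Rightarrow> 'a dual" where
  "dual_const a = Dual a 0"

lemma dual_const_simps [simp]: "real_part (dual_const a) = a" "inf_part (dual_const a) = 0"
  by (simp_all add: dual_const_def)

lemma comm_ring_hom_dual_const: "comm_ring_hom dual_const"
  by (rule comm_ring_homI) (simp_all add: dual.expand)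

lemma comm_ring_hom_real_part: "comm_ring_hom real_part"
  by (rule comm_ring_homI) simp_all

lemma comm_ring_hom_comp: "comm_ring_hom f \<Longrightarrow> comm_ring_hom g \<Longrightarrow> comm_ring_hom (g \<circ> f)"
proof -
  assume "comm_ring_hom f" "comm_ring_hom g"
  then interpret f: comm_ring_hom f + g: comm_ring_hom g .
  show ?thesis by (rule comm_ring_homI) (simp_all add: f.hom_add g.hom_add f.hom_mult g.hom_mult)
qed

lemma comm_ring_hom_map_dual:
  assumes "comm_ring_hom h"
  shows "comm_ring_hom (map_dual h)"
proof -
  interpret comm_ring_hom h by fact
  show ?thesis
    by (rule comm_ring_homI) (simp_all add: dual.expand dual.map_sel hom_add hom_mult)
qed

lemma dual_unit_iff: "a dvd 1 \<longleftrightarrow> real_part a dvd 1" for a :: "'a::comm_ring_1 dual"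
proof
  assume "a dvd 1"
  then obtain b where "1 = a * b" by (auto elim: dvdE)
  then have "1 = real_part a * real_part b" by (metis dual_simps(3,11))
  then show "real_part a dvd 1" by (auto intro: dvdI)
next
  assume "real_part a dvd 1"
  then obtain c where c: "1 = real_part a * c" by (auto elim: dvdE)
  \<comment> \<open>If \<open>c\<close> is inverse to \<open>a\<close>, then \<open>c - b c\<^sup>2 t\<close> is inverse to \<open>a + b t\<close>.\<close>
  have "real_part a * (inf_part a * c * c) = inf_part a * c * (real_part a * c)" by (simp add: ac_simps)
  also have "\<dots> = inf_part a * c" using c by simp
  finally have "1 = a * Dual c (- inf_part a * c * c)" using c by (simp add: dual.expand)
  then show "a dvd 1" by (rule dvdI)
qed

lemma mpderiv_superset:
  assumes "finite A" "Poly_Mapping.keys f \<subseteq> A"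
  shows "mpderiv x f = (\<Sum>m\<in>A. Poly_Mapping.single (m - Poly_Mapping.single x 1)
       (of_nat (Poly_Mapping.lookup m x) * Poly_Mapping.lookup f m))"
  unfolding mpderiv_def
  by (rule sum.mono_neutral_left) (use assms in \<open>auto simp: in_keys_iff\<close>)

lemma mpderiv_add: "mpderiv x (f + g) = mpderiv x f + mpderiv x g"
proof -
  let ?A = "Poly_Mapping.keys f \<union> Poly_Mapping.keys g"
  have "mpderiv x (f + g) = (\<Sum>m\<in>?A. Poly_Mapping.single (m - Poly_Mapping.single x 1)
       (of_nat (Poly_Mapping.lookup m x) * Poly_Mapping.lookup (f + g) m))"
    by (rule mpderiv_superset) (auto simp: in_keys_iff lookup_add)
  also have "\<dots> = mpderiv x f + mpderiv x g"
    by (subst (1 2) mpderiv_superset[of ?A])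
      (simp_all add: lookup_add sum.distrib distrib_left single_add)
  finally show ?thesis .
qed

lemma mpderiv_single: "mpderiv x (Poly_Mapping.single m c) =
    Poly_Mapping.single (m - Poly_Mapping.single x 1) (of_nat (Poly_Mapping.lookup m x) * c)"
  by (cases "c = 0") (simp_all add: mpderiv_def)

lemma mpderiv_0 [simp]: "mpderiv x 0 = 0"
  by (simp add: mpderiv_def)

lemma mpderiv_mconst [simp]: "mpderiv x (mconst c) = 0"
  by (simp add: mconst_def mpderiv_single)

lemma mpderiv_1 [simp]: "mpderiv x 1 = 0"
  using mpderiv_mconst[of x 1] by (simp del: mpderiv_mconst)

lemma mpderiv_mvar: "mpderiv x (mvar y) = (if x = y then 1 else 0)"
  by (auto simp: mvar_def mpderiv_single lookup_single)

lemma mpderiv_mult: "mpderiv x (f * g) = f * mpderiv x g + mpderiv x f * g"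
proof (induction f rule: poly_mapping_single_add_induct)
  case (single m c)
  show ?case
  proof (induction g rule: poly_mapping_single_add_induct)
    case (single n d)
    let ?e = "Poly_Mapping.single x (1::nat)"
    have 1: "m + (n - ?e) = m + n - ?e" if "Poly_Mapping.lookup n x \<noteq> 0"
      by (rule poly_mapping_eqI) (use that in \<open>auto simp: lookup_add lookup_minus lookup_single when_def\<close>)
    have 2: "(m - ?e) + n = m + n - ?e" if "Poly_Mapping.lookup m x \<noteq> 0"
      by (rule poly_mapping_eqI) (use that in \<open>auto simp: lookup_add lookup_minus lookup_single when_def\<close>)
    have "Poly_Mapping.single m c * mpderiv x (Poly_Mapping.single n d) =
        Poly_Mapping.single (m + n - ?e) (of_nat (Poly_Mapping.lookup n x) * (c * d))"
      using 1 by (cases "Poly_Mapping.lookup n x = 0") (simp_all add: mpderiv_single mult_single ac_simps)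
    moreover have "mpderiv x (Poly_Mapping.single m c) * Poly_Mapping.single n d =
        Poly_Mapping.single (m + n - ?e) (of_nat (Poly_Mapping.lookup m x) * (c * d))"
      using 2 by (cases "Poly_Mapping.lookup m x = 0") (simp_all add: mpderiv_single mult_single ac_simps)
    ultimately show ?case
      by (simp add: mult_single mpderiv_single lookup_add single_add[symmetric] algebra_simps)
  qed (simp_all add: mpderiv_add algebra_simps)
qed (simp_all add: mpderiv_add algebra_simps)

lemma mpderiv_sum: "mpderiv x (sum f A) = (\<Sum>i\<in>A. mpderiv x (f i))"
  by (induction A rule: infinite_finite_induct) (simp_all add: mpderiv_add)

lemma mpderiv_closed:
  assumes "f \<in> carrier (mpoly_ring N)"
  shows "mpderiv x f \<in> carrier (mpoly_ring N)"
  using assms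
  by (induction f rule: mpoly_induct) (auto simp: mpderiv_mvar mpderiv_add mpderiv_mult intro!: mpoly_closed)

text \<open>The Taylor formula to first order: both sides are homomorphisms in \<open>f\<close>, by the product rule.\<close>

lemma peval_dual:
  fixes \<kappa> :: "'k::comm_ring_1 \<Rightarrow> 'a::comm_ring_1"
  assumes "comm_ring_hom \<kappa>" "finite N" "f \<in> carrier (mpoly_ring N)"
  shows "peval (dual_const \<circ> \<kappa>) \<alpha> f =
    Dual (peval \<kappa> (\<lambda>x. real_part (\<alpha> x)) f) (\<Sum>x\<in>N. inf_part (\<alpha> x) * peval \<kappa> (\<lambda>x. real_part (\<alpha> x)) (mpderiv x f))"
proof -
  let ?\<theta> = "\<lambda>f. Dual (peval \<kappa> (\<lambda>x. real_part (\<alpha> x)) f)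
    (\<Sum>x\<in>N. inf_part (\<alpha> x) * peval \<kappa> (\<lambda>x. real_part (\<alpha> x)) (mpderiv x f))"
  interpret \<kappa>: comm_ring_hom \<kappa> by fact
  interpret e: comm_ring_hom "peval \<kappa> (\<lambda>x. real_part (\<alpha> x))" by (rule comm_ring_hom_peval) fact
  have "?\<theta> f = peval (dual_const \<circ> \<kappa>) \<alpha> f"
  proof (rule peval_unique[OF comm_ring_hom_comp[OF assms(1) comm_ring_hom_dual_const] assms(3)])
    fix x assume "x \<in> N"
    then show "?\<theta> (mvar x) = \<alpha> x"
      using assms(2) by (simp add: mpderiv_mvar dual.expand if_distrib sum.delta cong: if_cong)
  next
    fix f g :: "('b, 'k) mpoly"
    show "?\<theta> (f * g) = ?\<theta> f * ?\<theta> g"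
      by (simp add: dual.expand mpderiv_mult e.hom_add e.hom_mult sum.distrib algebra_simps
          sum_distrib_left)
  qed (simp_all add: dual.expand dual_const_def e.hom_zero mpderiv_add e.hom_add sum.distrib algebra_simps)
  then show ?thesis by simp
qed


section \<open>Ideals of the polynomial ring\<close>

lemma mpoly_ideal_closed:
  fixes I :: "('x, 'k::comm_ring_1) mpoly set"
  assumes "ideal I (mpoly_ring N)"
  shows "f \<in> I \<Longrightarrow> f \<in> carrier (mpoly_ring N)" "0 \<in> I" "f \<in> I \<Longrightarrow> g \<in> I \<Longrightarrow> f + g \<in> I"
    "f \<in> I \<Longrightarrow> h \<in> carrier (mpoly_ring N) \<Longrightarrow> h * f \<in> I"
    "f \<in> I \<Longrightarrow> h \<in> carrier (mpoly_ring N) \<Longrightarrow> f * h \<in> I"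
    "f \<in> I \<Longrightarrow> - f \<in> I" "f \<in> I \<Longrightarrow> g \<in> I \<Longrightarrow> f - g \<in> I"
proof -
  interpret ideal I "mpoly_ring N" by fact
  show sub: "f \<in> I \<Longrightarrow> f \<in> carrier (mpoly_ring N)" for f using a_subset by auto
  show "0 \<in> I" using additive_subgroup.zero_closed[OF is_additive_subgroup] by simp
  show add: "f \<in> I \<Longrightarrow> g \<in> I \<Longrightarrow> f + g \<in> I" for f g
    using additive_subgroup.a_closed[OF is_additive_subgroup, of f g] by simp
  show left: "f \<in> I \<Longrightarrow> h \<in> carrier (mpoly_ring N) \<Longrightarrow> h * f \<in> I" for f h using I_l_closed by simp
  show "f \<in> I \<Longrightarrow> h \<in> carrier (mpoly_ring N) \<Longrightarrow> f * h \<in> I" using I_r_closed by simp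
  show neg: "f \<in> I \<Longrightarrow> - f \<in> I" for f
    using left[of f "-1"] by (simp add: mpoly_closed)
  show "f \<in> I \<Longrightarrow> g \<in> I \<Longrightarrow> f - g \<in> I" using add[of f "- g"] neg by simp
qed

lemma mpoly_idealI:
  fixes I :: "('x, 'k::comm_ring_1) mpoly set"
  assumes "I \<subseteq> carrier (mpoly_ring N)" "0 \<in> I" "\<And>f g. f \<in> I \<Longrightarrow> g \<in> I \<Longrightarrow> f + g \<in> I"
    "\<And>f h. f \<in> I \<Longrightarrow> h \<in> carrier (mpoly_ring N) \<Longrightarrow> h * f \<in> I"
  shows "ideal I (mpoly_ring N)"
proof (rule idealI)
  interpret cring "mpoly_ring N :: ('x, 'k) mpoly ring" by (rule cring_mpoly_ring)
  show "ring (mpoly_ring N :: ('x, 'k) mpoly ring)" by (rule ring_axioms)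
  show "subgroup I (add_monoid (mpoly_ring N))"
  proof (rule group.subgroupI)
    show "Group.group (add_monoid (mpoly_ring N :: ('x, 'k) mpoly ring))" using a_comm_group by (rule comm_group.axioms)
    fix f assume f: "f \<in> I"
    then have "- f \<in> I" using assms(4)[of f "-1"] by (simp add: mpoly_closed)
    moreover have "inv\<^bsub>add_monoid (mpoly_ring N)\<^esub> f = - f"
      using minus_equality[of "- f" f] f assms(1) by (auto simp: a_inv_def intro!: mpoly_closed)
    ultimately show "inv\<^bsub>add_monoid (mpoly_ring N)\<^esub> f \<in> I" by simp
  qed (use assms in auto)
qed (use assms in \<open>auto simp: mult.commute\<close>)

lemma mpoly_prime_closed:
  fixes I :: "('x, 'k::comm_ring_1) mpoly set"
  assumes "primeideal I (mpoly_ring N)"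
  shows "ideal I (mpoly_ring N)" "1 \<notin> I"
    "f * g \<in> I \<Longrightarrow> f \<in> carrier (mpoly_ring N) \<Longrightarrow> g \<in> carrier (mpoly_ring N) \<Longrightarrow> f \<in> I \<or> g \<in> I"
proof -
  interpret primeideal I "mpoly_ring N" by fact
  show "ideal I (mpoly_ring N)" by (rule is_ideal)
  show "1 \<notin> I" using one_imp_carrier I_notcarr by auto
  show "f * g \<in> I \<Longrightarrow> f \<in> carrier (mpoly_ring N) \<Longrightarrow> g \<in> carrier (mpoly_ring N) \<Longrightarrow> f \<in> I \<or> g \<in> I"
    using I_prime by simp
qed

lemma mpoly_primeI:
  fixes I :: "('x, 'k::comm_ring_1) mpoly set"
  assumes "ideal I (mpoly_ring N)" "1 \<notin> I"
    "\<And>f g. f * g \<in> I \<Longrightarrow> f \<in> carrier (mpoly_ring N) \<Longrightarrow> g \<in> carrier (mpoly_ring N) \<Longrightarrow> f \<in> I \<or> g \<in> I"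
  shows "primeideal I (mpoly_ring N)"
  by (rule primeidealI) (use assms mpoly_closed_1[of N] in \<open>auto intro: cring_mpoly_ring\<close>)

lemma mpoly_genideal:
  fixes F :: "('x, 'k::comm_ring_1) mpoly set"
  assumes "F \<subseteq> carrier (mpoly_ring N)"
  shows "ideal (genideal (mpoly_ring N) F) (mpoly_ring N)" "F \<subseteq> genideal (mpoly_ring N) F"
    "ideal I (mpoly_ring N) \<Longrightarrow> F \<subseteq> I \<Longrightarrow> genideal (mpoly_ring N) F \<subseteq> I"
proof -
  interpret cring "mpoly_ring N :: ('x, 'k) mpoly ring" by (rule cring_mpoly_ring)
  show "ideal (genideal (mpoly_ring N) F) (mpoly_ring N)" "F \<subseteq> genideal (mpoly_ring N) F"
    "ideal I (mpoly_ring N) \<Longrightarrow> F \<subseteq> I \<Longrightarrow> genideal (mpoly_ring N) F \<subseteq> I"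
    using genideal_ideal[OF assms] genideal_self[OF assms] genideal_minimal by auto
qed

lemma mpoly_ideal_sum:
  assumes "ideal I (mpoly_ring N)" "\<And>i. i \<in> A \<Longrightarrow> f i \<in> I"
  shows "sum f A \<in> I"
  using assms(2) by (induction A rule: infinite_finite_induct) (auto intro: mpoly_ideal_closed[OF assms(1)])

lemma mpoly_prime_prod:
  assumes "primeideal p (mpoly_ring N)" "\<And>i. i \<in> A \<Longrightarrow> f i \<in> carrier (mpoly_ring N)" "\<And>i. i \<in> A \<Longrightarrow> f i \<notin> p"
  shows "prod f A \<notin> p"
  using assms(2-)
proof (induction A rule: infinite_finite_induct)
  case (insert x F)
  then show ?case using mpoly_prime_closed(3)[OF assms(1), of "f x" "prod f F"] by (auto intro: mpoly_closed)
qed (use mpoly_prime_closed(2)[OF assms(1)] in auto)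

lemma mpoly_prime_power:
  assumes "primeideal p (mpoly_ring N)" "f \<in> carrier (mpoly_ring N)" "f \<notin> p"
  shows "f ^ n \<notin> p"
  using mpoly_prime_prod[OF assms(1), of "{..<n}" "\<lambda>_. f"] assms by simp

lemma ideal_kernel:
  assumes "comm_ring_hom e"
  shows "ideal {f \<in> carrier (mpoly_ring N). e f = 0} (mpoly_ring N)"
proof -
  interpret comm_ring_hom e by fact
  show ?thesis by (rule mpoly_idealI) (auto simp: hom_add hom_mult intro: mpoly_closed)
qed

lemma genideal_eval_zero:
  assumes "comm_ring_hom e" "F \<subseteq> carrier (mpoly_ring N)" "\<And>f. f \<in> F \<Longrightarrow> e f = 0" "f \<in> genideal (mpoly_ring N) F"
  shows "e f = 0"
  using mpoly_genideal(3)[OF assms(2) ideal_kernel[OF assms(1)]] assms(2-) by blast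

section \<open>Spectra of graded rings\<close>

text \<open>For a prime ideal \<open>q\<close>, both \<open>f \<notin> q\<close> and \<open>g \<notin> q\<close> hold if and only if \<open>f g \<notin> q\<close>. So the sets that
  generate the topology are closed under intersection, and hence they are a basis.\<close>

lemma openin_zariski_iff:
  assumes prime: "\<And>p. p \<in> P \<Longrightarrow> primeideal p (mpoly_ring N)"
  shows "openin (zariski_topology (mpoly_ring N) P) U \<longleftrightarrow>
    U \<subseteq> P \<and> (\<forall>p\<in>U. \<exists>f\<in>carrier (mpoly_ring N). f \<notin> p \<and> {q \<in> P. f \<notin> q} \<subseteq> U)"
proof
  assume "openin (zariski_topology (mpoly_ring N) P) U"
  then have "generate_topology_on {{p \<in> P. f \<notin> p} | f. f \<in> carrier (mpoly_ring N)} U"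
    by (simp add: zariski_topology_def openin_topology_generated_by_iff)
  then show "U \<subseteq> P \<and> (\<forall>p\<in>U. \<exists>f\<in>carrier (mpoly_ring N). f \<notin> p \<and> {q \<in> P. f \<notin> q} \<subseteq> U)"
  proof induction
    case (Int a b)
    show ?case
    proof (intro conjI ballI)
      show "a \<inter> b \<subseteq> P" using Int by blast
      fix p assume "p \<in> a \<inter> b"
      then have p: "p \<in> a" "p \<in> b" by auto
      then obtain f g where f: "f \<in> carrier (mpoly_ring N)" "f \<notin> p" "{q \<in> P. f \<notin> q} \<subseteq> a"
        and g: "g \<in> carrier (mpoly_ring N)" "g \<notin> p" "{q \<in> P. g \<notin> q} \<subseteq> b"
        using Int by meson
      have "p \<in> P" using p Int by blast
      with prime have "f * g \<notin> p" using f g mpoly_prime_closed(3) by blast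
      moreover have "{q \<in> P. f * g \<notin> q} \<subseteq> a \<inter> b"
      proof safe
        fix q assume q: "q \<in> P" "f * g \<notin> q"
        then have "f \<notin> q" "g \<notin> q"
          using mpoly_ideal_closed(4,5)[OF mpoly_prime_closed(1)[OF prime[OF q(1)]]] f g by blast+
        then show "q \<in> a" "q \<in> b" using f g q by auto
      qed
      ultimately show "\<exists>f\<in>carrier (mpoly_ring N). f \<notin> p \<and> {q \<in> P. f \<notin> q} \<subseteq> a \<inter> b"
        using f g by (intro bexI[of _ "f * g"]) (auto intro: mpoly_closed)
    qed
  next
    case (UN K)
    show ?case
    proof (intro conjI ballI)
      show "\<Union> K \<subseteq> P" using UN by blast
      fix p assume "p \<in> \<Union> K"
      then obtain k where k: "k \<in> K" "p \<in> k" by blast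
      then obtain f where "f \<in> carrier (mpoly_ring N)" "f \<notin> p" "{q \<in> P. f \<notin> q} \<subseteq> k" using UN by meson
      with k show "\<exists>f\<in>carrier (mpoly_ring N). f \<notin> p \<and> {q \<in> P. f \<notin> q} \<subseteq> \<Union> K" by blast
    qed
  qed blast+
next
  assume U: "U \<subseteq> P \<and> (\<forall>p\<in>U. \<exists>f\<in>carrier (mpoly_ring N). f \<notin> p \<and> {q \<in> P. f \<notin> q} \<subseteq> U)"
  show "openin (zariski_topology (mpoly_ring N) P) U"
  proof (subst openin_subopen, intro ballI)
    fix p assume "p \<in> U"
    with U obtain f where f: "f \<in> carrier (mpoly_ring N)" "f \<notin> p" "{q \<in> P. f \<notin> q} \<subseteq> U" by blast
    have "openin (zariski_topology (mpoly_ring N) P) {q \<in> P. f \<notin> q}"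
      unfolding zariski_topology_def by (rule topology_generated_by_Basis) (use f in auto)
    then show "\<exists>V. openin (zariski_topology (mpoly_ring N) P) V \<and> p \<in> V \<and> V \<subseteq> U"
      using f U \<open>p \<in> U\<close> by blast
  qed
qed

text \<open>The common properties of the affine case, where \<open>H\<close> has one element, and of the multihomogeneous
  case. All constants are in one part because the structure map uses them as numerators with denominator \<open>1\<close>.\<close>

locale graded_fractions =
  fixes N :: "'x set" and H :: "('x, 'k::field) mpoly set set" and J :: "('x, 'k) mpoly set"
    and P :: "('x, 'k) mpoly set set"
  assumes H_carrier: "h \<in> H \<Longrightarrow> a \<in> h \<Longrightarrow> a \<in> carrier (mpoly_ring N)"
    and H_add: "h \<in> H \<Longrightarrow> a \<in> h \<Longrightarrow> b \<in> h \<Longrightarrow> a + b \<in> h"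
    and H_mult: "h \<in> H \<Longrightarrow> h' \<in> H \<Longrightarrow> \<exists>h''\<in>H. \<forall>a\<in>h. \<forall>b\<in>h'. a * b \<in> h''"
    and H_const: "\<exists>h\<in>H. \<forall>c. mconst c \<in> h"
    and J_ideal: "ideal J (mpoly_ring N)"
    and P_prime: "p \<in> P \<Longrightarrow> primeideal p (mpoly_ring N)"
begin

abbreviation T where "T \<equiv> zariski_topology (mpoly_ring N) P"

abbreviation space where "space \<equiv> fraction_space (mpoly_ring N) H J P"

abbreviation frac where "frac \<equiv> fraction H J"

text \<open>The pairs that represent an element of the stalk at \<open>p\<close>.\<close>

definition valid :: "('x, 'k) mpoly set \<Rightarrow> ('x, 'k) mpoly \<Rightarrow> ('x, 'k) mpoly \<Rightarrow> bool" where
  "valid p a b \<longleftrightarrow> (\<exists>h\<in>H. a \<in> h \<and> b \<in> h) \<and> b \<notin> p"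

lemma validI: "h \<in> H \<Longrightarrow> a \<in> h \<Longrightarrow> b \<in> h \<Longrightarrow> b \<notin> p \<Longrightarrow> valid p a b"
  by (auto simp: valid_def)

lemma valid_carrier: "valid p a b \<Longrightarrow> a \<in> carrier (mpoly_ring N)" "valid p a b \<Longrightarrow> b \<in> carrier (mpoly_ring N)"
  by (auto simp: valid_def intro: H_carrier)

lemma prime_mult: "p \<in> P \<Longrightarrow> f \<in> carrier (mpoly_ring N) \<Longrightarrow> g \<in> carrier (mpoly_ring N) \<Longrightarrow>
    f \<notin> p \<Longrightarrow> g \<notin> p \<Longrightarrow> f * g \<notin> p"
  using mpoly_prime_closed(3)[OF P_prime] by blast

lemma valid_mult: "p \<in> P \<Longrightarrow> valid p a b \<Longrightarrow> valid p c d \<Longrightarrow> valid p (a * c) (b * d)"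
proof -
  assume *: "p \<in> P" "valid p a b" "valid p c d"
  obtain h h' where h: "h \<in> H" "a \<in> h" "b \<in> h" "b \<notin> p" "h' \<in> H" "c \<in> h'" "d \<in> h'" "d \<notin> p"
    using * by (auto simp: valid_def)
  then obtain h'' where h'': "h'' \<in> H" "\<And>a b. a \<in> h \<Longrightarrow> b \<in> h' \<Longrightarrow> a * b \<in> h''" using H_mult by meson
  show ?thesis
    by (rule validI[OF h''(1)])
      (use h h'' prime_mult[OF *(1) H_carrier[OF h(1,3)] H_carrier[OF h(5,7)]] in auto)
qed

lemma valid_add:
  assumes "p \<in> P" "valid p a b" "valid p c d"
  shows "valid p (a * d + c * b) (b * d)"
proof -
  obtain h h' where h: "h \<in> H" "a \<in> h" "b \<in> h" "b \<notin> p" "h' \<in> H" "c \<in> h'" "d \<in> h'" "d \<notin> p"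
    using assms by (auto simp: valid_def)
  then obtain h'' where h'': "h'' \<in> H" "\<And>a b. a \<in> h \<Longrightarrow> b \<in> h' \<Longrightarrow> a * b \<in> h''" using H_mult by meson
  show ?thesis
    by (rule validI[OF h''(1)])
      (use h h'' prime_mult[OF assms(1) H_carrier[OF h(1,3)] H_carrier[OF h(5,7)]] in
        \<open>auto simp: mult.commute[of c] intro!: H_add\<close>)
qed

lemma valid_const: "p \<in> P \<Longrightarrow> valid p (mconst c) 1"
  using H_const mpoly_prime_closed(2)[OF P_prime] unfolding valid_def by (metis mconst_1)

lemma mem_frac: "(c, d) \<in> frac p a b \<longleftrightarrow>
    valid p c d \<and> (\<exists>h\<in>H. \<exists>t\<in>h. t \<notin> p \<and> t * (a * d - c * b) \<in> J)"
  by (auto simp: fraction_def valid_def)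

lemma one_homogeneous: "p \<in> P \<Longrightarrow> \<exists>h\<in>H. 1 \<in> h \<and> 1 \<notin> p"
  using valid_const[of p 1] by (auto simp: valid_def)

lemma frac_self: "p \<in> P \<Longrightarrow> valid p a b \<Longrightarrow> (a, b) \<in> frac p a b"
  using one_homogeneous[of p] mpoly_ideal_closed(2)[OF J_ideal] by (auto simp: mem_frac)

text \<open>Transitivity of the relation between fractions: if \<open>t\<close> and \<open>t'\<close> witness that \<open>c/d\<close> and \<open>e/f\<close> are equal to
  \<open>a/b\<close>, then \<open>t t' b\<close> witnesses that they are equal to each other.\<close>

lemma frac_subset:
  assumes "p \<in> P" "valid p a b" "(c, d) \<in> frac p a b"
  shows "frac p a b \<subseteq> frac p c d"
proof (intro subrelI)
  fix e f assume ef: "(e, f) \<in> frac p a b"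
  obtain h t where t: "h \<in> H" "t \<in> h" "t \<notin> p" "t * (a * d - c * b) \<in> J" using assms by (auto simp: mem_frac)
  obtain h' t' where t': "h' \<in> H" "t' \<in> h'" "t' \<notin> p" "t' * (a * f - e * b) \<in> J" using ef by (auto simp: mem_frac)
  have vf: "valid p e f" and vd: "valid p c d" using ef assms by (auto simp: mem_frac)
  obtain h1 where h1: "h1 \<in> H" "a \<in> h1" "b \<in> h1" "b \<notin> p" using assms by (auto simp: valid_def)
  obtain h2 where h2: "h2 \<in> H" "t * t' \<in> h2" using H_mult t t' by meson
  obtain h3 where h3: "h3 \<in> H" "(t * t') * b \<in> h3" using H_mult h1 h2 by meson
  have car: "t \<in> carrier (mpoly_ring N)" "t' \<in> carrier (mpoly_ring N)" "b \<in> carrier (mpoly_ring N)"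
    using H_carrier t t' h1 by blast+
  then have "t * t' * b \<notin> p" using t t' h1 assms(1) by (intro prime_mult mpoly_closed) auto
  moreover have "t * t' * b * (c * f - e * d) =
      (t' * (a * f - e * b)) * (t * d) - (t * (a * d - c * b)) * (t' * f)"
    by (simp add: algebra_simps)
  moreover have "\<dots> \<in> J"
    by (rule mpoly_ideal_closed(7)[OF J_ideal mpoly_ideal_closed(5)[OF J_ideal t'(4)] mpoly_ideal_closed(5)[OF J_ideal t(4)]])
      (use car valid_carrier[OF vf] valid_carrier[OF vd] in \<open>auto intro: mpoly_closed\<close>)
  ultimately show "(e, f) \<in> frac p c d"
    using h3 vf unfolding mem_frac by metis
qed

lemma frac_sym:
  assumes "valid p a b" "(c, d) \<in> frac p a b"
  shows "(a, b) \<in> frac p c d"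
proof -
  obtain h t where t: "h \<in> H" "t \<in> h" "t \<notin> p" "t * (a * d - c * b) \<in> J" using assms by (auto simp: mem_frac)
  then have "- (t * (a * d - c * b)) \<in> J" by (intro mpoly_ideal_closed(6)[OF J_ideal])
  then have "t * (c * b - a * d) \<in> J" by (simp add: algebra_simps)
  then show ?thesis using t assms by (auto simp: mem_frac)
qed

lemma frac_eqI:
  assumes "p \<in> P" "valid p a b" "(c, d) \<in> frac p a b"
  shows "frac p a b = frac p c d"
proof
  have "valid p c d" using assms(3) by (simp add: mem_frac)
  then show "frac p c d \<subseteq> frac p a b" by (rule frac_subset[OF assms(1) _ frac_sym[OF assms(2,3)]])
qed (rule frac_subset[OF assms])

lemma frac_eq_iff:
  assumes "p \<in> P" "valid p a b" "valid p c d"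
  shows "frac p a b = frac p c d \<longleftrightarrow> (\<exists>h\<in>H. \<exists>t\<in>h. t \<notin> p \<and> t * (a * d - c * b) \<in> J)"
proof
  assume "frac p a b = frac p c d"
  then show "\<exists>h\<in>H. \<exists>t\<in>h. t \<notin> p \<and> t * (a * d - c * b) \<in> J"
    using frac_self[OF assms(1,3)] mem_frac[of c d p a b] by simp
qed (use frac_eqI[OF assms(1,2), of c d] assms(3) in \<open>simp add: mem_frac\<close>)

lemma frac_eq_cross: "p \<in> P \<Longrightarrow> valid p a b \<Longrightarrow> valid p c d \<Longrightarrow> a * d - c * b \<in> J \<Longrightarrow> frac p a b = frac p c d"
  using one_homogeneous[of p] by (subst frac_eq_iff) (auto intro!: bexI[of _ 1])

text \<open>The union in the definition of the product is over representatives. All of its members are the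
  same class, which is why it is the class of the product of any two representatives.\<close>

lemma frac_mult:
  assumes p: "p \<in> P" "valid p a b" "valid p c d"
  shows "fraction_mult H J p (frac p a b) (frac p c d) = frac p (a * c) (b * d)"
proof -
  have "frac p (a' * c') (b' * d') = frac p (a * c) (b * d)"
    if m: "(a', b') \<in> frac p a b" "(c', d') \<in> frac p c d" for a' b' c' d'
  proof -
    obtain h t where t: "h \<in> H" "t \<in> h" "t \<notin> p" "t * (a * b' - a' * b) \<in> J" using m by (auto simp: mem_frac)
    obtain h' t' where t': "h' \<in> H" "t' \<in> h'" "t' \<notin> p" "t' * (c * d' - c' * d) \<in> J" using m by (auto simp: mem_frac)
    obtain h2 where h2: "h2 \<in> H" "t * t' \<in> h2" using H_mult t t' by meson
    have v: "valid p a' b'" "valid p c' d'" using m by (auto simp: mem_frac)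
    have car: "t \<in> carrier (mpoly_ring N)" "t' \<in> carrier (mpoly_ring N)"
      using H_carrier t t' by blast+
    have "t * t' * ((a * c) * (b' * d') - (a' * c') * (b * d)) =
      (t * (a * b' - a' * b)) * (t' * (c * d')) + (t' * (c * d' - c' * d)) * (t * (a' * b))"
      by (simp add: algebra_simps)
    also have "\<dots> \<in> J"
      by (rule mpoly_ideal_closed(3)[OF J_ideal mpoly_ideal_closed(5)[OF J_ideal t(4)] mpoly_ideal_closed(5)[OF J_ideal t'(4)]])
        (use car valid_carrier[OF v(1)] valid_carrier[OF v(2)] valid_carrier[OF p(2)] valid_carrier[OF p(3)] in
          \<open>auto intro: mpoly_closed\<close>)
    finally show ?thesis
      using h2 prime_mult[OF p(1) car t(3) t'(3)]
      by (subst eq_commute, subst frac_eq_iff[OF p(1)]) (use p v in \<open>auto intro: valid_mult\<close>)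
  qed
  then have "fraction_mult H J p (frac p a b) (frac p c d) =
      (\<Union>(a', b')\<in>frac p a b. \<Union>(c', d')\<in>frac p c d. frac p (a * c) (b * d))"
    unfolding fraction_mult_def by (intro SUP_cong refl) (auto intro!: SUP_cong)
  then show ?thesis using frac_self[OF p(1,2)] frac_self[OF p(1,3)] by auto
qed

lemma frac_add:
  assumes p: "p \<in> P" "valid p a b" "valid p c d"
  shows "fraction_add H J p (frac p a b) (frac p c d) = frac p (a * d + c * b) (b * d)"
proof -
  have "frac p (a' * d' + c' * b') (b' * d') = frac p (a * d + c * b) (b * d)"
    if m: "(a', b') \<in> frac p a b" "(c', d') \<in> frac p c d" for a' b' c' d'
  proof -
    obtain h t where t: "h \<in> H" "t \<in> h" "t \<notin> p" "t * (a * b' - a' * b) \<in> J" using m by (auto simp: mem_frac)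
    obtain h' t' where t': "h' \<in> H" "t' \<in> h'" "t' \<notin> p" "t' * (c * d' - c' * d) \<in> J" using m by (auto simp: mem_frac)
    obtain h2 where h2: "h2 \<in> H" "t * t' \<in> h2" using H_mult t t' by meson
    have v: "valid p a' b'" "valid p c' d'" using m by (auto simp: mem_frac)
    have car: "t \<in> carrier (mpoly_ring N)" "t' \<in> carrier (mpoly_ring N)"
      using H_carrier t t' by blast+
    have "t * t' * ((a * d + c * b) * (b' * d') - (a' * d' + c' * b') * (b * d)) =
      (t * (a * b' - a' * b)) * (t' * (d * d')) + (t' * (c * d' - c' * d)) * (t * (b * b'))"
      by (simp add: algebra_simps)
    also have "\<dots> \<in> J"
      by (rule mpoly_ideal_closed(3)[OF J_ideal mpoly_ideal_closed(5)[OF J_ideal t(4)] mpoly_ideal_closed(5)[OF J_ideal t'(4)]])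
        (use car valid_carrier[OF v(1)] valid_carrier[OF v(2)] valid_carrier[OF p(2)] valid_carrier[OF p(3)] in
          \<open>auto intro: mpoly_closed\<close>)
    finally show ?thesis
      using h2 prime_mult[OF p(1) car t(3) t'(3)]
      by (subst eq_commute, subst frac_eq_iff[OF p(1)]) (use p v in \<open>auto intro: valid_add\<close>)
  qed
  then have "fraction_add H J p (frac p a b) (frac p c d) =
      (\<Union>(a', b')\<in>frac p a b. \<Union>(c', d')\<in>frac p c d. frac p (a * d + c * b) (b * d))"
    unfolding fraction_add_def by (intro SUP_cong refl) (auto intro!: SUP_cong)
  then show ?thesis using frac_self[OF p(1,2)] frac_self[OF p(1,3)] by auto
qed

lemma openin_T_iff: "openin T U \<longleftrightarrow>
    U \<subseteq> P \<and> (\<forall>p\<in>U. \<exists>f\<in>carrier (mpoly_ring N). f \<notin> p \<and> {q \<in> P. f \<notin> q} \<subseteq> U)"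
  by (rule openin_zariski_iff) (rule P_prime)

lemma openin_basic: "f \<in> carrier (mpoly_ring N) \<Longrightarrow> openin T {q \<in> P. f \<notin> q}"
  unfolding openin_T_iff by blast

lemma topspace_T: "topspace T = P"
proof
  have "P \<subseteq> {q \<in> P. 1 \<notin> q}" using mpoly_prime_closed(2)[OF P_prime] by blast
  then show "P \<subseteq> topspace T" using openin_subset[OF openin_basic[OF mpoly_closed_1]] by blast
  show "topspace T \<subseteq> P" using openin_topspace[of T] openin_T_iff by blast
qed

abbreviation sections where "sections \<equiv> fraction_sections T H J"

definition frac_section where "frac_section U a b = (\<lambda>q\<in>U. frac q a b)"

lemma frac_section_apply: "q \<in> U \<Longrightarrow> frac_section U a b q = frac q a b"
  by (simp add: frac_section_def)

lemma sectionI: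
  assumes "s \<in> extensional U"
    "\<And>p. p \<in> U \<Longrightarrow> \<exists>W h a b. openin T W \<and> p \<in> W \<and> W \<subseteq> U \<and> h \<in> H \<and> a \<in> h \<and> b \<in> h \<and>
      (\<forall>q\<in>W. b \<notin> q \<and> s q = frac q a b)"
  shows "s \<in> sections U"
proof -
  have "\<exists>W. openin T W \<and> p \<in> W \<and> W \<subseteq> U \<and> (\<exists>h\<in>H. \<exists>a\<in>h. \<exists>b\<in>h. \<forall>q\<in>W. b \<notin> q \<and> s q = frac q a b)"
    if p: "p \<in> U" for p
  proof -
    obtain W h a b where "openin T W" "p \<in> W" "W \<subseteq> U" "h \<in> H" "a \<in> h" "b \<in> h"
      "\<forall>q\<in>W. b \<notin> q \<and> s q = frac q a b"
      using assms(2)[OF p] by (elim exE conjE)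
    then show ?thesis by (intro exI[of _ W] conjI bexI)
  qed
  then show ?thesis using assms(1) by (simp add: fraction_sections_def)
qed

lemma frac_section_closed: "openin T U \<Longrightarrow> h \<in> H \<Longrightarrow> a \<in> h \<Longrightarrow> b \<in> h \<Longrightarrow> (\<And>q. q \<in> U \<Longrightarrow> b \<notin> q) \<Longrightarrow>
    frac_section U a b \<in> sections U"
  by (rule sectionI, simp add: frac_section_def)
    (intro exI[of _ U] exI[of _ h] exI[of _ a] exI[of _ b], simp add: frac_section_def)

lemma section_local:
  assumes "s \<in> sections U" "p \<in> U"
  obtains W h a b where "openin T W" "p \<in> W" "W \<subseteq> U" "h \<in> H" "a \<in> h" "b \<in> h"
    "\<And>q. q \<in> W \<Longrightarrow> b \<notin> q" "\<And>q. q \<in> W \<Longrightarrow> s q = frac q a b"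
proof -
  have "\<exists>W. openin T W \<and> p \<in> W \<and> W \<subseteq> U \<and> (\<exists>h\<in>H. \<exists>a\<in>h. \<exists>b\<in>h. \<forall>q\<in>W. b \<notin> q \<and> s q = frac q a b)"
    using assms by (simp add: fraction_sections_def)
  then obtain W h a b where "openin T W" "p \<in> W" "W \<subseteq> U" "h \<in> H" "a \<in> h" "b \<in> h"
    "\<forall>q\<in>W. b \<notin> q \<and> s q = frac q a b" by (elim exE conjE bexE)
  then show thesis by (intro that[of W h a b]) simp_all
qed

lemma section_at:
  assumes "s \<in> sections U" "p \<in> U"
  obtains a b where "valid p a b" "s p = frac p a b"
proof (rule section_local[OF assms])
  fix W h a b assume "p \<in> W" "h \<in> H" "a \<in> h" "b \<in> h"
    "\<And>q. q \<in> W \<Longrightarrow> b \<notin> q" "\<And>q. q \<in> W \<Longrightarrow> s q = frac q a b"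
  then show thesis by (intro that[of a b] validI[of h]) simp_all
qed

lemma section_extensional: "s \<in> sections U \<Longrightarrow> s \<in> extensional U"
  by (simp add: fraction_sections_def)

lemma space_simps [simp]:
  "Top space = T"
  "carrier (Sec space U) = sections U"
  "s \<otimes>\<^bsub>Sec space U\<^esub> t = (\<lambda>p\<in>U. fraction_mult H J p (s p) (t p))"
  "s \<oplus>\<^bsub>Sec space U\<^esub> t = (\<lambda>p\<in>U. fraction_add H J p (s p) (t p))"
  "\<one>\<^bsub>Sec space U\<^esub> = frac_section U 1 1"
  "Res space U V s = restrict s V"
  "Sca space U c = frac_section U (mconst c) 1"
  by (simp_all add: fraction_space_def frac_section_def)

lemma frac_section_mult:
  assumes "U \<subseteq> P" "\<And>q. q \<in> U \<Longrightarrow> valid q a b" "\<And>q. q \<in> U \<Longrightarrow> valid q c d"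
  shows "frac_section U a b \<otimes>\<^bsub>Sec space U\<^esub> frac_section U c d = frac_section U (a * c) (b * d)"
  using assms by (simp add: frac_section_def frac_mult subset_iff cong: restrict_cong)

lemma frac_section_add:
  assumes "U \<subseteq> P" "\<And>q. q \<in> U \<Longrightarrow> valid q a b" "\<And>q. q \<in> U \<Longrightarrow> valid q c d"
  shows "frac_section U a b \<oplus>\<^bsub>Sec space U\<^esub> frac_section U c d = frac_section U (a * d + c * b) (b * d)"
  using assms by (simp add: frac_section_def frac_add subset_iff cong: restrict_cong)

lemma frac_section_eq:
  assumes "U \<subseteq> P" "\<And>q. q \<in> U \<Longrightarrow> valid q a b" "\<And>q. q \<in> U \<Longrightarrow> valid q c d" "a * d - c * b \<in> J"
  shows "frac_section U a b = frac_section U c d"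
  unfolding frac_section_def by (rule restrict_ext, rule frac_eq_cross) (use assms(1) in \<open>simp_all add: subset_iff assms(2-)\<close>)

text \<open>Near each point, both sections are given by single fractions, and so are their product and sum.\<close>

lemma sections_closed:
  assumes U: "openin T U" and s: "s \<in> sections U" and t: "t \<in> sections U"
  shows "s \<otimes>\<^bsub>Sec space U\<^esub> t \<in> sections U" "s \<oplus>\<^bsub>Sec space U\<^esub> t \<in> sections U"
proof -
  have *: "\<exists>W h a b c d. openin T W \<and> p \<in> W \<and> W \<subseteq> U \<and> h \<in> H \<and> a * c \<in> h \<and> b * d \<in> h \<and> a * d + c * b \<in> h \<and>
      (\<forall>q\<in>W. b * d \<notin> q \<and> fraction_mult H J q (s q) (t q) = frac q (a * c) (b * d) \<and>
         fraction_add H J q (s q) (t q) = frac q (a * d + c * b) (b * d))" if p: "p \<in> U" for p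
  proof -
    obtain W h a b where W: "openin T W" "p \<in> W" "W \<subseteq> U" and h: "h \<in> H" "a \<in> h" "b \<in> h"
      and ab: "\<And>q. q \<in> W \<Longrightarrow> b \<notin> q" "\<And>q. q \<in> W \<Longrightarrow> s q = frac q a b"
      by (rule section_local[OF s p]) (rule that)
    obtain W' h' c d where W': "openin T W'" "p \<in> W'" "W' \<subseteq> U" and h': "h' \<in> H" "c \<in> h'" "d \<in> h'"
      and cd: "\<And>q. q \<in> W' \<Longrightarrow> d \<notin> q" "\<And>q. q \<in> W' \<Longrightarrow> t q = frac q c d"
      by (rule section_local[OF t p]) (rule that)
    obtain h'' where h'': "h'' \<in> H" "\<And>a b. a \<in> h \<Longrightarrow> b \<in> h' \<Longrightarrow> a * b \<in> h''" using H_mult[OF h(1) h'(1)] by meson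
    have P: "q \<in> P" if "q \<in> W" for q using that W(1) unfolding openin_T_iff by blast
    have v: "valid q a b" "valid q c d" if "q \<in> W \<inter> W'" for q
      using that ab cd h h' by (auto intro: validI)
    show ?thesis
    proof (rule exI[of _ "W \<inter> W'"], rule exI[of _ h''], rule exI[of _ a], rule exI[of _ b], rule exI[of _ c],
        rule exI[of _ d], intro conjI ballI)
      show "openin T (W \<inter> W')" using W W' by blast
      show "a * d + c * b \<in> h''" using h h' h'' by (auto simp: mult.commute[of c] intro!: H_add)
      fix q assume q: "q \<in> W \<inter> W'"
      show "b * d \<notin> q" using valid_mult[OF P v[OF q]] q by (auto simp: valid_def)
      show "fraction_mult H J q (s q) (t q) = frac q (a * c) (b * d)"
        using q ab cd P frac_mult[OF P v[OF q]] by auto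
      show "fraction_add H J q (s q) (t q) = frac q (a * d + c * b) (b * d)"
        using q ab cd P frac_add[OF P v[OF q]] by auto
    qed (use W W' h h' h'' in auto)
  qed
  show "s \<otimes>\<^bsub>Sec space U\<^esub> t \<in> sections U"
  proof (rule sectionI, simp)
    fix p assume p: "p \<in> U"
    from *[OF p] obtain W h a b c d where W: "openin T W" "p \<in> W" "W \<subseteq> U" "h \<in> H" "a * c \<in> h" "b * d \<in> h"
      "\<forall>q\<in>W. b * d \<notin> q \<and> fraction_mult H J q (s q) (t q) = frac q (a * c) (b * d)" by meson
    then show "\<exists>W h a b. openin T W \<and> p \<in> W \<and> W \<subseteq> U \<and> h \<in> H \<and> a \<in> h \<and> b \<in> h \<and>
       (\<forall>q\<in>W. b \<notin> q \<and> (s \<otimes>\<^bsub>Sec space U\<^esub> t) q = frac q a b)"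
      by (intro exI[of _ W] exI[of _ h] exI[of _ "a * c"] exI[of _ "b * d"]) (simp add: subset_iff)
  qed
  show "s \<oplus>\<^bsub>Sec space U\<^esub> t \<in> sections U"
  proof (rule sectionI, simp)
    fix p assume p: "p \<in> U"
    from *[OF p] obtain W h a b c d where W: "openin T W" "p \<in> W" "W \<subseteq> U" "h \<in> H" "a * d + c * b \<in> h" "b * d \<in> h"
      "\<forall>q\<in>W. b * d \<notin> q \<and> fraction_add H J q (s q) (t q) = frac q (a * d + c * b) (b * d)" by meson
    then show "\<exists>W h a b. openin T W \<and> p \<in> W \<and> W \<subseteq> U \<and> h \<in> H \<and> a \<in> h \<and> b \<in> h \<and>
       (\<forall>q\<in>W. b \<notin> q \<and> (s \<oplus>\<^bsub>Sec space U\<^esub> t) q = frac q a b)"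
      by (intro exI[of _ W] exI[of _ h] exI[of _ "a * d + c * b"] exI[of _ "b * d"]) (simp add: subset_iff)
  qed
qed

lemma const_section: "openin T U \<Longrightarrow> frac_section U (mconst c) 1 \<in> sections U"
proof -
  assume U: "openin T U"
  then have P: "q \<in> P" if "q \<in> U" for q using that unfolding openin_T_iff by blast
  obtain h where h: "h \<in> H" "\<And>c. mconst c \<in> h" using H_const by blast
  show ?thesis
    by (rule frac_section_closed[OF U h(1)]) (use h(2)[of 1] h(2)[of c] mpoly_prime_closed(2)[OF P_prime[OF P]] in auto)
qed

lemma restrict_section:
  assumes "s \<in> sections U" "openin T V" "V \<subseteq> U"
  shows "restrict s V \<in> sections V"
proof (rule sectionI, simp)
  fix p assume p: "p \<in> V"
  then have pU: "p \<in> U" using assms by blast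
  obtain W h a b where W: "openin T W" "p \<in> W" "W \<subseteq> U" and h: "h \<in> H" "a \<in> h" "b \<in> h"
    and ab: "\<And>q. q \<in> W \<Longrightarrow> b \<notin> q" "\<And>q. q \<in> W \<Longrightarrow> s q = frac q a b"
    by (rule section_local[OF assms(1) pU]) (rule that)
  then show "\<exists>W h a b. openin T W \<and> p \<in> W \<and> W \<subseteq> V \<and> h \<in> H \<and> a \<in> h \<and> b \<in> h \<and>
      (\<forall>q\<in>W. b \<notin> q \<and> restrict s V q = frac q a b)"
    using p assms openin_Int[OF W(1) assms(2)]
    by (intro exI[of _ "W \<inter> V"] exI[of _ h] exI[of _ a] exI[of _ b]) auto
qed

end


section \<open>Homomorphisms on stalks\<close>

text \<open>The value at \<open>e\<close> of the fraction \<open>a/b\<close>. All representatives \<open>(a, b)\<close> of the class \<open>c\<close> determine the same \<open>r\<close> if the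
  values of their denominators are invertible.\<close>

definition germ_value :: "('b \<Rightarrow> 'a::comm_ring_1) \<Rightarrow> ('b \<times> 'b) set \<Rightarrow> 'a" where
  "germ_value e c = (THE r. \<exists>a b. (a, b) \<in> c \<and> r * e b = e a)"

lemma unit_cancel:
  fixes u :: "'a::comm_ring_1"
  assumes "u dvd 1" "u * x = u * y"
  shows "x = y"
proof -
  obtain v where v: "1 = u * v" using assms(1) by (elim dvdE)
  have "x = v * (u * x)" using v by (metis mult.assoc mult.commute mult.right_neutral)
  also have "\<dots> = v * (u * y)" by (simp only: assms(2))
  also have "\<dots> = y" using v by (metis mult.assoc mult.commute mult.right_neutral)
  finally show ?thesis .
qed

context graded_fractions
begin

text \<open>The homomorphisms \<open>e\<close> that extend to fractions, because they vanish on \<open>J\<close> and make the denominators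
  invertible. They are the points with values in the ring \<open>'a\<close> that are concentrated at \<open>p\<close>.\<close>

definition point_hom :: "('x, 'k) mpoly set \<Rightarrow> (('x, 'k) mpoly \<Rightarrow> 'a::comm_ring_1) \<Rightarrow> bool" where
  "point_hom p e \<longleftrightarrow> p \<in> P \<and> comm_ring_hom e \<and> (\<forall>f\<in>J. e f = 0) \<and> (\<forall>h\<in>H. \<forall>b\<in>h. b \<notin> p \<longrightarrow> e b dvd 1)"

lemma point_homD:
  assumes "point_hom p e"
  shows "p \<in> P" "comm_ring_hom e" "f \<in> J \<Longrightarrow> e f = 0" "h \<in> H \<Longrightarrow> b \<in> h \<Longrightarrow> b \<notin> p \<Longrightarrow> e b dvd 1"
    "valid p a b \<Longrightarrow> e b dvd 1"
  using assms by (auto simp: point_hom_def valid_def)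

text \<open>Equal fractions have equal values: the factor \<open>t\<close> in the relation between them becomes invertible.\<close>

lemma germ_value_eqI:
  assumes e: "point_hom p e" and v: "valid p a b" and r: "r * e b = e a"
  shows "germ_value e (frac p a b) = r"
  unfolding germ_value_def
proof (rule the_equality)
  show "\<exists>a' b'. (a', b') \<in> frac p a b \<and> r * e b' = e a'"
    using frac_self[OF point_homD(1)[OF e] v] r by blast
  fix r' assume "\<exists>a' b'. (a', b') \<in> frac p a b \<and> r' * e b' = e a'"
  then obtain a' b' where ab: "(a', b') \<in> frac p a b" "r' * e b' = e a'" by blast
  then obtain h t where v': "valid p a' b'" and t: "h \<in> H" "t \<in> h" "t \<notin> p" "t * (a * b' - a' * b) \<in> J"
    by (auto simp: mem_frac)
  interpret e: comm_ring_hom e using e by (rule point_homD)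
  have "e t * (e a * e b' - e a' * e b) = 0"
    using point_homD(3)[OF e t(4)] by (simp add: e.hom_mult e.hom_minus)
  then have "e a * e b' - e a' * e b = 0"
    by (intro unit_cancel[OF point_homD(4)[OF e t(1-3)], of _ 0]) simp
  then have "(e b * e b') * r' = (e b * e b') * r"
    by (simp add: ab(2)[symmetric] r[symmetric] ac_simps)
  moreover have "e b * e b' dvd 1" using point_homD(5)[OF e v] point_homD(5)[OF e v'] by simp
  ultimately show "r' = r" by (rule unit_cancel[rotated])
qed

lemma germ_value_frac:
  assumes e: "point_hom p e" and v: "valid p a b"
  shows "germ_value e (frac p a b) * e b = e a"
proof -
  obtain u where "1 = e b * u" using point_homD(5)[OF e v] by (elim dvdE)
  then have u: "e a * u * e b = e a" by (metis mult.assoc mult.commute mult.right_neutral)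
  then show ?thesis using germ_value_eqI[OF e v u] by simp
qed

lemma germ_value_mult:
  assumes e: "point_hom p e" and "valid p a b" "valid p c d"
  shows "germ_value e (fraction_mult H J p (frac p a b) (frac p c d)) =
    germ_value e (frac p a b) * germ_value e (frac p c d)"
proof -
  interpret e: comm_ring_hom e using e by (rule point_homD)
  have p: "p \<in> P" using e by (rule point_homD)
  have "germ_value e (frac p a b) * germ_value e (frac p c d) * e (b * d) =
     (germ_value e (frac p a b) * e b) * (germ_value e (frac p c d) * e d)"
    by (simp add: e.hom_mult ac_simps)
  also have "\<dots> = e (a * c)"
    using assms by (simp add: germ_value_frac e.hom_mult)
  finally show ?thesis
    using assms p by (simp add: frac_mult germ_value_eqI[OF e valid_mult[OF p]])
qed

lemma germ_value_add:
  assumes e: "point_hom p e" and "valid p a b" "valid p c d"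
  shows "germ_value e (fraction_add H J p (frac p a b) (frac p c d)) =
    germ_value e (frac p a b) + germ_value e (frac p c d)"
proof -
  interpret e: comm_ring_hom e using e by (rule point_homD)
  have p: "p \<in> P" using e by (rule point_homD)
  have "(germ_value e (frac p a b) + germ_value e (frac p c d)) * e (b * d) =
     (germ_value e (frac p a b) * e b) * e d + (germ_value e (frac p c d) * e d) * e b"
    by (simp add: e.hom_mult algebra_simps)
  also have "\<dots> = e (a * d + c * b)"
    using assms by (simp add: germ_value_frac e.hom_mult e.hom_add)
  finally show ?thesis
    using assms p by (simp add: frac_add germ_value_eqI[OF e valid_add[OF p]])
qed

lemma germ_value_hom:
  assumes e: "point_hom p e" and v: "valid p a b" and h: "comm_ring_hom h" and he: "point_hom p e'"
    and eq: "\<And>f. f \<in> carrier (mpoly_ring N) \<Longrightarrow> e' f = h (e f)"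
  shows "h (germ_value e (frac p a b)) = germ_value e' (frac p a b)"
proof -
  interpret h: comm_ring_hom h by fact
  have "h (germ_value e (frac p a b)) * e' b = e' a"
    using germ_value_frac[OF e v] valid_carrier[OF v] by (simp add: eq h.hom_mult[symmetric])
  then show ?thesis using germ_value_eqI[OF he v] by metis
qed

text \<open>A homomorphism of \<open>k\<close>-algebras on the stalk at \<open>y\<close>. It is encoded by its composites with the maps from
  the rings of sections over the open sets \<open>V\<close> with \<open>y \<in> V \<subseteq> Y\<close>, because an isomorphism of ringed spaces acts
  on these rings and not on fractions. The map \<open>\<kappa>\<close> is the structure map of the target.\<close>

definition stalk_hom ::
    "('k \<Rightarrow> 'a::comm_ring_1) \<Rightarrow> ('x, 'k) mpoly set set \<Rightarrow> ('x, 'k) mpoly set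
      \<Rightarrow> (('x, 'k) mpoly set set \<Rightarrow> (('x, 'k) mpoly set \<Rightarrow> (('x, 'k) mpoly \<times> ('x, 'k) mpoly) set) \<Rightarrow> 'a) \<Rightarrow> bool" where
  "stalk_hom \<kappa> Y y \<chi> \<longleftrightarrow> comm_ring_hom \<kappa> \<and> openin T Y \<and> y \<in> Y \<and>
    (\<forall>V. openin T V \<and> V \<subseteq> Y \<and> y \<in> V \<longrightarrow>
      (\<forall>s\<in>sections V. \<forall>t\<in>sections V. \<chi> V (s \<otimes>\<^bsub>Sec space V\<^esub> t) = \<chi> V s * \<chi> V t \<and>
         \<chi> V (s \<oplus>\<^bsub>Sec space V\<^esub> t) = \<chi> V s + \<chi> V t) \<and>
      (\<forall>c. \<chi> V (frac_section V (mconst c) 1) = \<kappa> c) \<and>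
      (\<forall>V' s. openin T V' \<and> V' \<subseteq> V \<and> y \<in> V' \<and> s \<in> sections V \<longrightarrow> \<chi> V' (restrict s V') = \<chi> V s))"

lemma stalk_homD:
  assumes "stalk_hom \<kappa> Y y \<chi>"
  shows "comm_ring_hom \<kappa>" "openin T Y" "y \<in> Y"
    "\<lbrakk>openin T V; V \<subseteq> Y; y \<in> V; s \<in> sections V; t \<in> sections V\<rbrakk> \<Longrightarrow> \<chi> V (s \<otimes>\<^bsub>Sec space V\<^esub> t) = \<chi> V s * \<chi> V t"
    "\<lbrakk>openin T V; V \<subseteq> Y; y \<in> V; s \<in> sections V; t \<in> sections V\<rbrakk> \<Longrightarrow> \<chi> V (s \<oplus>\<^bsub>Sec space V\<^esub> t) = \<chi> V s + \<chi> V t"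
    "\<lbrakk>openin T V; V \<subseteq> Y; y \<in> V\<rbrakk> \<Longrightarrow> \<chi> V (frac_section V (mconst c) 1) = \<kappa> c"
    "\<lbrakk>openin T V; V \<subseteq> Y; y \<in> V; openin T V'; V' \<subseteq> V; y \<in> V'; s \<in> sections V\<rbrakk> \<Longrightarrow> \<chi> V' (restrict s V') = \<chi> V s"
  using assms unfolding stalk_hom_def by (simp_all del: space_simps)

lemma stalk_hom_germ_value:
  assumes e: "point_hom p e" and \<kappa>: "comm_ring_hom \<kappa>" "\<And>c. e (mconst c) = \<kappa> c" and Y: "openin T Y" "p \<in> Y"
  shows "stalk_hom \<kappa> Y p (\<lambda>V s. germ_value e (s p))"
  unfolding stalk_hom_def
proof (intro conjI allI impI ballI, goal_cases)
  case (4 V s t)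
  then obtain a b c d where "valid p a b" "s p = frac p a b" "valid p c d" "t p = frac p c d"
    by (meson section_at)
  then show ?case using 4 e by (simp add: germ_value_mult)
next
  case (5 V s t)
  then obtain a b c d where "valid p a b" "s p = frac p a b" "valid p c d" "t p = frac p c d"
    by (meson section_at)
  then show ?case using 5 e by (simp add: germ_value_add)
next
  case (6 V c)
  interpret e: comm_ring_hom e using e by (rule point_homD)
  show ?case
    using 6 germ_value_eqI[OF e valid_const[OF point_homD(1)[OF e]], of "\<kappa> c" c]
    by (simp add: frac_section_apply \<kappa>)
qed (use assms in auto)

end

section \<open>Points of affine schemes\<close>

lemma affine_graded_fractions:
  fixes F :: "('x, 'k::field) mpoly set"
  assumes "F \<subseteq> carrier (mpoly_ring N)"
  shows "graded_fractions N {carrier (mpoly_ring N)} (genideal (mpoly_ring N) F)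
    {p. primeideal p (mpoly_ring N) \<and> genideal (mpoly_ring N) F \<subseteq> p}"
  by (rule graded_fractions.intro) (auto intro: mpoly_closed mpoly_genideal(1)[OF assms])

locale affine_fractions =
  fixes N :: "'x set" and F :: "('x, 'k::field) mpoly set"
  assumes F_carrier: "F \<subseteq> carrier (mpoly_ring N)"
begin

sublocale graded_fractions N "{carrier (mpoly_ring N)}" "genideal (mpoly_ring N) F"
  "{p. primeideal p (mpoly_ring N) \<and> genideal (mpoly_ring N) F \<subseteq> p}"
  by (rule affine_graded_fractions) (rule F_carrier)

lemma affine_scheme_eq: "affine_scheme N F = space"
  by (simp add: affine_scheme_def Let_def)

lemma valid_iff: "valid p a b \<longleftrightarrow> a \<in> carrier (mpoly_ring N) \<and> b \<in> carrier (mpoly_ring N) \<and> b \<notin> p"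
  by (auto simp: valid_def)

text \<open>Over an affine scheme, a homomorphism on a stalk is the evaluation at the images \<open>\<alpha>\<close> of the
  coordinates. This is the universal property on polynomials, and a denominator \<open>b\<close> causes no problem: it is
  invertible as a section near \<open>y\<close>, hence so is its image. In particular, the image of a section can be
  computed from its germ, and \<open>\<alpha>\<close> satisfies the equations of the scheme.\<close>

lemma stalk_hom_is_evaluation:
  assumes \<chi>: "stalk_hom \<kappa> Y y \<chi>"
  defines "\<alpha> \<equiv> \<lambda>x. \<chi> Y (frac_section Y (mvar x) 1)"
  shows "point_hom y (peval \<kappa> \<alpha>)"
    and "openin T V \<Longrightarrow> V \<subseteq> Y \<Longrightarrow> y \<in> V \<Longrightarrow> s \<in> sections V \<Longrightarrow> \<chi> V s = germ_value (peval \<kappa> \<alpha>) (s y)"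
    and "openin T V \<Longrightarrow> V \<subseteq> Y \<Longrightarrow> y \<in> V \<Longrightarrow> g \<in> carrier (mpoly_ring N) \<Longrightarrow> \<chi> V (frac_section V g 1) = peval \<kappa> \<alpha> g"
proof -
  note hom = stalk_homD(4,5)[OF \<chi>] and const = stalk_homD(6)[OF \<chi>] and res = stalk_homD(7)[OF \<chi>]
  have Y: "openin T Y" "y \<in> Y" and \<kappa>: "comm_ring_hom \<kappa>" using stalk_homD[OF \<chi>] by auto
  interpret \<kappa>: comm_ring_hom \<kappa> by fact
  interpret e: comm_ring_hom "peval \<kappa> \<alpha>" by (rule comm_ring_hom_peval) fact
  have PD: "V \<subseteq> {p. primeideal p (mpoly_ring N) \<and> genideal (mpoly_ring N) F \<subseteq> p}" if "openin T V" for V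
    using that unfolding openin_T_iff by blast
  have one: "1 \<notin> q" if "openin T V" "q \<in> V" for V q
    using PD[OF that(1)] that(2) mpoly_prime_closed(2) by blast
  have sec: "frac_section V g b \<in> sections V" if "openin T V" "g \<in> carrier (mpoly_ring N)" "b \<in> carrier (mpoly_ring N)"
    "\<And>q. q \<in> V \<Longrightarrow> b \<notin> q" for V g b
    using that by (intro frac_section_closed) auto
  note sec1 = sec[OF _ _ mpoly_closed_1 one]
  show eval: "\<chi> V (frac_section V g 1) = peval \<kappa> \<alpha> g" if V: "openin T V" "V \<subseteq> Y" "y \<in> V" and g: "g \<in> carrier (mpoly_ring N)" for V g
  proof (rule peval_unique[OF \<kappa> g])
    show "\<chi> V (frac_section V (mconst c) 1) = \<kappa> c" for c using V by (rule const)
    fix x assume x: "x \<in> N"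
    have "frac_section V (mvar x) 1 = restrict (frac_section Y (mvar x) 1) V"
      using V(2) by (simp add: frac_section_def Int_absorb1)
    then show "\<chi> V (frac_section V (mvar x) 1) = \<alpha> x"
      unfolding \<alpha>_def using res[OF Y(1) subset_refl Y(2) V sec1[OF Y(1) mpoly_closed_mvar[OF x]]] Y(1) by simp
  next
    fix f g :: "('x, 'k) mpoly" assume fg: "f \<in> carrier (mpoly_ring N)" "g \<in> carrier (mpoly_ring N)"
    have v: "\<And>q. q \<in> V \<Longrightarrow> valid q f 1" "\<And>q. q \<in> V \<Longrightarrow> valid q g 1"
      using fg one[OF V(1)] by (auto simp: valid_iff intro: mpoly_closed)
    show "\<chi> V (frac_section V (f + g) 1) = \<chi> V (frac_section V f 1) + \<chi> V (frac_section V g 1)"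
      using hom(2)[OF V sec1[OF V(1) fg(1) V(1)] sec1[OF V(1) fg(2) V(1)]] frac_section_add[OF PD[OF V(1)] v] by simp
    show "\<chi> V (frac_section V (f * g) 1) = \<chi> V (frac_section V f 1) * \<chi> V (frac_section V g 1)"
      using hom(1)[OF V sec1[OF V(1) fg(1) V(1)] sec1[OF V(1) fg(2) V(1)]] frac_section_mult[OF PD[OF V(1)] v] by simp
  qed
  show p: "point_hom y (peval \<kappa> \<alpha>)"
    unfolding point_hom_def
  proof (intro conjI ballI impI)
    show "y \<in> {p. primeideal p (mpoly_ring N) \<and> genideal (mpoly_ring N) F \<subseteq> p}" using PD Y by blast
    fix f assume f: "f \<in> genideal (mpoly_ring N) F"
    have fc: "f \<in> carrier (mpoly_ring N)" using mpoly_ideal_closed(1)[OF J_ideal f] .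
    have "frac_section Y f 1 = frac_section Y (mconst 0) 1"
      by (rule frac_section_eq[OF PD[OF Y(1)]])
        (use f fc one[OF Y(1)] in \<open>auto simp: valid_iff intro: mpoly_closed\<close>)
    then show "peval \<kappa> \<alpha> f = 0"
      using eval[OF Y(1) subset_refl Y(2) fc] const[OF Y(1) subset_refl Y(2), of 0] by simp
  next
    fix h b assume "h \<in> {carrier (mpoly_ring N) :: ('x, 'k) mpoly set}" "b \<in> h" "b \<notin> y"
    then have b: "b \<in> carrier (mpoly_ring N)" "b \<notin> y" by auto
    obtain V where V: "openin T V" "V \<subseteq> Y" "y \<in> V" and bV: "\<And>q. q \<in> V \<Longrightarrow> b \<notin> q"
    proof
      let ?V = "Y \<inter> {q \<in> {p. primeideal p (mpoly_ring N) \<and> genideal (mpoly_ring N) F \<subseteq> p}. b \<notin> q}"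
      show "openin T ?V" "?V \<subseteq> Y" "y \<in> ?V"
        using openin_Int[OF Y(1) openin_basic[OF b(1)]] Y(2) b(2) PD[OF Y(1)] by auto
    qed auto
    have v: "\<And>q. q \<in> V \<Longrightarrow> valid q b 1" "\<And>q. q \<in> V \<Longrightarrow> valid q 1 b"
      using b bV one[OF V(1)] by (auto simp: valid_iff intro: mpoly_closed)
    have "frac_section V b 1 \<otimes>\<^bsub>Sec space V\<^esub> frac_section V 1 b = frac_section V (b * 1) (1 * b)"
      by (rule frac_section_mult[OF PD[OF V(1)] v])
    also have "\<dots> = frac_section V (mconst 1) 1"
      by (rule frac_section_eq[OF PD[OF V(1)]])
        (use b bV one[OF V(1)] mpoly_ideal_closed(2)[OF J_ideal] in \<open>auto simp: valid_iff intro: mpoly_closed\<close>)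
    finally have "\<chi> V (frac_section V b 1) * \<chi> V (frac_section V 1 b) = 1"
      using hom(1)[OF V sec1[OF V(1) b(1) V(1)] sec[OF V(1) mpoly_closed_1 b(1) bV]]
        const[OF V, of 1] \<kappa>.hom_one by (simp del: space_simps)
    then show "peval \<kappa> \<alpha> b dvd 1" using eval[OF V b(1)] by (metis dvdI)
  qed (rule e.comm_ring_hom_axioms)
  fix V s assume V: "openin T V" "V \<subseteq> Y" "y \<in> V" and s: "s \<in> sections V"
  obtain W h a b where W: "openin T W" "y \<in> W" "W \<subseteq> V" and h: "h \<in> {carrier (mpoly_ring N)}" "a \<in> h" "b \<in> h"
    and ab': "\<And>q. q \<in> W \<Longrightarrow> b \<notin> q" "\<And>q. q \<in> W \<Longrightarrow> s q = frac q a b"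
    by (rule section_local[OF s V(3)]) (rule that)
  then have ab: "a \<in> carrier (mpoly_ring N)" "b \<in> carrier (mpoly_ring N)"
    "\<And>q. q \<in> W \<Longrightarrow> b \<notin> q" "\<And>q. q \<in> W \<Longrightarrow> s q = frac q a b" by auto
  have WY: "W \<subseteq> Y" using W V by blast
  have rs: "restrict s W = frac_section W a b" unfolding frac_section_def by (rule restrict_ext) (rule ab(4))
  have v: "\<And>q. q \<in> W \<Longrightarrow> valid q a b" "\<And>q. q \<in> W \<Longrightarrow> valid q b 1"
    using ab one[OF W(1)] by (auto simp: valid_iff intro: mpoly_closed)
  have "frac_section W a b \<otimes>\<^bsub>Sec space W\<^esub> frac_section W b 1 = frac_section W (a * b) (b * 1)"
    by (rule frac_section_mult[OF PD[OF W(1)] v])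
  also have "\<dots> = frac_section W a 1"
    by (rule frac_section_eq[OF PD[OF W(1)]])
      (use ab one[OF W(1)] mpoly_ideal_closed(2)[OF J_ideal] in \<open>auto simp: valid_iff intro: mpoly_closed\<close>)
  finally have "\<chi> W (frac_section W a b) * peval \<kappa> \<alpha> b = peval \<kappa> \<alpha> a"
    using hom(1)[OF W(1) WY W(2) sec[OF W(1) ab(1-3)] sec1[OF W(1) ab(2) W(1)]]
      eval[OF W(1) WY W(2)] ab(1,2) by (simp del: space_simps)
  then have "germ_value (peval \<kappa> \<alpha>) (frac y a b) = \<chi> W (frac_section W a b)"
    by (rule germ_value_eqI[OF p v(1)[OF W(2)]])
  then show "\<chi> V s = germ_value (peval \<kappa> \<alpha>) (s y)"
    using res[OF V W(1,3,2) s] rs ab(4)[OF W(2)] by simp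
qed

end


section \<open>Lifting solutions of polynomial equations\<close>

lemma linear_system_solvable:
  fixes M :: "nat \<Rightarrow> nat \<Rightarrow> 'k::field"
  assumes "Determinant.det (mat c c (\<lambda>(i, j). M i j)) \<noteq> 0"
  shows "\<exists>x. \<forall>i<c. (\<Sum>j<c. M i j * x j) = r i"
proof -
  let ?A = "mat c c (\<lambda>(i, j). M i j)"
  let ?B = "adj_mat ?A"
  let ?d = "Determinant.det ?A"
  have A: "?A \<in> carrier_mat c c" by simp
  have B: "?B \<in> carrier_mat c c" using adj_mat(1)[OF A] .
  have AB: "(\<Sum>j<c. M i j * ?B $$ (j, k)) = (if i = k then ?d else 0)" if "i < c" "k < c" for i k
  proof -
    have "(\<Sum>j<c. M i j * ?B $$ (j, k)) = (?A * ?B) $$ (i, k)"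
      using that B by (simp add: scalar_prod_def atLeast0LessThan)
    also have "\<dots> = (if i = k then ?d else 0)"
      unfolding adj_mat(2)[OF A] using that by simp
    finally show ?thesis .
  qed
  define x where "x j = inverse ?d * (\<Sum>k<c. ?B $$ (j, k) * r k)" for j
  have "(\<Sum>j<c. M i j * x j) = r i" if i: "i < c" for i
  proof -
    have "(\<Sum>j<c. M i j * x j) = (\<Sum>j<c. \<Sum>k<c. inverse ?d * (M i j * ?B $$ (j, k)) * r k)"
      by (simp add: x_def sum_distrib_left ac_simps)
    also have "\<dots> = (\<Sum>k<c. inverse ?d * (\<Sum>j<c. M i j * ?B $$ (j, k)) * r k)"
      by (subst sum.swap) (simp add: sum_distrib_left sum_distrib_right)
    also have "\<dots> = (\<Sum>k<c. if i = k then r k else 0)"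
      by (rule sum.cong) (use assms i AB in \<open>auto simp: AB\<close>)
    finally show ?thesis using i by simp
  qed
  then show ?thesis by blast
qed

lemma comm_ring_hom_id: "comm_ring_hom (\<lambda>x. x :: 'a::comm_ring_1)"
  by (rule comm_ring_homI) auto

lemma peval_real_part:
  "real_part (peval dual_const \<alpha> f) = peval (\<lambda>c. c) (\<lambda>x. real_part (\<alpha> x)) f"
  using peval_compose[OF comm_ring_hom_dual_const comm_ring_hom_real_part, of \<alpha> f] by (simp add: comp_def)

text \<open>The point \<open>\<gamma>\<close> is \<open>\<alpha> + e (\<beta>' + t x)\<close>, where \<open>\<beta>'\<close> is the infinitesimal part of \<open>\<beta>\<close>. By the Taylor formula,
  the equations hold at \<open>\<gamma>\<close> up to their \<open>t e\<close>-parts, which are affine linear in \<open>x\<close>, and the linear part is the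
  Jacobian matrix. Since the first \<open>c\<close> columns of this matrix form an invertible matrix, it suffices to
  vary the first \<open>c\<close> coordinates of \<open>x\<close>.\<close>

lemma jacobian_lift:
  fixes f :: "nat \<Rightarrow> (nat, 'k::field) mpoly" and \<alpha> \<beta> :: "nat \<Rightarrow> 'k dual"
  assumes cn: "c \<le> n" and f: "\<And>i. i < c \<Longrightarrow> f i \<in> carrier (mpoly_ring {..<n})"
    and eq: "\<And>j. j < n \<Longrightarrow> real_part (\<alpha> j) = real_part (\<beta> j)"
    and f\<alpha>: "\<And>i. i < c \<Longrightarrow> peval dual_const \<alpha> (f i) = 0" and f\<beta>: "\<And>i. i < c \<Longrightarrow> peval dual_const \<beta> (f i) = 0"
    and minor: "peval (\<lambda>c. c) (\<lambda>j. real_part (\<alpha> j)) (jacobian_minor c f) \<noteq> 0"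
  obtains \<gamma> :: "nat \<Rightarrow> 'k dual dual" where
    "\<And>j. real_part (\<gamma> j) = \<alpha> j" "\<And>j. j < n \<Longrightarrow> map_dual real_part (\<gamma> j) = \<beta> j"
    "\<And>i. i < c \<Longrightarrow> peval (dual_const \<circ> dual_const) \<gamma> (f i) = 0"
proof -
  define M where "M i j = peval (\<lambda>c. c) (\<lambda>j. real_part (\<alpha> j)) (mpderiv j (f i))" for i j
  define g where "g i j = inf_part (peval dual_const \<alpha> (mpderiv j (f i)))" for i j
  interpret e: comm_ring_hom "peval (\<lambda>c. c) (\<lambda>j. real_part (\<alpha> j)) :: (nat, 'k) mpoly \<Rightarrow> 'k"
    by (rule comm_ring_hom_peval[OF comm_ring_hom_id])
  have "mat c c (\<lambda>(i, j). M i j) =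
      map_mat (peval (\<lambda>c. c) (\<lambda>j. real_part (\<alpha> j))) (mat c c (\<lambda>(i, j). mpderiv j (f i)))"
    by (rule eq_matI) (auto simp: M_def)
  then have "Determinant.det (mat c c (\<lambda>(i, j). M i j)) \<noteq> 0"
    using minor by (simp add: jacobian_minor_def e.hom_det)
  then obtain x where x: "\<And>i. i < c \<Longrightarrow> (\<Sum>j<c. M i j * x j) = - (\<Sum>j<n. inf_part (\<beta> j) * g i j)"
    using linear_system_solvable[of c M "\<lambda>i. - (\<Sum>j<n. inf_part (\<beta> j) * g i j)"] by blast
  define \<gamma> where "\<gamma> j = Dual (\<alpha> j) (Dual (inf_part (\<beta> j)) (if j < c then x j else 0))" for j
  have sum_c: "(\<Sum>j<n. (if j < c then x j else 0) * h j) = (\<Sum>j<c. h j * x j)" for h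
  proof -
    have "(\<Sum>j<n. (if j < c then x j else 0) * h j) = (\<Sum>j<c. (if j < c then x j else 0) * h j)"
      by (rule sum.mono_neutral_right) (use cn in auto)
    then show ?thesis by (simp add: mult.commute)
  qed
  have "peval (dual_const \<circ> dual_const) \<gamma> (f i) = 0" if i: "i < c" for i
  proof -
    have *: "peval (dual_const \<circ> dual_const) \<gamma> (f i) = Dual (peval dual_const \<alpha> (f i))
        (\<Sum>j<n. inf_part (\<gamma> j) * peval dual_const \<alpha> (mpderiv j (f i)))"
      using peval_dual[OF comm_ring_hom_dual_const _ f[OF i], of \<gamma>] by (simp add: \<gamma>_def comp_def)
    have "inf_part (peval dual_const \<beta> (f i)) = (\<Sum>j<n. inf_part (\<beta> j) * M i j)"
    proof -
      have "M i j = peval (\<lambda>c. c) (\<lambda>j. real_part (\<beta> j)) (mpderiv j (f i))" for j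
        unfolding M_def
        by (rule peval_cong[OF comm_ring_hom_id mpderiv_closed[OF f[OF i]]]) (simp add: eq)
      then show ?thesis using peval_dual[OF comm_ring_hom_id _ f[OF i], of \<beta>] by (simp add: comp_def)
    qed
    then have "(\<Sum>j<n. inf_part (\<beta> j) * M i j) = 0" using f\<beta>[OF i] by simp
    moreover have "real_part (peval dual_const \<alpha> (mpderiv j (f i))) = M i j" for j
      by (simp add: M_def peval_real_part)
    ultimately show ?thesis
      unfolding * using f\<alpha>[OF i] x[OF i]
      by (intro dual.expand conjI) (simp_all add: \<gamma>_def g_def[symmetric] sum.distrib sum_c)
  qed
  moreover have "map_dual real_part (\<gamma> j) = \<beta> j" if "j < n" for j
    by (simp add: \<gamma>_def dual.expand eq[OF that])
  ultimately show thesis by (intro that[of \<gamma>]) (simp_all add: \<gamma>_def)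
qed


section \<open>Transport along isomorphisms of ringed spaces\<close>

text \<open>An isomorphism between open subspaces \<open>U\<close> and \<open>U'\<close>, in a form in which all open sets are open sets of the
  ambient spaces.\<close>

locale isomorphic_fractions =
  X: graded_fractions N H J P + Y: graded_fractions M K I Q
  for N :: "'x set" and H :: "('x, 'k::field) mpoly set set" and J P
    and M :: "'y set" and K :: "('y, 'k) mpoly set set" and I Q +
  fixes U :: "('x, 'k) mpoly set set" and U' :: "('y, 'k) mpoly set set" and \<phi> \<eta>
  assumes U: "openin X.T U" and U': "openin Y.T U'"
    and \<phi>: "homeomorphic_map (subtopology X.T U) (subtopology Y.T U') \<phi>"
    and \<eta>_iso: "openin Y.T V \<Longrightarrow> V \<subseteq> U' \<Longrightarrow> \<eta> V \<in> ring_iso (Sec Y.space V) (Sec X.space {x \<in> U. \<phi> x \<in> V})"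
    and \<eta>_const: "openin Y.T V \<Longrightarrow> V \<subseteq> U' \<Longrightarrow>
       \<eta> V (Y.frac_section V (mconst c) 1) = X.frac_section {x \<in> U. \<phi> x \<in> V} (mconst c) 1"
    and \<eta>_restrict: "openin Y.T V \<Longrightarrow> V \<subseteq> U' \<Longrightarrow> openin Y.T V' \<Longrightarrow> V' \<subseteq> V \<Longrightarrow> s \<in> Y.sections V \<Longrightarrow>
       \<eta> V' (restrict s V') = restrict (\<eta> V s) {x \<in> U. \<phi> x \<in> V'}"
begin

lemma topspace_U: "topspace (subtopology X.T U) = U" "topspace (subtopology Y.T U') = U'"
  using openin_subset[OF U] openin_subset[OF U'] by auto

lemma \<phi>_image: "\<phi> ` U = U'" and \<phi>_inj: "inj_on \<phi> U"
  using \<phi> topspace_U by (auto simp: homeomorphic_eq_everything_map)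

lemma openin_image: "openin X.T W \<Longrightarrow> W \<subseteq> U \<Longrightarrow> openin Y.T (\<phi> ` W)"
  using homeomorphic_map_openness[OF \<phi>, of W] topspace_U openin_subset[of X.T W]
  by (simp add: openin_open_subtopology U U')

lemma image_subset: "W \<subseteq> U \<Longrightarrow> \<phi> ` W \<subseteq> U'"
  using \<phi>_image by blast

lemma preimage_image: "W \<subseteq> U \<Longrightarrow> {x \<in> U. \<phi> x \<in> \<phi> ` W} = W"
  using \<phi>_inj by (auto simp: inj_on_def)

lemma openin_preimage:
  assumes "openin Y.T V" "V \<subseteq> U'"
  shows "openin X.T {x \<in> U. \<phi> x \<in> V}"
proof -
  have "\<phi> ` {x \<in> U. \<phi> x \<in> V} = V" using assms \<phi>_image by blast
  moreover have "{x \<in> U. \<phi> x \<in> V} \<subseteq> topspace X.T" using openin_subset[OF U] by blast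
  ultimately have "openin (subtopology X.T U) {x \<in> U. \<phi> x \<in> V}"
    using homeomorphic_map_openness[OF \<phi>, of "{x \<in> U. \<phi> x \<in> V}"] assms topspace_U openin_subset[OF U]
    by (simp add: openin_open_subtopology U')
  then show ?thesis by (simp add: openin_open_subtopology U)
qed

lemma \<eta>_hom:
  assumes "openin Y.T V" "V \<subseteq> U'"
  shows "s \<in> Y.sections V \<Longrightarrow> \<eta> V s \<in> X.sections {x \<in> U. \<phi> x \<in> V}"
    "s \<in> Y.sections V \<Longrightarrow> t \<in> Y.sections V \<Longrightarrow>
      \<eta> V (s \<otimes>\<^bsub>Sec Y.space V\<^esub> t) = \<eta> V s \<otimes>\<^bsub>Sec X.space {x \<in> U. \<phi> x \<in> V}\<^esub> \<eta> V t"
    "s \<in> Y.sections V \<Longrightarrow> t \<in> Y.sections V \<Longrightarrow>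
      \<eta> V (s \<oplus>\<^bsub>Sec Y.space V\<^esub> t) = \<eta> V s \<oplus>\<^bsub>Sec X.space {x \<in> U. \<phi> x \<in> V}\<^esub> \<eta> V t"
    "bij_betw (\<eta> V) (Y.sections V) (X.sections {x \<in> U. \<phi> x \<in> V})"
proof -
  have hom: "\<eta> V \<in> Ring.ring_hom (Sec Y.space V) (Sec X.space {x \<in> U. \<phi> x \<in> V})"
    and bij: "bij_betw (\<eta> V) (carrier (Sec Y.space V)) (carrier (Sec X.space {x \<in> U. \<phi> x \<in> V}))"
    using \<eta>_iso[OF assms] by (auto simp: ring_iso_def)
  show "s \<in> Y.sections V \<Longrightarrow> \<eta> V s \<in> X.sections {x \<in> U. \<phi> x \<in> V}"
    using ring_hom_closed[OF hom] by (simp only: X.space_simps Y.space_simps)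
  show "s \<in> Y.sections V \<Longrightarrow> t \<in> Y.sections V \<Longrightarrow>
      \<eta> V (s \<otimes>\<^bsub>Sec Y.space V\<^esub> t) = \<eta> V s \<otimes>\<^bsub>Sec X.space {x \<in> U. \<phi> x \<in> V}\<^esub> \<eta> V t"
    using ring_hom_mult[OF hom, of s t] by (simp only: X.space_simps(2) Y.space_simps(2))
  show "s \<in> Y.sections V \<Longrightarrow> t \<in> Y.sections V \<Longrightarrow>
      \<eta> V (s \<oplus>\<^bsub>Sec Y.space V\<^esub> t) = \<eta> V s \<oplus>\<^bsub>Sec X.space {x \<in> U. \<phi> x \<in> V}\<^esub> \<eta> V t"
    using ring_hom_add[OF hom, of s t] by (simp only: X.space_simps(2) Y.space_simps(2))
  show "bij_betw (\<eta> V) (Y.sections V) (X.sections {x \<in> U. \<phi> x \<in> V})"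
    using bij by (simp only: X.space_simps Y.space_simps)
qed

lemma stalk_hom_pushforward:
  assumes \<psi>: "X.stalk_hom \<kappa> U p \<psi>"
  shows "Y.stalk_hom \<kappa> U' (\<phi> p) (\<lambda>V s. \<psi> {x \<in> U. \<phi> x \<in> V} (\<eta> V s))"
proof -
  have p: "p \<in> U" and \<kappa>: "comm_ring_hom \<kappa>" using X.stalk_homD[OF \<psi>] by auto
  show ?thesis
    unfolding Y.stalk_hom_def
  proof (intro conjI allI impI ballI, goal_cases)
    case (4 V s t)
    then have V: "openin Y.T V" "V \<subseteq> U'" "\<phi> p \<in> V" by auto
    have W: "openin X.T {x \<in> U. \<phi> x \<in> V}" "{x \<in> U. \<phi> x \<in> V} \<subseteq> U" "p \<in> {x \<in> U. \<phi> x \<in> V}"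
      using openin_preimage[OF V(1,2)] p V by auto
    show ?case
      unfolding \<eta>_hom(2)[OF V(1,2) 4(2,3)]
      by (rule X.stalk_homD(4)[OF \<psi> W \<eta>_hom(1)[OF V(1,2) 4(2)] \<eta>_hom(1)[OF V(1,2) 4(3)]])
  next
    case (5 V s t)
    then have V: "openin Y.T V" "V \<subseteq> U'" "\<phi> p \<in> V" by auto
    have W: "openin X.T {x \<in> U. \<phi> x \<in> V}" "{x \<in> U. \<phi> x \<in> V} \<subseteq> U" "p \<in> {x \<in> U. \<phi> x \<in> V}"
      using openin_preimage[OF V(1,2)] p V by auto
    show ?case
      unfolding \<eta>_hom(3)[OF V(1,2) 5(2,3)]
      by (rule X.stalk_homD(5)[OF \<psi> W \<eta>_hom(1)[OF V(1,2) 5(2)] \<eta>_hom(1)[OF V(1,2) 5(3)]])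
  next
    case (6 V c)
    then have V: "openin Y.T V" "V \<subseteq> U'" "\<phi> p \<in> V" by auto
    have W: "openin X.T {x \<in> U. \<phi> x \<in> V}" "{x \<in> U. \<phi> x \<in> V} \<subseteq> U" "p \<in> {x \<in> U. \<phi> x \<in> V}"
      using openin_preimage[OF V(1,2)] p V by auto
    show ?case using X.stalk_homD(6)[OF \<psi> W] \<eta>_const[OF V(1,2)] by simp
  next
    case (7 V V' s)
    then have V: "openin Y.T V" "V \<subseteq> U'" "\<phi> p \<in> V" and V': "openin Y.T V'" "V' \<subseteq> V" "\<phi> p \<in> V'" "V' \<subseteq> U'" by auto
    have W: "openin X.T {x \<in> U. \<phi> x \<in> V}" "{x \<in> U. \<phi> x \<in> V} \<subseteq> U" "p \<in> {x \<in> U. \<phi> x \<in> V}"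
      using openin_preimage[OF V(1,2)] p V by auto
    have W': "openin X.T {x \<in> U. \<phi> x \<in> V'}" "{x \<in> U. \<phi> x \<in> V'} \<subseteq> {x \<in> U. \<phi> x \<in> V}" "p \<in> {x \<in> U. \<phi> x \<in> V'}"
      using openin_preimage[OF V'(1,4)] p V' by auto
    have s: "s \<in> Y.sections V" using 7 by simp
    show ?case
      unfolding \<eta>_restrict[OF V(1,2) V'(1,2) s]
      by (rule X.stalk_homD(7)[OF \<psi> W W' \<eta>_hom(1)[OF V(1,2) s]])
  qed (use p \<phi>_image \<kappa> U' in auto)
qed

definition \<eta>_inv where "\<eta>_inv W s = inv_into (Y.sections (\<phi> ` W)) (\<eta> (\<phi> ` W)) s"

lemma \<eta>_inv:
  assumes "openin X.T W" "W \<subseteq> U"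
  shows "s \<in> X.sections W \<Longrightarrow> \<eta>_inv W s \<in> Y.sections (\<phi> ` W)" "s \<in> X.sections W \<Longrightarrow> \<eta> (\<phi> ` W) (\<eta>_inv W s) = s"
    "t \<in> Y.sections (\<phi> ` W) \<Longrightarrow> \<eta> (\<phi> ` W) t = s \<Longrightarrow> \<eta>_inv W s = t"
proof -
  have "bij_betw (\<eta> (\<phi> ` W)) (Y.sections (\<phi> ` W)) (X.sections W)"
    using \<eta>_hom(4)[OF openin_image[OF assms(1,2)] image_subset[OF assms(2)]] preimage_image[OF assms(2)] by simp
  then have inj: "inj_on (\<eta> (\<phi> ` W)) (Y.sections (\<phi> ` W))"
    and s: "s \<in> X.sections W \<Longrightarrow> s \<in> \<eta> (\<phi> ` W) ` Y.sections (\<phi> ` W)"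
    by (auto simp: bij_betw_def)
  show "s \<in> X.sections W \<Longrightarrow> \<eta>_inv W s \<in> Y.sections (\<phi> ` W)" "s \<in> X.sections W \<Longrightarrow> \<eta> (\<phi> ` W) (\<eta>_inv W s) = s"
    unfolding \<eta>_inv_def using inv_into_into[OF s] f_inv_into_f[OF s] by auto
  show "t \<in> Y.sections (\<phi> ` W) \<Longrightarrow> \<eta> (\<phi> ` W) t = s \<Longrightarrow> \<eta>_inv W s = t"
    unfolding \<eta>_inv_def using inv_into_f_f[OF inj] by auto
qed

lemma stalk_hom_pullback:
  assumes \<psi>: "Y.stalk_hom \<kappa> U' (\<phi> p) \<psi>" and p: "p \<in> U"
  shows "X.stalk_hom \<kappa> U p (\<lambda>W s. \<psi> (\<phi> ` W) (\<eta>_inv W s))"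
proof -
  have \<kappa>: "comm_ring_hom \<kappa>" by (rule Y.stalk_homD(1)[OF \<psi>])
  note Wi = openin_image image_subset
  have W: "openin Y.T (\<phi> ` W)" "\<phi> ` W \<subseteq> U'" "\<phi> p \<in> \<phi> ` W" if "openin X.T W \<and> W \<subseteq> U \<and> p \<in> W" for W
    using that openin_image image_subset by auto
  show ?thesis
    unfolding X.stalk_hom_def
  proof (intro conjI allI impI ballI, goal_cases)
    case (4 W s t)
    note V = W[OF 4(1)] and inv = \<eta>_inv[of W] and pre = preimage_image[of W]
    have "\<eta>_inv W (s \<otimes>\<^bsub>Sec X.space W\<^esub> t) = \<eta>_inv W s \<otimes>\<^bsub>Sec Y.space (\<phi> ` W)\<^esub> \<eta>_inv W t"
      using 4 \<eta>_hom(2)[OF V(1,2) inv(1) inv(1)] Y.sections_closed(1)[OF V(1) inv(1) inv(1)]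
      by (intro inv(3)) (simp_all del: X.space_simps Y.space_simps add: inv(2) pre)
    then show ?case using 4 by (simp only: Y.stalk_homD(4)[OF \<psi> V inv(1) inv(1)])
  next
    case (5 W s t)
    note V = W[OF 5(1)] and inv = \<eta>_inv[of W] and pre = preimage_image[of W]
    have "\<eta>_inv W (s \<oplus>\<^bsub>Sec X.space W\<^esub> t) = \<eta>_inv W s \<oplus>\<^bsub>Sec Y.space (\<phi> ` W)\<^esub> \<eta>_inv W t"
      using 5 \<eta>_hom(3)[OF V(1,2) inv(1) inv(1)] Y.sections_closed(2)[OF V(1) inv(1) inv(1)]
      by (intro inv(3)) (simp_all del: X.space_simps Y.space_simps add: inv(2) pre)
    then show ?case using 5 by (simp only: Y.stalk_homD(5)[OF \<psi> V inv(1) inv(1)])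
  next
    case (6 W c)
    note V = W[OF 6]
    have "\<eta>_inv W (X.frac_section W (mconst c) 1) = Y.frac_section (\<phi> ` W) (mconst c) 1"
      using 6 \<eta>_const[OF V(1,2), of c] Y.const_section[OF V(1)] by (intro \<eta>_inv(3)) (simp_all add: preimage_image)
    then show ?case using Y.stalk_homD(6)[OF \<psi> V] by simp
  next
    case (7 W W' s)
    note V = W[OF 7(1)] and inv = \<eta>_inv[of W]
    have W': "openin X.T W' \<and> W' \<subseteq> U \<and> p \<in> W'" using 7 by auto
    note V' = W[OF W']
    have sub: "\<phi> ` W' \<subseteq> \<phi> ` W" using 7 by auto
    have s: "\<eta>_inv W s \<in> Y.sections (\<phi> ` W)" "\<eta> (\<phi> ` W) (\<eta>_inv W s) = s" using 7 inv by auto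
    have "\<eta>_inv W' (restrict s W') = restrict (\<eta>_inv W s) (\<phi> ` W')"
      using W' \<eta>_restrict[OF V(1,2) V'(1) sub s(1)] Y.restrict_section[OF s(1) V'(1) sub]
      by (intro \<eta>_inv(3)) (simp_all add: s(2) preimage_image)
    then show ?case using Y.stalk_homD(7)[OF \<psi> V V'(1) sub V'(3) s(1)] by simp
  qed (use p \<kappa> U in auto)
qed

end


section \<open>The infinitesimal lifting property of smooth schemes\<close>

lemma mpoly_closed_det:
  assumes "\<And>i j. i < c \<Longrightarrow> j < c \<Longrightarrow> A i j \<in> carrier (mpoly_ring N)"
  shows "Determinant.det (mat c c (\<lambda>(i, j). A i j)) \<in> carrier (mpoly_ring N)"
proof -
  have "Determinant.det (mat c c (\<lambda>(i, j). A i j)) =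
      (\<Sum>\<pi> \<in> {\<pi>. \<pi> permutes {0..<c}}. signof \<pi> * (\<Prod>i = 0..<c. A i (\<pi> i)))"
    unfolding det_def by (auto intro!: sum.cong prod.cong arg_cong2[of _ _ _ _ "(*)"])
  also have "\<dots> \<in> carrier (mpoly_ring N)"
  proof (rule mpoly_closed_sum, rule mpoly_closed_mult)
    fix \<pi> assume "\<pi> \<in> {\<pi>. \<pi> permutes {0..<c}}"
    then show "(\<Prod>i = 0..<c. A i (\<pi> i)) \<in> carrier (mpoly_ring N)"
      using permutes_in_image[of \<pi> "{0..<c}"] by (intro mpoly_closed_prod assms) auto
    show "signof \<pi> \<in> carrier (mpoly_ring N)"
      by (cases rule: sign_cases[of \<pi>]) (auto intro: mpoly_closed)
  qed
  finally show ?thesis .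
qed

lemma jacobian_minor_closed:
  assumes "\<And>i. i < c \<Longrightarrow> f i \<in> carrier (mpoly_ring N)"
  shows "jacobian_minor c f \<in> carrier (mpoly_ring N)"
  unfolding jacobian_minor_def by (intro mpoly_closed_det mpderiv_closed assms)

lemma open_subspace_simps [simp]:
  "Sec (open_subspace X U) = Sec X" "Res (open_subspace X U) = Res X" "Sca (open_subspace X U) = Sca X"
  "Top (open_subspace X U) = subtopology (Top X) U"
  by (simp_all add: open_subspace_def)

context graded_fractions
begin

lemma point_hom_comp:
  assumes "point_hom p e" "comm_ring_hom h"
  shows "point_hom p (\<lambda>f. h (e f))"
proof -
  interpret h: comm_ring_hom h by fact
  have "comm_ring_hom (\<lambda>f. h (e f))"
    using comm_ring_hom_comp[OF point_homD(2)[OF assms(1)] assms(2)] by (simp add: comp_def)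
  moreover have "h u dvd 1" if "u dvd 1" for u
    using that by (elim dvdE) (metis dvdI h.hom_mult h.hom_one)
  ultimately show ?thesis
    using point_homD(1,3,4)[OF assms(1)] unfolding point_hom_def by simp
qed

text \<open>Two tangent vectors \<open>e1\<close> and \<open>e2\<close> at \<open>p\<close> are transported to an affine scheme with an invertible Jacobian
  minor. There they are evaluations at solutions \<open>\<alpha>\<close> and \<open>\<beta>\<close> of the equations with values in dual numbers.
  A common lift \<open>\<gamma>\<close> of these solutions defines a homomorphism \<open>e'\<close> on the stalk, since units of
  \<open>k[t,e]/(t\<^sup>2,e\<^sup>2)\<close> can be recognised modulo \<open>e\<close>, and this homomorphism is transported back.\<close>

theorem smooth_lifting:
  fixes e1 e2 :: "('x, 'k) mpoly \<Rightarrow> 'k dual"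
  assumes smooth: "smooth space"
    and e: "point_hom p e1" "point_hom p e2"
    and const: "\<And>c. e1 (mconst c) = dual_const c" "\<And>c. e2 (mconst c) = dual_const c"
    and same: "\<And>f. f \<in> carrier (mpoly_ring N) \<Longrightarrow> real_part (e1 f) = real_part (e2 f)"
  obtains U \<theta> where "stalk_hom (dual_const \<circ> dual_const) U p \<theta>"
    "\<And>W s. openin T W \<Longrightarrow> W \<subseteq> U \<Longrightarrow> p \<in> W \<Longrightarrow> s \<in> sections W \<Longrightarrow>
      real_part (\<theta> W s) = germ_value e1 (s p) \<and> map_dual real_part (\<theta> W s) = germ_value e2 (s p)"
proof -
  have "p \<in> topspace (Top space)" using point_homD(1)[OF e(1)] topspace_T by simp
  with smooth obtain U n c f Y' where U: "openin T U" "p \<in> U" and cn: "c \<le> n"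
    and f: "\<And>i. i < c \<Longrightarrow> f i \<in> carrier (mpoly_ring {..<n})"
    and Y': "openin (Top (affine_scheme {..<n} (f ` {..<c}) :: (nat, 'k) mpoly_space)) Y'"
    and minor: "\<And>q. q \<in> Y' \<Longrightarrow> jacobian_minor c f \<notin> q"
    and iso: "isomorphic_spaces (open_subspace space U)
       (open_subspace (affine_scheme {..<n} (f ` {..<c}) :: (nat, 'k) mpoly_space) Y')"
    unfolding smooth_def Let_def space_simps(1) by metis
  interpret Y: affine_fractions "{..<n}" "f ` {..<c}"
    by unfold_locales (use f in auto)
  note Y' = Y'[unfolded Y.affine_scheme_eq Y.space_simps(1)]
  have topU: "topspace (subtopology T U) = U" using openin_subset[OF U(1)] by auto
  from iso obtain \<phi> \<eta> where iso':
      "homeomorphic_map (Top (open_subspace space U)) (Top (open_subspace Y.space Y')) \<phi>"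
      "\<forall>V. openin (Top (open_subspace Y.space Y')) V \<longrightarrow>
        \<eta> V \<in> ring_iso (Sec Y.space V) (Sec space {x \<in> topspace (Top (open_subspace space U)). \<phi> x \<in> V}) \<and>
        (\<forall>c. \<eta> V (Sca Y.space V c) = Sca space {x \<in> topspace (Top (open_subspace space U)). \<phi> x \<in> V} c) \<and>
        (\<forall>V' s. openin (Top (open_subspace Y.space Y')) V' \<and> V' \<subseteq> V \<and> s \<in> carrier (Sec Y.space V) \<longrightarrow>
           \<eta> V' (Res Y.space V V' s) = Res space {x \<in> topspace (Top (open_subspace space U)). \<phi> x \<in> V}
             {x \<in> topspace (Top (open_subspace space U)). \<phi> x \<in> V'} (\<eta> V s))"
    unfolding isomorphic_spaces_def Y.affine_scheme_eq open_subspace_simps(1-3) by (elim exE conjE)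
  have top: "Top (open_subspace space U) = subtopology T U" "Top (open_subspace Y.space Y') = subtopology Y.T Y'"
    by (simp_all add: open_subspace_def)
  note \<phi> = iso'(1)[unfolded top]
  have \<eta>: "\<eta> V \<in> ring_iso (Sec Y.space V) (Sec space {x \<in> U. \<phi> x \<in> V})"
      "\<eta> V (Sca Y.space V c) = Sca space {x \<in> U. \<phi> x \<in> V} c"
      "openin Y.T V' \<Longrightarrow> V' \<subseteq> V \<Longrightarrow> s \<in> carrier (Sec Y.space V) \<Longrightarrow>
           \<eta> V' (Res Y.space V V' s) = Res space {x \<in> U. \<phi> x \<in> V} {x \<in> U. \<phi> x \<in> V'} (\<eta> V s)"
    if "openin Y.T V" "V \<subseteq> Y'" for V V' c s
  proof -
    have "openin (subtopology Y.T Y') V" using that by (simp add: openin_open_subtopology Y')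
    note * = iso'(2)[unfolded top topU, rule_format, OF this]
    show "\<eta> V \<in> ring_iso (Sec Y.space V) (Sec space {x \<in> U. \<phi> x \<in> V})" by (rule *[THEN conjunct1])
    show "\<eta> V (Sca Y.space V c) = Sca space {x \<in> U. \<phi> x \<in> V} c"
      by (rule *[THEN conjunct2, THEN conjunct1, rule_format])
    assume V': "openin Y.T V'" "V' \<subseteq> V" "s \<in> carrier (Sec Y.space V)"
    then have "openin (subtopology Y.T Y') V'" using that by (simp add: openin_open_subtopology Y')
    then show "\<eta> V' (Res Y.space V V' s) = Res space {x \<in> U. \<phi> x \<in> V} {x \<in> U. \<phi> x \<in> V'} (\<eta> V s)"
      using V' by (intro *[THEN conjunct2, THEN conjunct2, rule_format]) auto
  qed
  note U_open = U(1) and pU = U(2)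
  interpret isomorphic_fractions N H J P "{..<n}" "{carrier (mpoly_ring {..<n})}"
    "genideal (mpoly_ring {..<n}) (f ` {..<c})"
    "{p. primeideal p (mpoly_ring {..<n}) \<and> genideal (mpoly_ring {..<n}) (f ` {..<c}) \<subseteq> p}" U Y' \<phi> \<eta>
  proof (rule isomorphic_fractions.intro[OF graded_fractions_axioms Y.graded_fractions_axioms],
      rule isomorphic_fractions_axioms.intro)
    fix V assume V: "openin Y.T V" "V \<subseteq> Y'"
    show "\<eta> V \<in> ring_iso (Sec Y.space V) (Sec space {x \<in> U. \<phi> x \<in> V})" by (rule \<eta>(1)[OF V])
    show "\<eta> V (Y.frac_section V (mconst c) 1) = frac_section {x \<in> U. \<phi> x \<in> V} (mconst c) 1" for c
      using \<eta>(2)[OF V] by simp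
    show "\<eta> V' (restrict s V') = restrict (\<eta> V s) {x \<in> U. \<phi> x \<in> V'}"
      if "openin Y.T V'" "V' \<subseteq> V" "s \<in> Y.sections V" for V' s
      using \<eta>(3)[OF V that(1,2), of s] that(3) by simp
  qed (rule U Y' \<phi>)+
  have hom: "stalk_hom dual_const U p (\<lambda>V s. germ_value e1 (s p))" "stalk_hom dual_const U p (\<lambda>V s. germ_value e2 (s p))"
    by (rule stalk_hom_germ_value e const comm_ring_hom_dual_const U_open pU)+
  define \<chi>1 \<chi>2 where "\<chi>1 V s = germ_value e1 (\<eta> V s p)" and "\<chi>2 V s = germ_value e2 (\<eta> V s p)" for V s
  have \<chi>: "Y.stalk_hom dual_const Y' (\<phi> p) \<chi>1" "Y.stalk_hom dual_const Y' (\<phi> p) \<chi>2"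
    unfolding \<chi>1_def \<chi>2_def by (rule stalk_hom_pushforward hom)+
  define \<alpha> \<beta> where "\<alpha> j = \<chi>1 Y' (Y.frac_section Y' (mvar j) 1)" and "\<beta> j = \<chi>2 Y' (Y.frac_section Y' (mvar j) 1)" for j
  note ev1 = Y.stalk_hom_is_evaluation[OF \<chi>(1), folded \<alpha>_def] and ev2 = Y.stalk_hom_is_evaluation[OF \<chi>(2), folded \<beta>_def]
  have y: "\<phi> p \<in> Y'" and Y'_open: "openin Y.T Y'" using Y.stalk_homD(2,3)[OF \<chi>(1)] by auto
  have \<alpha>\<beta>: "real_part (\<alpha> j) = real_part (\<beta> j)" if "j < n" for j
  proof -
    have one: "1 \<notin> q" if "q \<in> Y'" for q
      using that Y'_open mpoly_prime_closed(2) unfolding Y.openin_T_iff by blast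
    have "Y.frac_section Y' (mvar j) 1 \<in> Y.sections Y'"
      by (rule Y.frac_section_closed[OF Y'_open]) (use that one in \<open>auto intro: mpoly_closed\<close>)
    then have "\<eta> Y' (Y.frac_section Y' (mvar j) 1) \<in> sections {x \<in> U. \<phi> x \<in> Y'}"
      by (rule \<eta>_hom(1)[OF Y'_open subset_refl])
    then obtain a b where ab: "valid p a b" "\<eta> Y' (Y.frac_section Y' (mvar j) 1) p = frac p a b"
      by (rule section_at[of _ _ p]) (use pU y in auto)
    have "real_part (germ_value e1 (frac p a b)) = germ_value (\<lambda>f. real_part (e1 f)) (frac p a b)"
      by (rule germ_value_hom[OF e(1) ab(1) comm_ring_hom_real_part point_hom_comp[OF e(1) comm_ring_hom_real_part] refl])
    moreover have "real_part (germ_value e2 (frac p a b)) = germ_value (\<lambda>f. real_part (e1 f)) (frac p a b)"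
      by (rule germ_value_hom[OF e(2) ab(1) comm_ring_hom_real_part point_hom_comp[OF e(1) comm_ring_hom_real_part] same])
    ultimately show ?thesis unfolding \<alpha>_def \<beta>_def \<chi>1_def \<chi>2_def ab(2) by simp
  qed
  have fJ: "f i \<in> genideal (mpoly_ring {..<n}) (f ` {..<c})" if "i < c" for i
    using that mpoly_genideal(2)[OF Y.F_carrier] by auto
  have "peval dual_const \<alpha> (jacobian_minor c f) dvd 1"
    by (rule Y.point_homD(4)[OF ev1(1), of "carrier (mpoly_ring {..<n})"])
      (use minor[OF y] jacobian_minor_closed f in auto)
  then have minor_ne: "peval (\<lambda>c. c) (\<lambda>j. real_part (\<alpha> j)) (jacobian_minor c f) \<noteq> 0"
    by (auto simp: dual_unit_iff peval_real_part)
  obtain \<gamma> :: "nat \<Rightarrow> 'k dual dual" where \<gamma>: "\<And>j. real_part (\<gamma> j) = \<alpha> j" "\<And>j. j < n \<Longrightarrow> map_dual real_part (\<gamma> j) = \<beta> j"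
    "\<And>i. i < c \<Longrightarrow> peval (dual_const \<circ> dual_const) \<gamma> (f i) = 0"
    by (rule jacobian_lift[OF cn f \<alpha>\<beta> Y.point_homD(3)[OF ev1(1) fJ] Y.point_homD(3)[OF ev2(1) fJ] minor_ne]; (assumption | rule that)+)
  define e' where "e' = (peval (dual_const \<circ> dual_const) \<gamma> :: (nat, 'k) mpoly \<Rightarrow> 'k dual dual)"
  have \<kappa>: "comm_ring_hom (dual_const \<circ> dual_const :: 'k \<Rightarrow> 'k dual dual)"
    by (rule comm_ring_hom_comp comm_ring_hom_dual_const)+
  interpret \<kappa>: comm_ring_hom "dual_const \<circ> dual_const :: 'k \<Rightarrow> 'k dual dual" by (rule \<kappa>)
  have e'_hom: "comm_ring_hom e'" unfolding e'_def by (rule comm_ring_hom_peval[OF \<kappa>])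
  have e'1: "peval dual_const \<alpha> g = real_part (e' g)" for g
    using peval_compose[OF \<kappa> comm_ring_hom_real_part, of \<gamma> g] by (simp add: e'_def comp_def \<gamma>)
  have e'2: "peval dual_const \<beta> g = map_dual real_part (e' g)" if g: "g \<in> carrier (mpoly_ring {..<n})" for g
  proof -
    have "map_dual real_part (e' g) = peval (map_dual real_part \<circ> (dual_const \<circ> dual_const)) (map_dual real_part \<circ> \<gamma>) g"
      unfolding e'_def by (rule peval_compose[OF \<kappa> comm_ring_hom_map_dual[OF comm_ring_hom_real_part]])
    also have "map_dual real_part \<circ> (dual_const \<circ> dual_const) = (dual_const :: 'k \<Rightarrow> 'k dual)"
      by (auto simp: fun_eq_iff dual.expand dual.map_sel)
    also have "peval dual_const (map_dual real_part \<circ> \<gamma>) g = peval dual_const \<beta> g"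
      by (rule peval_cong[OF comm_ring_hom_dual_const g]) (simp add: \<gamma>)
    finally show ?thesis by simp
  qed
  have e': "Y.point_hom (\<phi> p) e'"
    unfolding Y.point_hom_def
  proof (intro conjI ballI impI)
    fix g assume "g \<in> genideal (mpoly_ring {..<n}) (f ` {..<c})"
    then show "e' g = 0"
      by (rule genideal_eval_zero[OF e'_hom Y.F_carrier, rotated]) (auto simp: e'_def \<gamma>)
  next
    fix h b assume "h \<in> {carrier (mpoly_ring {..<n}) :: (nat, 'k) mpoly set}" "b \<in> h" "b \<notin> \<phi> p"
    then have "peval dual_const \<alpha> b dvd 1" by (rule Y.point_homD(4)[OF ev1(1)])
    then show "e' b dvd 1" unfolding e'1 by (subst dual_unit_iff)
  qed (rule e'_hom Y.point_homD(1)[OF ev1(1)])+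
  have \<psi>: "Y.stalk_hom (dual_const \<circ> dual_const) Y' (\<phi> p) (\<lambda>V s. germ_value e' (s (\<phi> p)))"
    by (rule Y.stalk_hom_germ_value[OF e' \<kappa> _ Y'_open y])
      (simp only: e'_def peval_mconst[of "dual_const \<circ> dual_const", OF \<kappa>.hom_zero])
  show thesis
  proof (rule that[OF stalk_hom_pullback[OF \<psi> pU]])
    fix W s assume W: "openin T W" "W \<subseteq> U" "p \<in> W" and s: "s \<in> sections W"
    let ?V = "\<phi> ` W" and ?t = "\<eta>_inv W s"
    have V: "openin Y.T ?V" "?V \<subseteq> Y'" "\<phi> p \<in> ?V" using openin_image image_subset W by auto
    have t: "?t \<in> Y.sections ?V" "\<eta> ?V ?t = s" using \<eta>_inv(1,2)[OF W(1,2) s] by auto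
    obtain a b where ab: "Y.valid (\<phi> p) a b" "?t (\<phi> p) = Y.frac (\<phi> p) a b"
      by (rule Y.section_at[OF t(1) V(3)])
    have "real_part (germ_value e' (?t (\<phi> p))) = germ_value (peval dual_const \<alpha>) (?t (\<phi> p))"
      unfolding ab(2) by (rule Y.germ_value_hom[OF e' ab(1) comm_ring_hom_real_part ev1(1) e'1])
    also have "\<dots> = germ_value e1 (s p)" using ev1(2)[OF V t(1)] t(2) by (simp add: \<chi>1_def)
    finally have 1: "real_part (germ_value e' (?t (\<phi> p))) = germ_value e1 (s p)" .
    have "map_dual real_part (germ_value e' (?t (\<phi> p))) = germ_value (peval dual_const \<beta>) (?t (\<phi> p))"
      unfolding ab(2) by (rule Y.germ_value_hom[OF e' ab(1) comm_ring_hom_map_dual[OF comm_ring_hom_real_part] ev2(1) e'2])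
    also have "\<dots> = germ_value e2 (s p)" using ev2(2)[OF V t(1)] t(2) by (simp add: \<chi>2_def)
    finally show "real_part (germ_value e' (?t (\<phi> p))) = germ_value e1 (s p) \<and>
        map_dual real_part (germ_value e' (?t (\<phi> p))) = germ_value e2 (s p)" using 1 by blast
  qed
qed

end


section \<open>Multihomogeneous polynomials\<close>

text \<open>The coordinates are maximised one after the other, in both sets in parallel: a sum of two values of
  a coordinate is the sum of the two maxima only if both values are maximal. The pair plays the part of the
  leading terms in the proof that a product of nonzero polynomials is nonzero.\<close>

lemma unique_sum_pair:
  fixes A A' :: "('v \<Rightarrow> nat) set"
  assumes "finite V" "finite A" "finite A'" "A \<noteq> {}" "A' \<noteq> {}"
  shows "\<exists>a\<in>A. \<exists>b\<in>A'. \<forall>c\<in>A. \<forall>d\<in>A'. (\<forall>v\<in>V. a v + b v = c v + d v) \<longrightarrow> (\<forall>v\<in>V. a v = c v \<and> b v = d v)"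
  using assms
proof (induction V arbitrary: A A' rule: finite_induct)
  case empty
  then show ?case by auto
next
  case (insert x V)
  define m m' where "m = Max ((\<lambda>a. a x) ` A)" and "m' = Max ((\<lambda>a. a x) ` A')"
  have m: "a \<in> A \<Longrightarrow> a x \<le> m" and m': "b \<in> A' \<Longrightarrow> b x \<le> m'" for a b
    using insert by (auto simp: m_def m'_def)
  have "m \<in> (\<lambda>a. a x) ` A" "m' \<in> (\<lambda>a. a x) ` A'"
    unfolding m_def m'_def using insert by (auto intro!: Max_in)
  then have "{a \<in> A. a x = m} \<noteq> {}" "{b \<in> A'. b x = m'} \<noteq> {}" by auto
  then have "\<exists>a\<in>{a \<in> A. a x = m}. \<exists>b\<in>{b \<in> A'. b x = m'}. \<forall>c\<in>{a \<in> A. a x = m}. \<forall>d\<in>{b \<in> A'. b x = m'}.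
      (\<forall>v\<in>V. a v + b v = c v + d v) \<longrightarrow> (\<forall>v\<in>V. a v = c v \<and> b v = d v)"
    using insert.prems by (intro insert.IH) auto
  then obtain a b where ab': "a \<in> {a \<in> A. a x = m}" "b \<in> {b \<in> A'. b x = m'}"
    and *: "\<forall>c\<in>{a \<in> A. a x = m}. \<forall>d\<in>{b \<in> A'. b x = m'}.
      (\<forall>v\<in>V. a v + b v = c v + d v) \<longrightarrow> (\<forall>v\<in>V. a v = c v \<and> b v = d v)" by (elim bexE)
  then have ab: "a \<in> A" "a x = m" "b \<in> A'" "b x = m'" by auto
  show ?case
  proof (rule bexI[of _ a], rule bexI[of _ b], intro ballI impI)
    fix c d v assume cd: "c \<in> A" "d \<in> A'" "\<forall>v\<in>insert x V. a v + b v = c v + d v" and v: "v \<in> insert x V"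
    have "a x + b x = c x + d x" using cd(3) by simp
    then have x: "c x = m" "d x = m'" using m[OF cd(1)] m'[OF cd(2)] ab by auto
    have "\<forall>v\<in>V. a v = c v \<and> b v = d v"
      using *[THEN bspec, of c, THEN bspec, of d] cd x by simp
    then show "a v = c v \<and> b v = d v" using x ab v by auto
  qed (use ab in auto)
qed

definition component :: "'b set \<Rightarrow> ('v \<Rightarrow> nat) \<Rightarrow> ('v \<times> 'b, 'k::comm_ring_1) mpoly \<Rightarrow> ('v \<times> 'b, 'k) mpoly" where
  "component B \<delta> f =
    (\<Sum>m | m \<in> Poly_Mapping.keys f \<and> multidegree B m = \<delta>. Poly_Mapping.single m (Poly_Mapping.lookup f m))"

lemma lookup_component:
  "Poly_Mapping.lookup (component B \<delta> f) m = (if multidegree B m = \<delta> then Poly_Mapping.lookup f m else 0)"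
  by (auto simp: component_def lookup_sum lookup_single when_def in_keys_iff sum.delta' cong: if_cong)

lemma component_add: "component B \<delta> (f + g) = component B \<delta> f + component B \<delta> g"
  by (rule poly_mapping_eqI) (simp add: lookup_component lookup_add)

lemma component_0 [simp]: "component B \<delta> 0 = 0"
  by (rule poly_mapping_eqI) (simp add: lookup_component)

lemma component_sum: "component B \<delta> (sum f A) = (\<Sum>i\<in>A. component B \<delta> (f i))"
  by (induction A rule: infinite_finite_induct) (simp_all add: component_add)

lemma component_homogeneous:
  "f \<in> homogeneous_part V B \<epsilon> \<Longrightarrow> component B \<delta> f = (if \<delta> = \<epsilon> then f else 0)"
  by (rule poly_mapping_eqI) (auto simp: lookup_component homogeneous_part_def in_keys_iff)

lemma component_in_homogeneous_part:
  "f \<in> carrier (mpoly_ring (V \<times> B)) \<Longrightarrow> component B \<delta> f \<in> homogeneous_part V B \<delta>"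
  by (auto simp: homogeneous_part_def carrier_mpoly_ring in_keys_iff lookup_component split: if_splits)

lemma sum_components:
  "f = (\<Sum>\<delta>\<in>multidegree B ` Poly_Mapping.keys f. component B \<delta> f)"
proof (rule poly_mapping_eqI)
  fix m
  have "(\<Sum>\<delta>\<in>multidegree B ` Poly_Mapping.keys f. Poly_Mapping.lookup (component B \<delta> f) m) =
      (\<Sum>\<delta>\<in>multidegree B ` Poly_Mapping.keys f. if multidegree B m = \<delta> then Poly_Mapping.lookup f m else 0)"
    by (simp add: lookup_component)
  also have "\<dots> = Poly_Mapping.lookup f m"
    by (auto simp: sum.delta in_keys_iff image_iff)
  finally show "Poly_Mapping.lookup f m =
      Poly_Mapping.lookup (\<Sum>\<delta>\<in>multidegree B ` Poly_Mapping.keys f. component B \<delta> f) m"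
    by (simp add: lookup_sum)
qed

lemma component_eq_0: "\<delta> \<notin> multidegree B ` Poly_Mapping.keys f \<Longrightarrow> component B \<delta> f = 0"
  by (rule poly_mapping_eqI) (auto simp: lookup_component in_keys_iff)

lemma multidegree_add: "multidegree B (m + n) = (\<lambda>v. multidegree B m v + multidegree B n v)"
  by (auto simp: multidegree_def lookup_add sum.distrib)

lemma multidegree_outside: "Poly_Mapping.keys m \<subseteq> V \<times> B \<Longrightarrow> v \<notin> V \<Longrightarrow> multidegree B m v = 0"
  unfolding multidegree_def by (rule sum.neutral) (auto simp: in_keys_iff subset_iff)

text \<open>The last parameter determines the coefficients of the polynomials.\<close>

locale multigraded =
  fixes V :: "'v set" and B :: "'b set" and kfield :: "'k::field itself"
  assumes finite_V: "finite V" and finite_B: "finite B"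
begin

abbreviation R :: "('v \<times> 'b, 'k) mpoly set" where "R \<equiv> carrier (mpoly_ring (V \<times> B))"

abbreviation hom :: "('v \<Rightarrow> nat) \<Rightarrow> ('v \<times> 'b, 'k) mpoly set" where "hom \<equiv> homogeneous_part V B"

lemma hom_carrier: "f \<in> hom \<delta> \<Longrightarrow> f \<in> R"
  by (simp add: homogeneous_part_def)

lemma hom_0: "0 \<in> hom \<delta>"
  by (simp add: homogeneous_part_def mpoly_closed)

lemma hom_add: "f \<in> hom \<delta> \<Longrightarrow> g \<in> hom \<delta> \<Longrightarrow> f + g \<in> hom \<delta>"
  unfolding homogeneous_part_def using keys_add[of f g] by (auto intro: mpoly_closed)

lemma hom_uminus: "f \<in> hom \<delta> \<Longrightarrow> - f \<in> hom \<delta>"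
  by (auto simp: homogeneous_part_def in_keys_iff intro: mpoly_closed)

lemma hom_diff: "f \<in> hom \<delta> \<Longrightarrow> g \<in> hom \<delta> \<Longrightarrow> f - g \<in> hom \<delta>"
  using hom_add[of f \<delta> "- g"] hom_uminus by simp

lemma hom_sum: "(\<And>i. i \<in> A \<Longrightarrow> f i \<in> hom \<delta>) \<Longrightarrow> sum f A \<in> hom \<delta>"
  by (induction A rule: infinite_finite_induct) (auto intro: hom_0 hom_add)

lemma hom_mult:
  assumes "f \<in> hom \<delta>" "g \<in> hom \<epsilon>"
  shows "f * g \<in> hom (\<lambda>v. \<delta> v + \<epsilon> v)"
proof -
  have "multidegree B m = (\<lambda>v. \<delta> v + \<epsilon> v)" if m: "m \<in> Poly_Mapping.keys (f * g)" for m
  proof -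
    obtain m1 m2 where "m = m1 + m2" "m1 \<in> Poly_Mapping.keys f" "m2 \<in> Poly_Mapping.keys g"
      using keys_mult[of f g] m by auto
    then show ?thesis using assms by (auto simp: homogeneous_part_def multidegree_add)
  qed
  then show ?thesis using assms by (auto simp: homogeneous_part_def intro: mpoly_closed)
qed

lemma hom_mconst: "mconst c \<in> hom (\<lambda>_. 0)"
proof -
  have "Poly_Mapping.keys (mconst c) \<subseteq> {0}" by (simp add: mconst_def)
  then have "m = 0" if "m \<in> Poly_Mapping.keys (mconst c)" for m using that by blast
  then show ?thesis by (force simp: homogeneous_part_def multidegree_def mpoly_closed_mconst)
qed

lemma hom_1: "1 \<in> hom (\<lambda>_. 0)"
  using hom_mconst[of 1] by simp

lemma hom_mvar: "v \<in> V \<Longrightarrow> b \<in> B \<Longrightarrow> mvar (v, b) \<in> hom (\<lambda>u. if u = v then 1 else 0)"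
  using finite_B
  by (auto simp: homogeneous_part_def mvar_def multidegree_def fun_eq_iff lookup_single when_def mpoly_closed_single
      split: if_splits)

lemma hom_power: "f \<in> hom \<delta> \<Longrightarrow> f ^ n \<in> hom (\<lambda>v. n * \<delta> v)"
proof (induction n)
  case (Suc n)
  then show ?case using hom_mult[of f \<delta> "f ^ n" "\<lambda>v. n * \<delta> v"] by simp
qed (simp add: hom_1)

lemma hom_prod: "finite A \<Longrightarrow> (\<And>i. i \<in> A \<Longrightarrow> f i \<in> hom (\<delta> i)) \<Longrightarrow> prod f A \<in> hom (\<lambda>v. \<Sum>i\<in>A. \<delta> i v)"
proof (induction A rule: finite_induct)
  case (insert x F)
  then show ?case using hom_mult[of "f x" "\<delta> x" "prod f F" "\<lambda>v. \<Sum>i\<in>F. \<delta> i v"] by simp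
qed (simp add: hom_1)

lemma component_hom: "f \<in> R \<Longrightarrow> component B \<delta> f \<in> hom \<delta>"
  by (rule component_in_homogeneous_part)

lemma component_mult:
  assumes "f \<in> R" "g \<in> R"
  shows "component B \<delta> (f * g) =
    (\<Sum>(\<epsilon>, \<epsilon>')\<in>multidegree B ` Poly_Mapping.keys f \<times> multidegree B ` Poly_Mapping.keys g.
      if (\<lambda>v. \<epsilon> v + \<epsilon>' v) = \<delta> then component B \<epsilon> f * component B \<epsilon>' g else 0)"
proof -
  let ?D = "\<lambda>f. multidegree B ` Poly_Mapping.keys f"
  have "f * g = (\<Sum>\<epsilon>\<in>?D f. component B \<epsilon> f) * (\<Sum>\<epsilon>'\<in>?D g. component B \<epsilon>' g)"
    by (simp flip: sum_components)
  also have "\<dots> = (\<Sum>(\<epsilon>, \<epsilon>')\<in>?D f \<times> ?D g. component B \<epsilon> f * component B \<epsilon>' g)"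
    by (simp add: sum_product sum.cartesian_product)
  finally have "component B \<delta> (f * g) = (\<Sum>(\<epsilon>, \<epsilon>')\<in>?D f \<times> ?D g. component B \<delta> (component B \<epsilon> f * component B \<epsilon>' g))"
    by (simp add: component_sum case_prod_unfold)
  also have "\<dots> = (\<Sum>(\<epsilon>, \<epsilon>')\<in>?D f \<times> ?D g. if (\<lambda>v. \<epsilon> v + \<epsilon>' v) = \<delta> then component B \<epsilon> f * component B \<epsilon>' g else 0)"
    by (intro sum.cong refl)
      (auto simp: component_homogeneous[OF hom_mult[OF component_hom[OF assms(1)] component_hom[OF assms(2)]]])
  finally show ?thesis .
qed

definition homogeneous_ideal :: "('v \<times> 'b, 'k) mpoly set \<Rightarrow> bool" where
  "homogeneous_ideal p \<longleftrightarrow> p = genideal (mpoly_ring (V \<times> B)) (p \<inter> (\<Union>\<delta>. hom \<delta>))"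

lemma components_ideal:
  assumes "ideal p (mpoly_ring (V \<times> B))"
  shows "ideal {f \<in> R. \<forall>\<delta>. component B \<delta> f \<in> p} (mpoly_ring (V \<times> B))"
proof (rule mpoly_idealI)
  fix f h assume f: "f \<in> {f \<in> R. \<forall>\<delta>. component B \<delta> f \<in> p}" and h: "h \<in> R"
  then have "component B \<delta> (h * f) \<in> p" for \<delta>
    by (subst component_mult)
      (auto intro!: mpoly_ideal_sum[OF assms] mpoly_ideal_closed(2,4)[OF assms] hom_carrier[OF component_hom])
  then show "h * f \<in> {f \<in> R. \<forall>\<delta>. component B \<delta> f \<in> p}" using f h by (auto intro: mpoly_closed)
qed (use mpoly_ideal_closed[OF assms] in \<open>auto simp: component_add intro: mpoly_closed\<close>)

text \<open>The elements all of whose components are in \<open>p\<close> form an ideal, and this ideal contains the homogeneous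
  elements of \<open>p\<close>, which generate \<open>p\<close>.\<close>

lemma homogeneous_ideal_component:
  assumes "ideal p (mpoly_ring (V \<times> B))" "homogeneous_ideal p" "f \<in> p"
  shows "component B \<delta> f \<in> p"
proof -
  let ?S = "p \<inter> (\<Union>\<delta>. hom \<delta>)"
  have S: "?S \<subseteq> R" by (auto intro: hom_carrier)
  have "?S \<subseteq> {f \<in> R. \<forall>\<delta>. component B \<delta> f \<in> p}"
    using mpoly_ideal_closed(2)[OF assms(1)] by (auto simp: component_homogeneous intro: hom_carrier)
  then have "genideal (mpoly_ring (V \<times> B)) ?S \<subseteq> {f \<in> R. \<forall>\<delta>. component B \<delta> f \<in> p}"
    by (rule mpoly_genideal(3)[OF S components_ideal[OF assms(1)]])
  then show ?thesis using assms(2,3) unfolding homogeneous_ideal_def by blast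
qed

lemma homogeneous_idealI:
  assumes "ideal p (mpoly_ring (V \<times> B))" "\<And>f \<delta>. f \<in> p \<Longrightarrow> component B \<delta> f \<in> p"
  shows "homogeneous_ideal p"
  unfolding homogeneous_ideal_def
proof
  let ?S = "p \<inter> (\<Union>\<delta>. hom \<delta>)"
  have S: "?S \<subseteq> R" by (auto intro: hom_carrier)
  show "genideal (mpoly_ring (V \<times> B)) ?S \<subseteq> p" by (rule mpoly_genideal(3)[OF S assms(1)]) auto
  show "p \<subseteq> genideal (mpoly_ring (V \<times> B)) ?S"
  proof
    fix f assume f: "f \<in> p"
    then have "component B \<delta> f \<in> ?S" for \<delta>
      using assms component_hom mpoly_ideal_closed(1)[OF assms(1) f] by blast
    then have "(\<Sum>\<delta>\<in>multidegree B ` Poly_Mapping.keys f. component B \<delta> f) \<in> genideal (mpoly_ring (V \<times> B)) ?S"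
      using mpoly_genideal(2)[OF S] by (intro mpoly_ideal_sum[OF mpoly_genideal(1)[OF S]]) blast
    then show "f \<in> genideal (mpoly_ring (V \<times> B)) ?S" by (simp flip: sum_components)
  qed
qed

text \<open>The cone over a point. The polynomials all of whose components have values in the prime ideal \<open>\<pp>\<close> of
  the ring \<open>C\<close> form a prime ideal: if \<open>f\<close> and \<open>g\<close> are not of this kind, then among the components whose values
  are not in \<open>\<pp>\<close> there are two whose degrees have a sum that no other such pair has (\<open>unique_sum_pair\<close>). Their
  product is not in \<open>\<pp>\<close>, but modulo \<open>\<pp>\<close> it is the value of a component of \<open>f g\<close>. The ring \<open>C\<close> is a subset of
  a type because polynomials in given variables do not form a type.\<close>

lemma homogeneous_prime_of_values:
  fixes \<kappa> :: "'k \<Rightarrow> 'a::comm_ring_1" and \<alpha> :: "'v \<times> 'b \<Rightarrow> 'a" and C \<pp> :: "'a set"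
  assumes \<kappa>: "comm_ring_hom \<kappa>" "\<And>c. \<kappa> c \<in> C" and \<alpha>: "\<And>x. x \<in> V \<times> B \<Longrightarrow> \<alpha> x \<in> C"
    and C: "\<And>a b. a \<in> C \<Longrightarrow> b \<in> C \<Longrightarrow> a + b \<in> C" "\<And>a b. a \<in> C \<Longrightarrow> b \<in> C \<Longrightarrow> a * b \<in> C"
    and \<pp>: "0 \<in> \<pp>" "1 \<notin> \<pp>" "\<And>a b. a \<in> \<pp> \<Longrightarrow> b \<in> \<pp> \<Longrightarrow> a + b \<in> \<pp>" "\<And>a b. a \<in> \<pp> \<Longrightarrow> b \<in> \<pp> \<Longrightarrow> a - b \<in> \<pp>"
      "\<And>a b. a \<in> \<pp> \<Longrightarrow> b \<in> C \<Longrightarrow> b * a \<in> \<pp>" "\<And>a b. a \<in> C \<Longrightarrow> b \<in> C \<Longrightarrow> a * b \<in> \<pp> \<Longrightarrow> a \<in> \<pp> \<or> b \<in> \<pp>"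
  obtains p where "primeideal p (mpoly_ring (V \<times> B))" "homogeneous_ideal p"
    "\<And>f \<delta>. f \<in> hom \<delta> \<Longrightarrow> f \<in> p \<longleftrightarrow> peval \<kappa> \<alpha> f \<in> \<pp>"
proof
  let ?ev = "peval \<kappa> \<alpha> :: ('v \<times> 'b, 'k) mpoly \<Rightarrow> 'a"
  let ?D = "\<lambda>f. multidegree B ` Poly_Mapping.keys f"
  interpret ev: comm_ring_hom ?ev by (rule comm_ring_hom_peval) fact
  define p where "p = {f \<in> R. \<forall>\<delta>. ?ev (component B \<delta> f) \<in> \<pp>}"
  have evC: "?ev f \<in> C" if "f \<in> R" for f
    using that by (rule peval_closed[OF \<kappa>(1)]) (use \<kappa> \<alpha> C in auto)
  have sum\<pp>: "finite A \<Longrightarrow> (\<And>i. i \<in> A \<Longrightarrow> g i \<in> \<pp>) \<Longrightarrow> sum g A \<in> \<pp>" for A and g :: "'z \<Rightarrow> 'a"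
    by (induction A rule: finite_induct) (auto intro: \<pp>)
  have evc: "?ev (component B \<delta> f) \<in> C" if "f \<in> R" for f \<delta>
    using that by (intro evC hom_carrier[OF component_hom])
  have ev_mult: "?ev (component B \<delta> (f * g)) = (\<Sum>(\<epsilon>, \<epsilon>')\<in>?D f \<times> ?D g.
      if (\<lambda>v. \<epsilon> v + \<epsilon>' v) = \<delta> then ?ev (component B \<epsilon> f) * ?ev (component B \<epsilon>' g) else 0)"
    if "f \<in> R" "g \<in> R" for f g \<delta>
    unfolding component_mult[OF that] ev.hom_sum
    by (rule sum.cong) (auto simp: ev.hom_mult)
  have ideal: "ideal p (mpoly_ring (V \<times> B))"
  proof (rule mpoly_idealI)
    fix f h assume f: "f \<in> p" and h: "h \<in> R"
    then have "?ev (component B \<delta> (h * f)) \<in> \<pp>" for \<delta>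
      by (subst ev_mult) (auto simp: p_def intro!: sum\<pp> \<pp> evc)
    then show "h * f \<in> p" using f h by (auto simp: p_def intro: mpoly_closed)
  qed (auto simp: p_def component_add ev.hom_add intro: \<pp> mpoly_closed)
  show hom_iff: "f \<in> p \<longleftrightarrow> ?ev f \<in> \<pp>" if "f \<in> hom \<delta>" for f \<delta>
    using that \<pp>(1) hom_carrier[OF that] by (auto simp: p_def component_homogeneous)
  show "homogeneous_ideal p"
  proof (rule homogeneous_idealI[OF ideal])
    fix f \<delta> assume "f \<in> p"
    then have f: "f \<in> R" "?ev (component B \<delta> f) \<in> \<pp>" by (auto simp: p_def)
    then show "component B \<delta> f \<in> p" using hom_iff[OF component_hom[OF f(1)]] by simp
  qed
  show "primeideal p (mpoly_ring (V \<times> B))"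
  proof (rule mpoly_primeI[OF ideal])
    show "1 \<notin> p" using hom_iff[OF hom_1] \<pp> by simp
    fix f g assume fg: "f * g \<in> p" and f: "f \<in> R" and g: "g \<in> R"
    show "f \<in> p \<or> g \<in> p"
    proof (rule ccontr)
      assume contra: "\<not> (f \<in> p \<or> g \<in> p)"
      define A where "A f = {\<epsilon> \<in> ?D f. ?ev (component B \<epsilon> f) \<notin> \<pp>}" for f
      have A_ne: "A f \<noteq> {}" if "f \<in> R" "f \<notin> p" for f
      proof -
        from that obtain \<delta> where \<delta>: "?ev (component B \<delta> f) \<notin> \<pp>" by (auto simp: p_def)
        then have "\<delta> \<in> ?D f" using component_eq_0[of \<delta> B f] \<pp>(1) ev.hom_zero by metis
        then show ?thesis using \<delta> by (auto simp: A_def)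
      qed
      have zero: "\<epsilon> v = 0" if "\<epsilon> \<in> ?D f" "f \<in> R" "v \<notin> V" for \<epsilon> f v
        using that by (auto simp: carrier_mpoly_ring multidegree_outside)
      have "finite (A f)" for f by (simp add: A_def)
      moreover have "A f \<noteq> {}" "A g \<noteq> {}" using A_ne f g contra by auto
      ultimately have "\<exists>a\<in>A f. \<exists>b\<in>A g. \<forall>c\<in>A f. \<forall>d\<in>A g.
          (\<forall>v\<in>V. a v + b v = c v + d v) \<longrightarrow> (\<forall>v\<in>V. a v = c v \<and> b v = d v)"
        by (intro unique_sum_pair[OF finite_V])
      then obtain a b where ab: "a \<in> A f" "b \<in> A g" and unique': "\<forall>c\<in>A f. \<forall>d\<in>A g.
          (\<forall>v\<in>V. a v + b v = c v + d v) \<longrightarrow> (\<forall>v\<in>V. a v = c v \<and> b v = d v)"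
        by (elim bexE)
      note unique = unique'[THEN bspec, THEN bspec, THEN mp]
      let ?t = "\<lambda>(\<epsilon>, \<epsilon>'). if (\<lambda>v. \<epsilon> v + \<epsilon>' v) = (\<lambda>v. a v + b v)
        then ?ev (component B \<epsilon> f) * ?ev (component B \<epsilon>' g) else 0"
      \<comment> \<open>All summands of the component of \<open>f * g\<close> of degree \<open>a + b\<close>, except one, have values in \<open>\<pp>\<close>.\<close>
      have rest: "?t x \<in> \<pp>" if x: "x \<in> ?D f \<times> ?D g - {(a, b)}" for x
      proof -
        obtain c d where cd: "x = (c, d)" "c \<in> ?D f" "d \<in> ?D g" "(c, d) \<noteq> (a, b)" using x by auto
        show ?thesis
        proof (cases "(\<lambda>v. c v + d v) = (\<lambda>v. a v + b v)")
          case True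
          have "c \<notin> A f \<or> d \<notin> A g"
          proof (rule ccontr)
            assume "\<not> (c \<notin> A f \<or> d \<notin> A g)"
            then have cdA: "c \<in> A f" "d \<in> A g" by auto
            have "\<forall>v\<in>V. a v + b v = c v + d v" using fun_cong[OF True] by simp
            then have "\<forall>v\<in>V. a v = c v \<and> b v = d v" by (rule unique[OF cdA])
            moreover have "a v = c v \<and> b v = d v" if "v \<notin> V" for v
            proof -
              have "a \<in> ?D f" "b \<in> ?D g" using ab by (simp_all add: A_def)
              then show ?thesis using cd(2,3) zero[OF _ f that] zero[OF _ g that] by metis
            qed
            ultimately have "\<forall>v. c v = a v \<and> d v = b v" by metis
            then have "c = a" "d = b" by (simp_all add: fun_eq_iff)
            then show False using cd by simp
          qed
          then have "?ev (component B c f) \<in> \<pp> \<or> ?ev (component B d g) \<in> \<pp>" using cd by (auto simp: A_def)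
          then show ?thesis
            using cd(1) True \<pp>(5)[OF _ evc[OF f, of c]] \<pp>(5)[OF _ evc[OF g, of d]]
            by (auto simp: mult.commute[of "?ev (component B c f)"])
        qed (use cd \<pp> in auto)
      qed
      have "?ev (component B (\<lambda>v. a v + b v) (f * g)) = ?t (a, b) + sum ?t (?D f \<times> ?D g - {(a, b)})"
        unfolding ev_mult[OF f g] by (rule sum.remove) (use ab in \<open>auto simp: A_def\<close>)
      moreover have "sum ?t (?D f \<times> ?D g - {(a, b)}) \<in> \<pp>" by (rule sum\<pp>) (use rest in auto)
      moreover have "?ev (component B (\<lambda>v. a v + b v) (f * g)) \<in> \<pp>" using fg by (auto simp: p_def)
      ultimately have "?t (a, b) + sum ?t (?D f \<times> ?D g - {(a, b)}) - sum ?t (?D f \<times> ?D g - {(a, b)}) \<in> \<pp>"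
        by (intro \<pp>(4)) simp_all
      then have "?ev (component B a f) * ?ev (component B b g) \<in> \<pp>" by simp
      then show False using \<pp>(6)[OF evc[OF f] evc[OF g]] ab by (auto simp: A_def)
    qed
  qed
qed

end


section \<open>Closed subschemes of products of projective spaces\<close>

context multigraded
begin

definition points :: "('v \<times> 'b, 'k) mpoly set \<Rightarrow> ('v \<times> 'b, 'k) mpoly set set" where
  "points F = {p. primeideal p (mpoly_ring (V \<times> B)) \<and> homogeneous_ideal p \<and>
     genideal (mpoly_ring (V \<times> B)) F \<subseteq> p \<and> (\<forall>v\<in>V. \<exists>b\<in>B. mvar (v, b) \<notin> p)}"

lemma multiprojective_scheme_eq:
  "multiprojective_scheme V B F =
    fraction_space (mpoly_ring (V \<times> B)) (range hom) (genideal (mpoly_ring (V \<times> B)) F) (points F)"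
  by (simp add: multiprojective_scheme_def Let_def points_def homogeneous_ideal_def)

lemma multiprojective_graded_fractions:
  assumes "F \<subseteq> R"
  shows "graded_fractions (V \<times> B) (range hom) (genideal (mpoly_ring (V \<times> B)) F) (points F)"
proof (rule graded_fractions.intro)
  show "\<exists>h''\<in>range hom. \<forall>a\<in>h. \<forall>b\<in>h'. a * b \<in> h''" if "h \<in> range hom" "h' \<in> range hom" for h h'
    using that hom_mult by blast
  show "\<exists>h\<in>range hom. \<forall>c. mconst c \<in> h" using hom_mconst by blast
qed (use mpoly_genideal(1)[OF assms] hom_carrier hom_add in \<open>auto simp: points_def\<close>)

definition unit_degree :: "'v \<Rightarrow> 'v \<Rightarrow> nat" where
  "unit_degree v = (\<lambda>u. if u = v then 1 else 0)"

lemma mvar_hom: "v \<in> V \<Longrightarrow> b \<in> B \<Longrightarrow> mvar (v, b) \<in> hom (unit_degree v)"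
  unfolding unit_degree_def by (rule hom_mvar)

lemma edge_term_hom:
  assumes "v \<in> V" "u \<in> V" "b \<in> B" "c \<in> B"
  shows "mconst a * mvar (v, b) * mvar (u, c) \<in> hom (\<lambda>x. unit_degree v x + unit_degree u x)"
  using hom_mult[OF hom_mult[OF hom_mconst mvar_hom[OF assms(1,3)]] mvar_hom[OF assms(2,4)]] by simp

lemma edge_equation_hom:
  assumes "v \<in> V" "u \<in> V"
  shows "edge_equation B form v u \<in> hom (\<lambda>x. unit_degree v x + unit_degree u x)"
  unfolding edge_equation_def by (intro hom_sum edge_term_hom assms)

end

lemma peval_edge_equation:
  assumes "comm_ring_hom \<kappa>"
  shows "peval \<kappa> \<alpha> (edge_equation B form v u) =
    (\<Sum>b\<in>B. \<Sum>c\<in>B. \<kappa> (form b c) * \<alpha> (v, b) * \<alpha> (u, c))"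
proof -
  interpret \<kappa>: comm_ring_hom \<kappa> by fact
  interpret e: comm_ring_hom "peval \<kappa> \<alpha>" by (rule comm_ring_hom_peval) fact
  show ?thesis by (simp add: edge_equation_def e.hom_sum e.hom_mult)
qed

section \<open>A singular point of the variety of a graph with a cycle\<close>

text \<open>In coordinates, \<open>w\<^sub>0\<close> is the basis vector \<open>b0\<close>. Since the \<open>b0\<close>-coordinates of \<open>x\<close> and \<open>y\<close> are zero, all vectors
  \<open>w\<^sub>0 + t x\<close> and \<open>w\<^sub>0 + e y\<close> have \<open>b0\<close>-coordinate \<open>1\<close>, so that their coordinates are the values of the functions
  \<open>mvar (v, b) / mvar (v, b0)\<close>, which are sections near the point.\<close>

lemma (in multigraded) not_smooth_if_cycle:
  fixes form :: "'b \<Rightarrow> 'b \<Rightarrow> 'k" and E :: "'v set set" and x y :: "'b \<Rightarrow> 'k"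
  assumes form: "\<And>b c. form c b = - form b c" "form b0 b0 = 0" and b0: "b0 \<in> B"
    and x: "x b0 = 0" "(\<Sum>c\<in>B. form b0 c * x c) = 0"
    and y: "y b0 = 0" "(\<Sum>c\<in>B. form b0 c * y c) = 0"
    and xy: "(\<Sum>b\<in>B. \<Sum>c\<in>B. form b c * x b * y c) = 1"
    and E: "\<And>v u. {v, u} \<in> E \<Longrightarrow> v \<in> V \<and> u \<in> V"
    and cycle: "is_cycle E us"
  shows "\<not> smooth (projective_graph_variety V E B form)"
proof
  assume smooth: "smooth (projective_graph_variety V E B form)"
  define F where "F = {edge_equation B form v u | v u. {v, u} \<in> E}"
  have F_hom: "edge_equation B form v u \<in> hom (\<lambda>x. unit_degree v x + unit_degree u x)" if "{v, u} \<in> E" for v u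
    using E[OF that] by (intro edge_equation_hom) auto
  then have FR: "F \<subseteq> R" unfolding F_def using hom_carrier by blast
  let ?J = "genideal (mpoly_ring (V \<times> B)) F"
  interpret X: graded_fractions "V \<times> B" "range hom" ?J "points F"
    by (rule multiprojective_graded_fractions[OF FR])
  have smooth: "smooth X.space"
    using smooth by (simp add: projective_graph_variety_def F_def multiprojective_scheme_eq)
  define w :: "'v \<times> 'b \<Rightarrow> 'k" where "w = (\<lambda>(v, b). if b = b0 then 1 else 0)"
  interpret ev: comm_ring_hom "peval (\<lambda>c. c) w :: ('v \<times> 'b, 'k) mpoly \<Rightarrow> 'k"
    by (rule comm_ring_hom_peval[OF comm_ring_hom_id])
  have w_sum: "(\<Sum>b\<in>B. w (v, b) * g b) = g b0" "(\<Sum>b\<in>B. g b * w (v, b)) = g b0" for v g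
    using b0 finite_B by (simp_all add: w_def if_distrib[of "\<lambda>z. z * _"] if_distrib[of "\<lambda>z. _ * z"] cong: if_cong)
  obtain p where p: "primeideal p (mpoly_ring (V \<times> B))" "homogeneous_ideal p"
    and p_iff: "\<And>f \<delta>. f \<in> hom \<delta> \<Longrightarrow> f \<in> p \<longleftrightarrow> peval (\<lambda>c. c) w f \<in> {0}"
    by (rule homogeneous_prime_of_values[of "\<lambda>c. c" UNIV w "{0}"]) (auto simp: comm_ring_hom_id)
  have edge_ev: "peval (\<lambda>c. c) w (edge_equation B form v u) = 0" for v u
    by (simp only: peval_edge_equation[OF comm_ring_hom_id] w_sum form(2))
  have "F \<subseteq> p" unfolding F_def using p_iff[OF F_hom] edge_ev by auto
  then have Jp: "?J \<subseteq> p" by (rule mpoly_genideal(3)[OF FR mpoly_prime_closed(1)[OF p(1)]])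
  have mvar_b0: "mvar (v, b0) \<notin> p" if "v \<in> V" for v
    using p_iff[OF mvar_hom[OF that b0]] by (simp add: w_def)
  have pP: "p \<in> points F" unfolding points_def using p Jp mvar_b0 b0 by blast
  have point: "X.point_hom p (peval dual_const \<omega>)"
    if \<omega>: "\<And>x. real_part (\<omega> x) = w x" and edge: "\<And>v u. {v, u} \<in> E \<Longrightarrow>
      (\<Sum>b\<in>B. \<Sum>c\<in>B. form b c * (w (v, b) * inf_part (\<omega> (u, c)) + inf_part (\<omega> (v, b)) * w (u, c))) = 0" for \<omega>
    unfolding X.point_hom_def
  proof (intro conjI ballI impI)
    show "comm_ring_hom (peval dual_const \<omega>)" by (rule comm_ring_hom_peval[OF comm_ring_hom_dual_const])
    fix f assume f: "f \<in> ?J"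
    show "peval dual_const \<omega> f = 0"
    proof (rule genideal_eval_zero[OF comm_ring_hom_peval[OF comm_ring_hom_dual_const] FR _ f])
      fix f assume "f \<in> F"
      then obtain v u where vu: "f = edge_equation B form v u" "{v, u} \<in> E" by (auto simp: F_def)
      have "real_part (peval dual_const \<omega> f) = 0" using edge_ev[of v u] by (simp add: peval_real_part \<omega> vu(1))
      moreover have "inf_part (peval dual_const \<omega> f) = 0"
        using edge[OF vu(2)]
        by (simp add: vu(1) peval_edge_equation[OF comm_ring_hom_dual_const] \<omega> algebra_simps)
      ultimately show "peval dual_const \<omega> f = 0" by (simp add: dual.expand)
    qed
  next
    fix h b assume "h \<in> range hom" "b \<in> h" "b \<notin> p"
    then have "peval (\<lambda>c. c) w b \<noteq> 0" using p_iff by auto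
    then show "peval dual_const \<omega> b dvd 1"
      by (subst dual_unit_iff) (simp add: peval_real_part \<omega> dvd_field_iff)
  qed (rule pP)
  define u0 u1 where "u0 = us ! 0" and "u1 = us ! 1"
  define w1 where "w1 = (\<lambda>(v, b). Dual (w (v, b)) (if v = u0 then x b else 0))"
  define w2 where "w2 = (\<lambda>(v, b). Dual (w (v, b)) (if v = u1 then y b else 0))"
  \<comment> \<open>The tangent vectors satisfy the equations to first order because \<open>x\<close> and \<open>y\<close> are orthogonal to \<open>w\<^sub>0\<close>.\<close>
  have orth: "(\<Sum>b\<in>B. \<Sum>c\<in>B. form b c * (w (v, b) * (if u = t then r c else 0) + (if v = t then r b else 0) * w (u, c))) = 0"
    if r: "(\<Sum>c\<in>B. form b0 c * r c) = 0" for v u t r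
  proof -
    have "(\<Sum>b\<in>B. \<Sum>c\<in>B. form b c * (w (v, b) * (if u = t then r c else 0))) =
        (\<Sum>b\<in>B. w (v, b) * (\<Sum>c\<in>B. form b c * (if u = t then r c else 0)))"
      by (simp add: sum_distrib_left ac_simps)
    also have "\<dots> = 0" using r by (cases "u = t") (simp_all add: w_sum)
    finally have 1: "(\<Sum>b\<in>B. \<Sum>c\<in>B. form b c * (w (v, b) * (if u = t then r c else 0))) = 0" .
    have "(\<Sum>b\<in>B. \<Sum>c\<in>B. form b c * ((if v = t then r b else 0) * w (u, c))) =
        (\<Sum>b\<in>B. \<Sum>c\<in>B. (form b c * (if v = t then r b else 0)) * w (u, c))"
      by (simp add: ac_simps)
    also have "\<dots> = (\<Sum>b\<in>B. form b b0 * (if v = t then r b else 0))"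
      by (simp only: w_sum)
    also have "\<dots> = - (\<Sum>b\<in>B. form b0 b * (if v = t then r b else 0))"
      by (simp add: form(1)[of b0] sum_negf)
    also have "\<dots> = 0" using r by (cases "v = t") simp_all
    finally show ?thesis using 1 by (simp add: distrib_left sum.distrib)
  qed
  have e1: "X.point_hom p (peval dual_const w1)"
    by (rule point) (use orth[OF x(2)] in \<open>auto simp: w1_def\<close>)
  have e2: "X.point_hom p (peval dual_const w2)"
    by (rule point) (use orth[OF y(2)] in \<open>auto simp: w2_def\<close>)
  have dc0: "dual_const 0 = 0" by (simp add: dual.expand)
  obtain U \<theta> where \<theta>: "X.stalk_hom (dual_const \<circ> dual_const) U p \<theta>"
    and \<theta>_eq: "\<And>W s. openin X.T W \<Longrightarrow> W \<subseteq> U \<Longrightarrow> p \<in> W \<Longrightarrow> s \<in> X.sections W \<Longrightarrow>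
      real_part (\<theta> W s) = germ_value (peval dual_const w1) (s p) \<and>
      map_dual real_part (\<theta> W s) = germ_value (peval dual_const w2) (s p)"
    by (rule X.smooth_lifting[OF smooth e1 e2])
      (simp_all add: dc0 peval_real_part w1_def w2_def case_prod_unfold)
  let ?m = "\<Prod>v\<in>V. mvar (v, b0) :: ('v \<times> 'b, 'k) mpoly"
  have m: "?m \<in> R" by (intro mpoly_closed) (use b0 in auto)
  have mp: "?m \<notin> p" by (rule mpoly_prime_prod[OF p(1)]) (use mvar_b0 b0 in \<open>auto intro: mpoly_closed\<close>)
  define W where "W = U \<inter> {q \<in> points F. ?m \<notin> q}"
  have W: "openin X.T W" "W \<subseteq> U" "p \<in> W"
    unfolding W_def using openin_Int[OF X.stalk_homD(2)[OF \<theta>] X.openin_basic[OF m]] X.stalk_homD(3)[OF \<theta>] pP mp by auto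
  have WP: "W \<subseteq> points F" by (auto simp: W_def)
  have b0_W: "mvar (v, b0) \<notin> q" if "v \<in> V" "q \<in> W" for v q
  proof
    assume q: "mvar (v, b0) \<in> q"
    have "q \<in> points F" using that WP by blast
    then have ideal: "ideal q (mpoly_ring (V \<times> B))"
      using mpoly_prime_closed(1) by (auto simp: points_def)
    have "?m = mvar (v, b0) * (\<Prod>u\<in>V - {v}. mvar (u, b0))" using finite_V that by (intro prod.remove) auto
    also have "\<dots> \<in> q" by (rule mpoly_ideal_closed(5)[OF ideal q]) (use b0 in \<open>auto intro!: mpoly_closed\<close>)
    finally show False using that by (simp add: W_def)
  qed
  \<comment> \<open>The vectors \<open>\<beta> v\<close> are the common lift of the two tangent vectors.\<close>
  define \<beta> where "\<beta> v b = \<theta> W (X.frac_section W (mvar (v, b)) (mvar (v, b0)))" for v b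
  have sec: "X.frac_section W (mvar (v, b)) (mvar (v, b0)) \<in> X.sections W" and
    valid: "\<And>q. q \<in> W \<Longrightarrow> X.valid q (mvar (v, b)) (mvar (v, b0))" if "v \<in> V" "b \<in> B" for v b
    using that b0 b0_W mvar_hom by (auto intro!: X.frac_section_closed[OF W(1), of "hom (unit_degree v)"] X.validI[of "hom (unit_degree v)"])
  have germ: "germ_value (peval dual_const \<omega>) (X.frac_section W (mvar (v, b)) (mvar (v, b0)) p) = \<omega> (v, b)"
    if "v \<in> V" "b \<in> B" "X.point_hom p (peval dual_const \<omega>)" "\<omega> (v, b0) = 1" for \<omega> v b
    unfolding X.frac_section_apply[OF W(3)]
    by (rule X.germ_value_eqI[OF that(3) valid[OF that(1,2) W(3)]])
      (use that(4) in \<open>simp add: dual.expand\<close>)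
  have \<beta>: "real_part (\<beta> v b) = w1 (v, b)" "map_dual real_part (\<beta> v b) = w2 (v, b)" if "v \<in> V" "b \<in> B" for v b
    unfolding \<beta>_def using \<theta>_eq[OF W sec[OF that]] germ[OF that e1] germ[OF that e2] x(1) y(1)
    by (auto simp: w1_def w2_def w_def dual.expand)
  have edge: "(\<Sum>b\<in>B. \<Sum>c\<in>B. (dual_const \<circ> dual_const) (form b c) * \<beta> v b * \<beta> u c) = 0" if vu: "{v, u} \<in> E" for v u
  proof -
    let ?d = "\<lambda>x. unit_degree v x + unit_degree u x"
    let ?m = "mvar (v, b0) * mvar (u, b0)"
    have V: "v \<in> V" "u \<in> V" using E[OF vu] by auto
    have m_hom: "?m \<in> hom ?d" by (intro hom_mult mvar_hom V b0)
    have PW: "primeideal q (mpoly_ring (V \<times> B))" if "q \<in> W" for q using that WP by (auto simp: points_def)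
    have m_W: "?m \<notin> q" if "q \<in> W" for q
      using mpoly_prime_closed(3)[OF PW[OF that], of "mvar (v, b0)" "mvar (u, b0)"] b0_W[OF _ that] V b0
      by (auto intro: mpoly_closed)
    have one_W: "1 \<notin> q" if "q \<in> W" for q using mpoly_prime_closed(2)[OF PW[OF that]] .
    \<comment> \<open>All terms of the equation are divided by \<open>?m\<close>, which makes them sections that can be added.\<close>
    define G where "G g = \<theta> W (X.frac_section W g ?m)" for g
    have vd: "X.valid q g ?m" if "g \<in> hom ?d" "q \<in> W" for g q
      using that m_hom m_W by (intro X.validI[of "hom ?d"]) auto
    have sc: "X.frac_section W g ?m \<in> X.sections W" if "g \<in> hom ?d" for g
      using that m_hom m_W by (intro X.frac_section_closed[OF W(1), of "hom ?d"]) auto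
    have J0: "0 \<in> ?J" by (rule mpoly_ideal_closed(2)[OF X.J_ideal])
    have G_add: "G (g + g') = G g + G g'" if g: "g \<in> hom ?d" "g' \<in> hom ?d" for g g'
    proof -
      have "X.frac_section W g ?m \<oplus>\<^bsub>Sec X.space W\<^esub> X.frac_section W g' ?m = X.frac_section W (g * ?m + g' * ?m) (?m * ?m)"
        by (rule X.frac_section_add[OF WP vd[OF g(1)] vd[OF g(2)]])
      also have "\<dots> = X.frac_section W (g + g') ?m"
        by (rule X.frac_section_eq[OF WP X.valid_add[OF _ vd[OF g(1)] vd[OF g(2)]] vd[OF hom_add[OF g]]])
          (use WP J0 in \<open>auto simp: algebra_simps\<close>)
      finally show ?thesis
        unfolding G_def using X.stalk_homD(5)[OF \<theta> W sc[OF g(1)] sc[OF g(2)]] by metis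
    qed
    have G_0: "G 0 = 0" using G_add[OF hom_0 hom_0] by simp
    have G_sum: "G (sum g A) = (\<Sum>i\<in>A. G (g i))" if "finite A" "\<And>i. i \<in> A \<Longrightarrow> g i \<in> hom ?d" for g and A :: "'b set"
      using that
    proof (induction A rule: finite_induct)
      case (insert i A)
      then show ?case using G_add[of "g i" "sum g A"] hom_sum[of A g ?d] by auto
    qed (simp add: G_0)
    have G_term: "G (mconst a * mvar (v, b) * mvar (u, c)) = (dual_const \<circ> dual_const) a * \<beta> v b * \<beta> u c"
      if bc: "b \<in> B" "c \<in> B" for a b c
    proof -
      have va: "X.valid q (mconst a) 1" if "q \<in> W" for q using WP that by (intro X.valid_const) auto
      have sa: "X.frac_section W (mconst a) 1 \<in> X.sections W" by (rule X.const_section[OF W(1)])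
      note v1 = valid[OF V(1) bc(1)] and v2 = valid[OF V(2) bc(2)]
      note s1 = sec[OF V(1) bc(1)] and s2 = sec[OF V(2) bc(2)]
      have 1: "X.frac_section W (mconst a) 1 \<otimes>\<^bsub>Sec X.space W\<^esub> X.frac_section W (mvar (v, b)) (mvar (v, b0)) =
          X.frac_section W (mconst a * mvar (v, b)) (1 * mvar (v, b0))"
        by (rule X.frac_section_mult[OF WP va v1])
      have 2: "X.frac_section W (mconst a * mvar (v, b)) (1 * mvar (v, b0)) \<otimes>\<^bsub>Sec X.space W\<^esub> X.frac_section W (mvar (u, c)) (mvar (u, b0)) =
          X.frac_section W (mconst a * mvar (v, b) * mvar (u, c)) (1 * mvar (v, b0) * mvar (u, b0))"
        by (rule X.frac_section_mult[OF WP X.valid_mult[OF _ va v1] v2]) (use WP in auto)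
      have s3: "X.frac_section W (mconst a * mvar (v, b)) (1 * mvar (v, b0)) \<in> X.sections W"
        using X.sections_closed(1)[OF W(1) sa s1] unfolding 1 .
      show ?thesis
        using X.stalk_homD(4)[OF \<theta> W sa s1] X.stalk_homD(4)[OF \<theta> W s3 s2] X.stalk_homD(6)[OF \<theta> W, of a]
        unfolding 1 2 G_def \<beta>_def by simp
    qed
    have "edge_equation B form v u \<in> ?J"
      using mpoly_genideal(2)[OF FR] vu by (auto simp: F_def)
    then have "X.frac_section W (edge_equation B form v u) ?m = X.frac_section W 0 ?m"
      using m_hom by (intro X.frac_section_eq[OF WP vd[OF edge_equation_hom[OF V]] vd[OF hom_0]])
        (auto intro: mpoly_ideal_closed(5)[OF X.J_ideal] hom_carrier)
    then have "G (edge_equation B form v u) = 0" using G_0 by (simp add: G_def)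
    moreover have "G (edge_equation B form v u) =
        (\<Sum>b\<in>B. \<Sum>c\<in>B. (dual_const \<circ> dual_const) (form b c) * \<beta> v b * \<beta> u c)"
      unfolding edge_equation_def
      by (simp add: G_sum[OF finite_B] hom_sum edge_term_hom[OF V] G_term del: comp_apply cong: sum.cong)
    ultimately show ?thesis by simp
  qed
  define \<zeta> where "\<zeta> v b = inf_part (inf_part (\<beta> v b))" for v b
  define z where "z v = (\<Sum>b\<in>B. form b b0 * \<zeta> v b)" for v
  \<comment> \<open>The \<open>t e\<close>-part of the equation of an edge.\<close>
  have key: "z v - z u + (if v = u0 \<and> u = u1 then 1 else 0) - (if v = u1 \<and> u = u0 then 1 else 0) = 0"
    if vu: "{v, u} \<in> E" for v u
  proof -
    have V: "v \<in> V" "u \<in> V" using E[OF vu] by auto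
    let ?X = "\<lambda>v b. if v = u0 then x b else 0" and ?Y = "\<lambda>v b. if v = u1 then y b else 0"
    have parts: "real_part (real_part (\<beta> v b)) = w (v, b)" "inf_part (real_part (\<beta> v b)) = ?X v b"
      "real_part (inf_part (\<beta> v b)) = ?Y v b" if "v \<in> V" "b \<in> B" for v b
      using \<beta>(1)[OF that] arg_cong[OF \<beta>(2)[OF that], of inf_part] by (simp_all add: w1_def w2_def dual.map_sel)
    have "0 = inf_part (inf_part (\<Sum>b\<in>B. \<Sum>c\<in>B. (dual_const \<circ> dual_const) (form b c) * \<beta> v b * \<beta> u c))"
      unfolding edge[OF vu] by simp
    also have "\<dots> = (\<Sum>b\<in>B. \<Sum>c\<in>B. form b c * (w (v, b) * \<zeta> u c + ?X v b * ?Y u c + ?Y v b * ?X u c + \<zeta> v b * w (u, c)))"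
      unfolding dual_sum
      by (intro sum.cong refl) (simp add: parts V \<zeta>_def algebra_simps)
    also have "\<dots> = (\<Sum>b\<in>B. \<Sum>c\<in>B. form b c * (w (v, b) * \<zeta> u c)) + (\<Sum>b\<in>B. \<Sum>c\<in>B. form b c * (?X v b * ?Y u c)) +
        (\<Sum>b\<in>B. \<Sum>c\<in>B. form b c * (?Y v b * ?X u c)) + (\<Sum>b\<in>B. \<Sum>c\<in>B. form b c * (\<zeta> v b * w (u, c)))"
      by (simp add: distrib_left sum.distrib)
    also have "(\<Sum>b\<in>B. \<Sum>c\<in>B. form b c * (w (v, b) * \<zeta> u c)) = (\<Sum>b\<in>B. w (v, b) * (\<Sum>c\<in>B. form b c * \<zeta> u c))"
      by (simp add: sum_distrib_left ac_simps)
    also have "\<dots> = - z u"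
      unfolding w_sum z_def sum_negf[symmetric] by (simp add: form(1)[of b0])
    also have "(\<Sum>b\<in>B. \<Sum>c\<in>B. form b c * (\<zeta> v b * w (u, c))) = (\<Sum>b\<in>B. \<Sum>c\<in>B. (form b c * \<zeta> v b) * w (u, c))"
      by (simp add: ac_simps)
    also have "\<dots> = z v" unfolding w_sum z_def ..
    also have "(\<Sum>b\<in>B. \<Sum>c\<in>B. form b c * (?X v b * ?Y u c)) = (if v = u0 \<and> u = u1 then 1 else 0)"
      using xy by (auto simp: mult.assoc)
    also have "(\<Sum>b\<in>B. \<Sum>c\<in>B. form b c * (?Y v b * ?X u c)) = - (if v = u1 \<and> u = u0 then 1 else 0)"
    proof -
      have "(\<Sum>b\<in>B. \<Sum>c\<in>B. form b c * (y b * x c)) = (\<Sum>c\<in>B. \<Sum>b\<in>B. - (form c b * x c * y b))"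
        by (subst sum.swap, intro sum.cong refl, subst (1) form(1)) (simp add: ac_simps)
      then show ?thesis using xy by (auto simp: sum_negf)
    qed
    finally show ?thesis by (simp add: algebra_simps)
  qed
  let ?n = "length us"
  have n: "3 \<le> ?n" "distinct us" and edges: "\<And>i. i < ?n \<Longrightarrow> {us ! i, us ! (Suc i mod ?n)} \<in> E"
    using cycle by (auto simp: is_cycle_def)
  have dist: "us ! i = us ! j \<longleftrightarrow> i = j" if "i < ?n" "j < ?n" for i j
    using n that by (simp add: nth_eq_iff_index_eq)
  have step: "z (us ! i) = z (us ! (Suc i mod ?n))" if "1 \<le> i" "i < ?n" for i
  proof -
    have j: "Suc i mod ?n < ?n" by (rule mod_less_divisor) (use n in linarith)
    have "\<not> (us ! i = u1 \<and> us ! (Suc i mod ?n) = u0)"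
    proof
      assume "us ! i = u1 \<and> us ! (Suc i mod ?n) = u0"
      then have "i = 1" "Suc i mod ?n = 0"
        using dist[of i 1] dist[OF j, of 0] n that unfolding u0_def u1_def by linarith+
      then show False using n by simp
    qed
    moreover have "us ! i \<noteq> u0"
    proof
      assume "us ! i = u0"
      then show False using dist[of i 0] n that unfolding u0_def by linarith
    qed
    ultimately show ?thesis using key[OF edges[OF that(2)]] by auto
  qed
  have chain: "z (us ! 1) = z (us ! Suc i)" if "Suc i < ?n" for i
    using that
  proof (induction i)
    case (Suc i)
    then show ?case using step[of "Suc i"] by simp
  qed simp
  obtain k where k: "?n = Suc (Suc (Suc k))" using n(1) by (metis Suc_le_D numeral_3_eq_3 Suc_le_mono)
  have "z u1 = z u0"
    using chain[of "Suc k"] step[of "Suc (Suc k)"] k unfolding u0_def u1_def by simp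
  moreover have "{u0, u1} \<in> E" using edges[of 0] k unfolding u0_def u1_def by simp
  moreover have "u0 \<noteq> u1" using dist[of 0 1] k unfolding u0_def u1_def by simp
  ultimately show False using key[of u0 u1] by simp
qed


section \<open>Symplectic forms in coordinates\<close>

context symplectic_space
begin

lemma form_add: "form (x + y) z = form x z + form y z" "form z (x + y) = form z x + form z y"
  using linear_left[of z] linear_right[of z]
  by (simp_all add: Vector_Spaces.linear_iff)

lemma form_scale: "form (scale a x) z = a * form x z" "form z (scale a x) = a * form z x"
  using linear_left[of z] linear_right[of z]
  by (simp_all add: Vector_Spaces.linear_iff)

lemma form_zero: "form 0 z = 0" "form z 0 = 0"
  using form_scale(1)[of 0 0 z] form_scale(2)[of z 0 0] by simp_all

lemma form_sum: "form (sum f A) z = (\<Sum>i\<in>A. form (f i) z)" "form z (sum f A) = (\<Sum>i\<in>A. form z (f i))"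
  by (induction A rule: infinite_finite_induct) (simp_all add: form_add form_zero)

lemma form_antisym: "form y x = - form x y"
proof -
  have "form y x + form x y = 0"
    using alternating[of "x + y"] by (simp only: form_add alternating[of x] alternating[of y] add_0_left add_0_right)
  then show ?thesis by (simp add: eq_neg_iff_add_eq_0)
qed

lemma in_coordinates: obtains \<xi> where "w = (\<Sum>b\<in>Basis. scale (\<xi> b) b)"
proof -
  have "w \<in> range (\<lambda>\<xi>. \<Sum>b\<in>Basis. scale (\<xi> b) b)"
    using span_Basis unfolding span_finite[OF finite_Basis] by simp
  then show thesis using that by blast
qed

lemma form_eq_0_if_on_Basis:
  assumes "\<And>c. c \<in> Basis \<Longrightarrow> form w c = 0"
  shows "w = 0"
proof (rule nondegenerate)
  fix y
  obtain \<xi> where "y = (\<Sum>b\<in>Basis. scale (\<xi> b) b)" by (rule in_coordinates)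
  then show "form w y = 0" using assms by (simp add: form_sum form_scale)
qed

lemma form_matrix_nondegenerate:
  assumes "\<And>c. c \<in> Basis \<Longrightarrow> (\<Sum>b\<in>Basis. \<xi> b * form b c) = 0" "b \<in> Basis"
  shows "\<xi> b = 0"
proof -
  have "(\<Sum>b\<in>Basis. scale (\<xi> b) b) = 0"
    by (rule form_eq_0_if_on_Basis) (simp add: form_sum form_scale assms)
  then show ?thesis by (rule independentD[OF independent_Basis finite_Basis subset_refl _ assms(2)])
qed

text \<open>The map that sends \<open>w\<close> to the vector with coordinates \<open>form w c\<close> is injective by non-degeneracy, and
  hence surjective. The coordinates of a preimage of \<open>a\<close> are a row of the inverse of the matrix of the form.\<close>

lemma form_matrix_inverse:
  assumes a: "a \<in> Basis"
  obtains \<xi> where "\<And>c. c \<in> Basis \<Longrightarrow> (\<Sum>b\<in>Basis. \<xi> b * form b c) = (if c = a then 1 else 0)"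
proof -
  let ?T = "\<lambda>w. \<Sum>c\<in>Basis. scale (form w c) c"
  have lin: "Vector_Spaces.linear scale scale ?T"
    by (unfold_locales) (simp_all add: form_add form_scale scale_left_distrib sum.distrib scale_sum_right)
  interpret T: Vector_Spaces.linear scale scale ?T by (rule lin)
  have T0: "w = 0" if "?T w = 0" for w
    using independentD[OF independent_Basis finite_Basis subset_refl that] by (intro form_eq_0_if_on_Basis)
  have "inj ?T"
  proof (rule injI)
    fix x y assume "?T x = ?T y"
    then have "?T x - ?T y = 0" by simp
    then have "?T (x - y) = 0" using T.diff[of x y] by simp
    then show "x = y" using T0[of "x - y"] by simp
  qed
  then have "surj ?T" by (rule linear_inj_imp_surj[OF lin])
  then have "a \<in> range ?T" by simp
  then obtain w where w: "?T w = a" by (elim rangeE) simp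
  obtain \<xi> where \<xi>: "w = (\<Sum>b\<in>Basis. scale (\<xi> b) b)" by (rule in_coordinates)
  have "(\<Sum>c\<in>Basis. scale (form w c - (if c = a then 1 else 0)) c) = 0"
  proof -
    have "(\<Sum>c\<in>Basis. scale (if c = a then 1 else 0) c) = (\<Sum>c\<in>Basis. if c = a then c else 0)"
      by (rule sum.cong) auto
    also have "\<dots> = a" using a finite_Basis by simp
    finally show ?thesis using w by (simp add: scale_left_diff_distrib sum_subtractf)
  qed
  from independentD[OF independent_Basis finite_Basis subset_refl this]
  have "form w c = (if c = a then 1 else 0)" if "c \<in> Basis" for c using that by fastforce
  then show thesis using that[of \<xi>] by (simp add: \<xi> form_sum form_scale)
qed

text \<open>Choose \<open>b1\<close> with \<open>form b0 b1 \<noteq> 0\<close>. A multiple of \<open>b1\<close> can be subtracted from any vector to make it orthogonal to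
  \<open>b0\<close>. The vector \<open>x\<close> is obtained in this way from a third basis vector \<open>b2\<close>. If \<open>x\<close> were orthogonal to all vectors
  that are orthogonal to \<open>b0\<close>, then \<open>form x\<close> would be a multiple of \<open>form b0\<close>, and \<open>x\<close> a multiple of \<open>b0\<close>. So some
  basis vector \<open>c\<close>, made orthogonal to \<open>b0\<close> and rescaled, serves as \<open>y\<close>; its \<open>b0\<close>-coordinate can be removed
  because \<open>b0\<close> is orthogonal to \<open>b0\<close> and to \<open>x\<close>.\<close>

lemma symplectic_coordinates:
  assumes "3 \<le> dim (UNIV :: 'w set)"
  obtains b0 x y where "b0 \<in> Basis" "x b0 = 0" "(\<Sum>c\<in>Basis. form b0 c * x c) = 0"
    "y b0 = 0" "(\<Sum>c\<in>Basis. form b0 c * y c) = 0" "(\<Sum>b\<in>Basis. \<Sum>c\<in>Basis. form b c * x b * y c) = 1"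
proof -
  have card: "3 \<le> card Basis" using assms by simp
  then have "Basis \<noteq> {}" by auto
  then obtain b0 where b0: "b0 \<in> Basis" by blast
  have "b0 \<noteq> 0" using b0 independent_Basis dependent_zero by blast
  then obtain b1 where b1: "b1 \<in> Basis" "form b0 b1 \<noteq> 0" using form_eq_0_if_on_Basis by blast
  have b01: "b1 \<noteq> b0" using b1 alternating by auto
  have "card {b0, b1} < card Basis" using card b01 by simp
  then obtain b2 where b2: "b2 \<in> Basis" "b2 \<noteq> b0" "b2 \<noteq> b1"
    using card_mono[of "{b0, b1}" Basis] by fastforce
  define a where "a = form b0 b1"
  have a: "a \<noteq> 0" using b1 by (simp add: a_def)
  define t where "t = form b0 b2 / a"
  define x where "x c = (if c = b2 then 1 else 0) - (if c = b1 then t else 0)" for c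
  have delta: "(\<Sum>c\<in>Basis. g c * (if c = b then r else 0)) = g b * r" if "b \<in> Basis" for g b and r :: 'k
    using that finite_Basis by (simp add: if_distrib[of "\<lambda>z. _ * z"] cong: if_cong)
  have x_sum: "(\<Sum>c\<in>Basis. g c * x c) = g b2 - g b1 * t" for g
    using b1 b2 by (simp add: x_def right_diff_distrib sum_subtractf delta)
  define f where "f c = (\<Sum>b\<in>Basis. form b c * x b)" for c
  have f_b0: "f b0 = 0"
    unfolding f_def x_sum using a
    by (simp add: form_antisym[of b2 b0] form_antisym[of b1 b0] t_def a_def)
  have "\<exists>c\<in>Basis. f c - form b0 c / a * f b1 \<noteq> 0"
  proof (rule ccontr)
    assume contra: "\<not> ?thesis"
    \<comment> \<open>Otherwise \<open>x = s b0\<close>, which contradicts the coefficient of \<open>b2\<close>.\<close>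
    define s where "s = f b1 / a"
    let ?\<xi> = "\<lambda>b. x b - (if b = b0 then s else 0)"
    have "?\<xi> b2 = 0"
    proof (rule form_matrix_nondegenerate[OF _ b2(1)])
      fix c assume c: "c \<in> Basis"
      have "?\<xi> b * form b c = form b c * x b - form b c * (if b = b0 then s else 0)" for b
        by (simp add: algebra_simps)
      then have "(\<Sum>b\<in>Basis. ?\<xi> b * form b c) = f c - form b0 c * s"
        by (simp only: f_def sum_subtractf delta[OF b0])
      then show "(\<Sum>b\<in>Basis. ?\<xi> b * form b c) = 0" using contra c by (simp add: s_def)
    qed
    then show False using b2 by (simp add: x_def)
  qed
  then obtain c where c: "c \<in> Basis" and r: "f c - form b0 c / a * f b1 \<noteq> 0" by blast
  define r where "r = f c - form b0 c / a * f b1"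
  define y' where "y' d = (if d = c then 1 else 0) - (if d = b1 then form b0 c / a else 0)" for d
  have y'_sum: "(\<Sum>d\<in>Basis. g d * y' d) = g c - g b1 * (form b0 c / a)" for g
    using b1 c by (simp add: y'_def right_diff_distrib sum_subtractf delta)
  define y where "y d = (y' d - (if d = b0 then y' b0 else 0)) / r" for d
  have y_sum: "(\<Sum>d\<in>Basis. g d * y d) = (g c - g b1 * (form b0 c / a) - g b0 * y' b0) / r" for g
    using y'_sum[of g] delta[OF b0, of g "y' b0"]
    by (simp add: y_def right_diff_distrib sum_subtractf flip: sum_divide_distrib)
  have "(\<Sum>b\<in>Basis. \<Sum>c\<in>Basis. form b c * x b * y c) = (\<Sum>c\<in>Basis. f c * y c)"
    by (subst sum.swap) (simp add: f_def sum_distrib_right)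
  also have "\<dots> = 1" using r f_b0 by (simp add: y_sum r_def mult.commute)
  finally have "(\<Sum>b\<in>Basis. \<Sum>c\<in>Basis. form b c * x b * y c) = 1" .
  moreover have "(\<Sum>c\<in>Basis. form b0 c * y c) = 0"
    unfolding y_sum using a by (simp add: alternating a_def[symmetric])
  moreover have "(\<Sum>c\<in>Basis. form b0 c * x c) = 0"
    unfolding x_sum using a by (simp add: t_def a_def[symmetric])
  moreover have "x b0 = 0" "y b0 = 0" using b2 b01 by (auto simp: x_def y_def)
  ultimately show thesis using that b0 by blast
qed

end

section \<open>Cycles and degeneracy\<close>

lemma cycle_neighbours:
  assumes "is_cycle E us" "i < length us"
  shows "card (neighbours E (us ! i) \<inter> set us) \<ge> 2"
proof -
  let ?n = "length us"
  have n: "3 \<le> ?n" "distinct us" and edges: "\<And>i. i < ?n \<Longrightarrow> {us ! i, us ! (Suc i mod ?n)} \<in> E"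
    using assms by (auto simp: is_cycle_def)
  define j where "j = Suc i mod ?n"
  define l where "l = (if i = 0 then ?n - 1 else i - 1)"
  have l: "l < ?n" "Suc l mod ?n = i" using assms(2) n by (auto simp: l_def)
  have j: "j < ?n" using n unfolding j_def by (intro mod_less_divisor) linarith
  have "j \<noteq> l"
  proof (cases "Suc i < ?n")
    case False
    then have "Suc i = ?n" using assms(2) by simp
    then have "i = ?n - 1" "j = 0" by (simp_all add: j_def)
    then show ?thesis using n by (auto simp: l_def)
  qed (use n in \<open>auto simp: j_def l_def\<close>)
  then have "us ! j \<noteq> us ! l" using n j l by (simp add: nth_eq_iff_index_eq)
  moreover have "{us ! i, us ! j} \<in> E" "{us ! i, us ! l} \<in> E"
    using edges[OF assms(2)] edges[OF l(1)] l(2) by (auto simp: j_def insert_commute)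
  ultimately have "{us ! j, us ! l} \<subseteq> neighbours E (us ! i) \<inter> set us" "card {us ! j, us ! l} = 2"
    using j l by (auto simp: neighbours_def)
  then show ?thesis by (metis List.finite_set card_mono finite_Int)
qed

text \<open>The least vertex of the cycle has two neighbours on the cycle, and both are greater.\<close>

lemma degenerate_cycle:
  assumes "simple_graph V E" "degenerate d V E" "is_cycle E us"
  shows "2 \<le> d"
proof -
  obtain r where r: "strict_linear_order_on V r" "\<And>v. v \<in> V \<Longrightarrow> card {u \<in> neighbours E v. (v, u) \<in> r} \<le> d"
    using assms(2) by (auto simp: degenerate_def)
  have n: "3 \<le> length us" and edges: "\<And>i. i < length us \<Longrightarrow> {us ! i, us ! (Suc i mod length us)} \<in> E"
    using assms by (auto simp: is_cycle_def)
  have usV: "set us \<subseteq> V"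
    using edges assms(1) by (fastforce simp: simple_graph_def in_set_conv_nth)
  have fV: "finite V" using assms(1) by (simp add: simple_graph_def)
  let ?S = "r \<inter> (set us \<times> set us)"
  have "trans r" "irrefl r" "total_on V r" using r(1) by (auto simp: strict_linear_order_on_def)
  then have "acyclic ?S"
    by (metis acyclic_subset acyclicI Int_lower1 irrefl_def trancl_id)
  then have "wf ?S" by (intro finite_acyclic_wf) auto
  moreover have "us ! 0 \<in> set us" using n by (intro nth_mem) linarith
  ultimately obtain v where v: "v \<in> set us" "\<And>u. (u, v) \<in> ?S \<Longrightarrow> u \<notin> set us"
    by (metis wfE_min)
  obtain i where i: "i < length us" "us ! i = v" using v by (auto simp: in_set_conv_nth)
  have "(v, u) \<in> r" if "u \<in> neighbours E v \<inter> set us" for u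
  proof -
    have "{v, u} \<in> E" using that by (simp add: neighbours_def)
    then have "card {v, u} = 2" using assms(1) by (simp add: simple_graph_def)
    then have "u \<noteq> v" by auto
    moreover have "u \<in> V" "v \<in> V" using that v(1) usV by auto
    ultimately have "(v, u) \<in> r \<or> (u, v) \<in> r" using \<open>total_on V r\<close> unfolding total_on_def by blast
    moreover have "(u, v) \<notin> r" using v(2)[of u] that v(1) by blast
    ultimately show ?thesis by blast
  qed
  then have "neighbours E v \<inter> set us \<subseteq> {u \<in> neighbours E v. (v, u) \<in> r}" by auto
  moreover have "neighbours E v \<subseteq> V" using assms(1) by (auto simp: neighbours_def simple_graph_def)
  then have "finite {u \<in> neighbours E v. (v, u) \<in> r}" using fV by (simp add: finite_subset)
  ultimately have "card (neighbours E v \<inter> set us) \<le> card {u \<in> neighbours E v. (v, u) \<in> r}"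
    by (intro card_mono)
  then show ?thesis using r(2)[of v] v(1) usV cycle_neighbours[OF assms(3) i(1)] i(2) by auto
qed

lemma max_degree_cycle:
  assumes "simple_graph V E" "is_cycle E us"
  shows "2 \<le> max_degree V E"
proof -
  have n: "3 \<le> length us" and edges: "\<And>i. i < length us \<Longrightarrow> {us ! i, us ! (Suc i mod length us)} \<in> E"
    using assms by (auto simp: is_cycle_def)
  have fV: "finite V" using assms(1) by (simp add: simple_graph_def)
  have 0: "0 < length us" using n by linarith
  have v: "us ! 0 \<in> V" using edges[OF 0] assms(1) by (auto simp: simple_graph_def)
  have "neighbours E (us ! 0) \<subseteq> V" using assms(1) by (auto simp: neighbours_def simple_graph_def)
  then have "card (neighbours E (us ! 0) \<inter> set us) \<le> card (neighbours E (us ! 0))"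
    using fV by (intro card_mono) (auto intro: finite_subset)
  also have "\<dots> \<le> max_degree V E" unfolding max_degree_def using fV v by (intro Max_ge) auto
  finally show ?thesis using cycle_neighbours[OF assms(2) 0] by linarith
qed


section \<open>Dehomogenisation\<close>

text \<open>The chart of the closed subscheme defined by \<open>F\<close> on which the coordinates with index \<open>(v, bv v)\<close> are
  invertible. The other coordinates are numbered by \<open>idx\<close>. The numbering is a parameter, because the
  Jacobian minors that occur in the definition of smoothness belong to the first variables.\<close>

locale chart = multigraded V B kfield
  for V :: "'v set" and B :: "'b set" and kfield :: "'k::field itself" +
  fixes F :: "('v \<times> 'b, 'k) mpoly set" and bv :: "'v \<Rightarrow> 'b" and idx :: "'v \<times> 'b \<Rightarrow> nat" and n :: nat
  assumes F_hom: "f \<in> F \<Longrightarrow> \<exists>d. f \<in> hom d"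
    and bv: "v \<in> V \<Longrightarrow> bv v \<in> B"
    and idx: "bij_betw idx {(v, b). v \<in> V \<and> b \<in> B \<and> b \<noteq> bv v} {..<n}"
begin

abbreviation N where "N \<equiv> {(v, b). v \<in> V \<and> b \<in> B \<and> b \<noteq> bv v}"

abbreviation S :: "(nat, 'k) mpoly set" where "S \<equiv> carrier (mpoly_ring {..<n})"

definition chart_value :: "'v \<times> 'b \<Rightarrow> (nat, 'k) mpoly" where
  "chart_value x = (if x \<in> N then mvar (idx x) else 1)"

definition dehom :: "('v \<times> 'b, 'k) mpoly \<Rightarrow> (nat, 'k) mpoly" where
  "dehom = peval mconst chart_value"

text \<open>Monomials in the coordinates that are invertible on the chart. They are used to adjust degrees.\<close>

definition mon :: "('v \<Rightarrow> nat) \<Rightarrow> ('v \<times> 'b, 'k) mpoly" where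
  "mon d = (\<Prod>v\<in>V. mvar (v, bv v) ^ d v)"

sublocale dehom: comm_ring_hom dehom
  unfolding dehom_def by (rule comm_ring_hom_peval[OF comm_ring_hom_mconst])

lemma finite_N: "finite N"
  using finite_V finite_B by (auto intro: finite_subset[of _ "V \<times> B"])

lemma idx_less: "x \<in> N \<Longrightarrow> idx x < n"
  using idx by (auto simp: bij_betw_def)

lemma idx_inj: "inj_on idx N" using idx by (simp add: bij_betw_def)

lemma dehom_mconst: "dehom (mconst c) = mconst c"
  by (simp add: dehom_def)

lemma dehom_mvar: "dehom (mvar x) = chart_value x"
  by (simp add: dehom_def)

lemma chart_value_closed: "chart_value x \<in> S"
  using idx_less by (auto simp: chart_value_def intro: mpoly_closed)

lemma dehom_closed: "f \<in> R \<Longrightarrow> dehom f \<in> S"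
  unfolding dehom_def
  by (rule peval_closed[OF comm_ring_hom_mconst]) (auto intro: mpoly_closed chart_value_closed)

lemma dehom_mvar_bv: "dehom (mvar (v, bv v)) = 1"
  by (simp add: dehom_mvar chart_value_def)

lemma dehom_mon: "dehom (mon d) = 1"
  by (simp add: mon_def dehom.hom_prod dehom.hom_power dehom_mvar_bv)

lemma mvar_bv_closed: "v \<in> V \<Longrightarrow> mvar (v, bv v) \<in> R"
  by (rule mpoly_closed_mvar) (simp add: bv)

lemma mon_closed: "mon d \<in> R"
  unfolding mon_def by (intro mpoly_closed_prod mpoly_closed_power mvar_bv_closed)

lemma mon_hom: "mon d \<in> hom (\<lambda>v. if v \<in> V then d v else 0)"
proof -
  have "mon d \<in> hom (\<lambda>v. \<Sum>u\<in>V. d u * unit_degree u v)"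
    unfolding mon_def by (intro hom_prod finite_V hom_power mvar_hom bv)
  moreover have "(\<lambda>v. \<Sum>u\<in>V. d u * unit_degree u v) = (\<lambda>v. if v \<in> V then d v else 0)"
    using finite_V by (auto simp: unit_degree_def fun_eq_iff if_distrib[of "\<lambda>z. _ * z"] cong: if_cong)
  ultimately show ?thesis by simp
qed

lemma hom_support: "f \<in> hom d \<Longrightarrow> f \<noteq> 0 \<Longrightarrow> v \<notin> V \<Longrightarrow> d v = 0"
proof -
  assume f: "f \<in> hom d" "f \<noteq> 0" and v: "v \<notin> V"
  then obtain m where "m \<in> Poly_Mapping.keys f" by (metis keys_eq_empty equals0I)
  then show "d v = 0"
    using f v multidegree_outside[of m V B v] by (auto simp: homogeneous_part_def carrier_mpoly_ring)
qed

lemma hom_mult_mon: "f \<in> hom d \<Longrightarrow> f * mon d' \<in> hom (\<lambda>v. if v \<in> V then d v + d' v else 0)"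
proof (cases "f = 0")
  case False
  assume f: "f \<in> hom d"
  have "(\<lambda>v. d v + (if v \<in> V then d' v else 0)) = (\<lambda>v. if v \<in> V then d v + d' v else 0)"
    using hom_support[OF f False] by auto
  then show ?thesis using hom_mult[OF f mon_hom[of d']] by simp
qed (simp add: hom_0)

lemma hom_common_degree:
  assumes "f \<in> hom d" "g \<in> hom d'"
  obtains e where "f * mon d' \<in> hom e" "g * mon d \<in> hom e"
proof (rule that)
  show "f * mon d' \<in> hom (\<lambda>v. if v \<in> V then d v + d' v else 0)" by (rule hom_mult_mon[OF assms(1)])
  show "g * mon d \<in> hom (\<lambda>v. if v \<in> V then d v + d' v else 0)"
    using hom_mult_mon[OF assms(2), of d] by (simp only: add.commute)
qed

text \<open>Two homogeneous polynomials can be brought to the same degree by multiplication with monomials that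
  become \<open>1\<close> after dehomogenisation. Hence the dehomogenisations of homogeneous polynomials form a ring.\<close>

lemma dehom_surj:
  assumes "g \<in> S"
  shows "\<exists>d f. f \<in> hom d \<and> dehom f = g"
  using assms
proof (induction g rule: mpoly_induct)
  case (mconst c)
  show ?case using hom_mconst dehom_mconst by blast
next
  case (mvar j)
  then have "j \<in> idx ` N" using idx by (simp add: bij_betw_def)
  then obtain x where x: "x \<in> N" "idx x = j" by blast
  then have "mvar x \<in> hom (unit_degree (fst x))" by (cases x) (auto intro: mvar_hom)
  moreover have "dehom (mvar x) = mvar j" using x by (simp add: dehom_mvar chart_value_def)
  ultimately show ?case by blast
next
  case (add g g')
  then obtain d f d' f' where f: "f \<in> hom d" "dehom f = g" and f': "f' \<in> hom d'" "dehom f' = g'" by blast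
  obtain e where "f * mon d' \<in> hom e" "f' * mon d \<in> hom e" by (rule hom_common_degree[OF f(1) f'(1)])
  then have "f * mon d' + f' * mon d \<in> hom e" by (rule hom_add)
  moreover have "dehom (f * mon d' + f' * mon d) = g + g'"
    by (simp add: dehom.hom_add dehom.hom_mult dehom_mon f f')
  ultimately show ?case by blast
next
  case (mult g g')
  then obtain d f d' f' where f: "f \<in> hom d" "dehom f = g" and f': "f' \<in> hom d'" "dehom f' = g'" by blast
  have "dehom (f * f') = g * g'" by (simp add: dehom.hom_mult f f')
  then show ?case using hom_mult[OF f(1) f'(1)] by blast
qed

lemma dehom_surj2:
  assumes "g \<in> S" "g' \<in> S"
  obtains e f f' where "f \<in> hom e" "f' \<in> hom e" "dehom f = g" "dehom f' = g'"
proof -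
  obtain d f d' f' where f: "f \<in> hom d" "dehom f = g" and f': "f' \<in> hom d'" "dehom f' = g'"
    using dehom_surj assms by meson
  obtain e where "f * mon d' \<in> hom e" "f' * mon d \<in> hom e" by (rule hom_common_degree[OF f(1) f'(1)])
  then show thesis
    by (rule that) (simp_all add: dehom.hom_mult dehom_mon f f')
qed

text \<open>The effect of dehomogenisation on exponent vectors.\<close>

definition red :: "('v \<times> 'b \<Rightarrow>\<^sub>0 nat) \<Rightarrow> (nat \<Rightarrow>\<^sub>0 nat)" where
  "red m = (\<Sum>x\<in>N. Poly_Mapping.single (idx x) (Poly_Mapping.lookup m x))"

lemma red_add: "red (m + m') = red m + red m'"
  by (simp add: red_def lookup_add single_add sum.distrib)

lemma red_single: "red (Poly_Mapping.single x k) = (if x \<in> N then Poly_Mapping.single (idx x) k else 0)"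
proof -
  have "red (Poly_Mapping.single x k) = (\<Sum>y\<in>N. if x = y then Poly_Mapping.single (idx y) k else 0)"
    unfolding red_def by (rule sum.cong) (auto simp: lookup_single)
  then show ?thesis using finite_N by (simp add: sum.delta')
qed

lemma lookup_red: "x \<in> N \<Longrightarrow> Poly_Mapping.lookup (red m) (idx x) = Poly_Mapping.lookup m x"
proof -
  assume x: "x \<in> N"
  have "Poly_Mapping.lookup (red m) (idx x) = (\<Sum>y\<in>N. if y = x then Poly_Mapping.lookup m x else 0)"
    unfolding red_def lookup_sum
    by (rule sum.cong) (use x idx_inj in \<open>auto simp: lookup_single when_def dest: inj_onD\<close>)
  then show ?thesis using finite_N x by simp
qed

lemma monomial_value_chart: "monomial_value chart_value m = Poly_Mapping.single (red m) 1"
proof (induction m rule: poly_mapping_single_add_induct)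
  case zero
  then show ?case by (simp add: red_def)
next
  case (single x k)
  have "mvar j ^ k = (Poly_Mapping.single (Poly_Mapping.single j k) 1 :: (nat, 'k) mpoly)" for j
    by (induction k) (simp_all add: mvar_def mult_single single_add[symmetric])
  then show ?case by (simp add: chart_value_def red_single)
qed (simp add: monomial_value_add red_add mult_single)

lemma red_inj:
  assumes m: "Poly_Mapping.keys m \<subseteq> V \<times> B" "Poly_Mapping.keys m' \<subseteq> V \<times> B"
    and "multidegree B m = multidegree B m'" "red m = red m'"
  shows "m = m'"
proof (rule poly_mapping_eqI)
  fix x :: "'v \<times> 'b"
  obtain v b where x: "x = (v, b)" by (cases x)
  have N: "Poly_Mapping.lookup m y = Poly_Mapping.lookup m' y" if "y \<in> N" for y
    using lookup_red[OF that, of m] lookup_red[OF that, of m'] assms(4) by simp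
  show "Poly_Mapping.lookup m x = Poly_Mapping.lookup m' x"
  proof (cases "x \<in> V \<times> B")
    case True
    then have vb: "v \<in> V" "b \<in> B" using x by auto
    show ?thesis
    proof (cases "b = bv v")
      case True
      have "multidegree B m v = Poly_Mapping.lookup m (v, b) + (\<Sum>b'\<in>B - {b}. Poly_Mapping.lookup m (v, b'))" for m
        unfolding multidegree_def using finite_B vb by (intro sum.remove)
      moreover have "(\<Sum>b'\<in>B - {b}. Poly_Mapping.lookup m (v, b')) = (\<Sum>b'\<in>B - {b}. Poly_Mapping.lookup m' (v, b'))"
        by (rule sum.cong) (use N vb True in auto)
      ultimately show ?thesis using assms(3) x by (metis add_right_cancel)
    qed (use N vb x in auto)
  next
    case False
    then have "x \<notin> Poly_Mapping.keys m" "x \<notin> Poly_Mapping.keys m'" using m by auto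
    then show ?thesis by (simp add: in_keys_iff)
  qed
qed

text \<open>A monomial of known multidegree can be recovered from its dehomogenisation, so that no cancellation
  occurs.\<close>

lemma dehom_inj:
  assumes f: "f \<in> hom d" and "dehom f = 0"
  shows "f = 0"
proof (rule poly_mapping_eqI)
  fix m
  show "Poly_Mapping.lookup f m = Poly_Mapping.lookup 0 m"
  proof (cases "m \<in> Poly_Mapping.keys f")
    case m: True
    have "dehom f = (\<Sum>m\<in>Poly_Mapping.keys f. Poly_Mapping.single (red m) (Poly_Mapping.lookup f m))"
      by (simp add: dehom_def peval_def monomial_value_chart mconst_def mult_single)
    then have "0 = (\<Sum>m'\<in>Poly_Mapping.keys f. Poly_Mapping.lookup (Poly_Mapping.single (red m') (Poly_Mapping.lookup f m')) (red m))"
      using assms(2) by (simp flip: lookup_sum)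
    also have "\<dots> = (\<Sum>m'\<in>Poly_Mapping.keys f. if m' = m then Poly_Mapping.lookup f m else 0)"
    proof (rule sum.cong)
      fix m' assume m': "m' \<in> Poly_Mapping.keys f"
      have "m' = m" if "red m' = red m"
        by (rule red_inj[OF _ _ _ that])
          (use m m' f in \<open>auto simp: homogeneous_part_def carrier_mpoly_ring\<close>)
      then show "Poly_Mapping.lookup (Poly_Mapping.single (red m') (Poly_Mapping.lookup f m')) (red m) =
          (if m' = m then Poly_Mapping.lookup f m else 0)"
        by (auto simp: lookup_single when_def)
    qed simp
    finally show ?thesis using m by simp
  qed (simp add: in_keys_iff)
qed

text \<open>The replacement for division by the invertible coordinates: the two sides have the same degree.\<close>

lemma dehom_eq_imp:
  assumes "f \<in> hom d" "g \<in> hom d'" "dehom f = dehom g"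
  shows "f * mon d' = g * mon d"
proof -
  obtain e where "f * mon d' \<in> hom e" "g * mon d \<in> hom e" by (rule hom_common_degree[OF assms(1,2)])
  then have "f * mon d' - g * mon d \<in> hom e" by (rule hom_diff)
  moreover have "dehom (f * mon d' - g * mon d) = 0"
    using assms(3) by (simp add: dehom.hom_minus dehom.hom_mult dehom_mon)
  ultimately show ?thesis using dehom_inj by fastforce
qed

abbreviation J where "J \<equiv> genideal (mpoly_ring (V \<times> B)) F"

abbreviation J' where "J' \<equiv> genideal (mpoly_ring {..<n}) (dehom ` F)"

lemma F_carrier: "F \<subseteq> R"
  using F_hom hom_carrier by blast

lemma dehom_F_carrier: "dehom ` F \<subseteq> S"
  using F_carrier dehom_closed by blast

lemma J_ideal: "ideal J (mpoly_ring (V \<times> B))" by (rule mpoly_genideal(1)[OF F_carrier])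

lemma J'_ideal: "ideal J' (mpoly_ring {..<n})" by (rule mpoly_genideal(1)[OF dehom_F_carrier])

lemma dehom_preimage_ideal:
  assumes "ideal I (mpoly_ring {..<n})"
  shows "ideal {f \<in> R. dehom f \<in> I} (mpoly_ring (V \<times> B))"
  by (rule mpoly_idealI)
    (auto simp: dehom.hom_add dehom.hom_mult intro: mpoly_closed mpoly_ideal_closed(2,3)[OF assms]
      mpoly_ideal_closed(4)[OF assms _ dehom_closed])

lemma dehom_J: "f \<in> J \<Longrightarrow> dehom f \<in> J'"
  using mpoly_genideal(3)[OF F_carrier dehom_preimage_ideal[OF J'_ideal]]
    mpoly_genideal(2)[OF dehom_F_carrier] F_carrier by blast

lemma homogeneous_image_ideal:
  assumes I: "ideal I (mpoly_ring (V \<times> B))"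
  shows "ideal {dehom f | f d. f \<in> hom d \<and> f \<in> I} (mpoly_ring {..<n})" (is "ideal ?I _")
proof (rule mpoly_idealI)
  show "?I \<subseteq> S" using dehom_closed hom_carrier by blast
  show "0 \<in> ?I" using hom_0 mpoly_ideal_closed(2)[OF I] dehom.hom_zero by (metis (mono_tags, lifting) mem_Collect_eq)
next
  fix g g' assume "g \<in> ?I" "g' \<in> ?I"
  then obtain f d f' d' where f: "g = dehom f" "f \<in> hom d" "f \<in> I" and f': "g' = dehom f'" "f' \<in> hom d'" "f' \<in> I"
    by blast
  obtain e where e: "f * mon d' \<in> hom e" "f' * mon d \<in> hom e" by (rule hom_common_degree[OF f(2) f'(2)])
  have "f * mon d' + f' * mon d \<in> I"
    using f f' by (intro mpoly_ideal_closed(3,5)[OF I] mon_closed)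
  moreover have "g + g' = dehom (f * mon d' + f' * mon d)"
    by (simp add: dehom.hom_add dehom.hom_mult dehom_mon f f')
  ultimately show "g + g' \<in> ?I" using hom_add[OF e] by blast
next
  fix g h assume "g \<in> ?I" and h: "h \<in> S"
  then obtain f d where f: "g = dehom f" "f \<in> hom d" "f \<in> I" by blast
  obtain f' d' where f': "f' \<in> hom d'" "dehom f' = h" using dehom_surj[OF h] by blast
  have "f' * f \<in> I" by (rule mpoly_ideal_closed(4)[OF I f(3) hom_carrier[OF f'(1)]])
  moreover have "h * g = dehom (f' * f)" by (simp add: dehom.hom_mult f f')
  ultimately show "h * g \<in> ?I" using hom_mult[OF f'(1) f(2)] by blast
qed

text \<open>The dehomogenisations of homogeneous elements of \<open>J\<close> form an ideal, which therefore contains \<open>J'\<close>.\<close>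

lemma dehom_in_J'_imp:
  assumes f: "f \<in> hom d" and "dehom f \<in> J'"
  obtains e where "f * mon e \<in> J"
proof -
  have "dehom ` F \<subseteq> {dehom f | f d. f \<in> hom d \<and> f \<in> J}"
    using F_hom mpoly_genideal(2)[OF F_carrier] by blast
  then have "J' \<subseteq> {dehom f | f d. f \<in> hom d \<and> f \<in> J}"
    by (rule mpoly_genideal(3)[OF dehom_F_carrier homogeneous_image_ideal[OF J_ideal]])
  then obtain f' d' where f': "dehom f = dehom f'" "f' \<in> hom d'" "f' \<in> J" using assms(2) by blast
  have "f * mon d' = f' * mon d" by (rule dehom_eq_imp[OF f f'(2,1)])
  also have "\<dots> \<in> J" by (rule mpoly_ideal_closed(5)[OF J_ideal f'(3) mon_closed])
  finally show thesis by (rule that)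
qed

end


section \<open>The homeomorphism of a chart with an affine scheme\<close>

context chart
begin

sublocale X: graded_fractions "V \<times> B" "range hom" J "points F"
  by (rule multiprojective_graded_fractions[OF F_carrier])

sublocale Y: affine_fractions "{..<n}" "dehom ` F"
  by unfold_locales (rule dehom_F_carrier)

abbreviation Q where "Q \<equiv> {p. primeideal p (mpoly_ring {..<n}) \<and> J' \<subseteq> p}"

definition chart_points where
  "chart_points = {q \<in> points F. \<forall>v\<in>V. mvar (v, bv v) \<notin> q}"

definition chart_map :: "('v \<times> 'b, 'k) mpoly set \<Rightarrow> (nat, 'k) mpoly set" where
  "chart_map q = {dehom f | f d. f \<in> hom d \<and> f \<in> q}"

lemma chart_pointsD:
  assumes "q \<in> chart_points"
  shows "q \<in> points F" "primeideal q (mpoly_ring (V \<times> B))" "ideal q (mpoly_ring (V \<times> B))"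
    "homogeneous_ideal q" "J \<subseteq> q" "mon d \<notin> q"
proof -
  show q: "q \<in> points F" "primeideal q (mpoly_ring (V \<times> B))" "homogeneous_ideal q" "J \<subseteq> q"
    using assms by (auto simp: chart_points_def points_def)
  then show "ideal q (mpoly_ring (V \<times> B))" by (intro mpoly_prime_closed)
  show "mon d \<notin> q"
    unfolding mon_def
    by (intro mpoly_prime_prod[OF q(2)] mpoly_prime_power[OF q(2)] mpoly_closed_power mvar_bv_closed)
      (use assms in \<open>auto simp: chart_points_def\<close>)
qed

lemma mult_mon_in_iff:
  assumes "q \<in> chart_points" "f \<in> R"
  shows "f * mon d \<in> q \<longleftrightarrow> f \<in> q"
  using mpoly_prime_closed(3)[OF chart_pointsD(2)[OF assms(1)], of f "mon d"] mon_closed assms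
    mpoly_ideal_closed(5)[OF chart_pointsD(3)[OF assms(1)], of f "mon d"] chart_pointsD(6)[OF assms(1)] by blast

text \<open>Homogeneous polynomials with the same dehomogenisation differ by factors \<open>mon d\<close>, and these are not in \<open>q\<close>.
  The other properties of \<open>chart_map\<close> rest on this equivalence.\<close>

lemma dehom_in_chart_map_iff:
  assumes q: "q \<in> chart_points" and f: "f \<in> hom d"
  shows "dehom f \<in> chart_map q \<longleftrightarrow> f \<in> q"
proof
  assume "dehom f \<in> chart_map q"
  then obtain f' d' where f': "dehom f = dehom f'" "f' \<in> hom d'" "f' \<in> q" by (auto simp: chart_map_def)
  have "f * mon d' = f' * mon d" by (rule dehom_eq_imp[OF f f'(2,1)])
  then have "f * mon d' \<in> q" using f'(3) mult_mon_in_iff[OF q hom_carrier[OF f'(2)]] by simp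
  then show "f \<in> q" using mult_mon_in_iff[OF q hom_carrier[OF f]] by simp
qed (use f in \<open>auto simp: chart_map_def\<close>)

lemma chart_map_prime:
  assumes q: "q \<in> chart_points"
  shows "chart_map q \<in> Q"
proof -
  have ideal: "ideal (chart_map q) (mpoly_ring {..<n})"
    unfolding chart_map_def by (rule homogeneous_image_ideal[OF chart_pointsD(3)[OF q]])
  have "primeideal (chart_map q) (mpoly_ring {..<n})"
  proof (rule mpoly_primeI[OF ideal])
    show "1 \<notin> chart_map q"
      using dehom_in_chart_map_iff[OF q hom_1] mpoly_prime_closed(2)[OF chart_pointsD(2)[OF q]] by simp
    fix g g' assume gg: "g * g' \<in> chart_map q" and g: "g \<in> S" "g' \<in> S"
    obtain e f f' where f: "f \<in> hom e" "f' \<in> hom e" "dehom f = g" "dehom f' = g'"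
      by (rule dehom_surj2[OF g])
    have "dehom (f * f') \<in> chart_map q" using gg by (simp add: dehom.hom_mult f)
    then have "f * f' \<in> q" using dehom_in_chart_map_iff[OF q hom_mult[OF f(1,2)]] by simp
    then have "f \<in> q \<or> f' \<in> q"
      using mpoly_prime_closed(3)[OF chart_pointsD(2)[OF q]] hom_carrier f by blast
    then show "g \<in> chart_map q \<or> g' \<in> chart_map q"
      using dehom_in_chart_map_iff[OF q f(1)] dehom_in_chart_map_iff[OF q f(2)] f by auto
  qed
  moreover have "dehom ` F \<subseteq> chart_map q"
    using F_hom mpoly_genideal(2)[OF F_carrier] chart_pointsD(5)[OF q] unfolding chart_map_def by blast
  then have "J' \<subseteq> chart_map q" by (rule mpoly_genideal(3)[OF dehom_F_carrier ideal])
  ultimately show ?thesis by simp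
qed

lemma chart_map_inj: "inj_on chart_map chart_points"
proof (rule inj_onI)
  fix p q assume p: "p \<in> chart_points" and q: "q \<in> chart_points" and eq: "chart_map p = chart_map q"
  have "f \<in> p \<longleftrightarrow> f \<in> q" if "f \<in> hom d" for f d
    using dehom_in_chart_map_iff[OF p that] dehom_in_chart_map_iff[OF q that] eq by simp
  then have "p \<inter> (\<Union>\<delta>. hom \<delta>) = q \<inter> (\<Union>\<delta>. hom \<delta>)" by auto
  then show "p = q" using chart_pointsD(4)[OF p] chart_pointsD(4)[OF q] unfolding homogeneous_ideal_def by metis
qed

lemma chart_map_surj:
  assumes "q' \<in> Q"
  obtains q where "q \<in> chart_points" "chart_map q = q'"
proof -
  have prime: "primeideal q' (mpoly_ring {..<n})" and J': "J' \<subseteq> q'" using assms by auto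
  note ideal = mpoly_prime_closed(1)[OF prime]
  obtain p where p: "primeideal p (mpoly_ring (V \<times> B))" "homogeneous_ideal p"
    and p_iff: "\<And>f \<delta>. f \<in> hom \<delta> \<Longrightarrow> f \<in> p \<longleftrightarrow> peval mconst chart_value f \<in> q'"
  proof (rule homogeneous_prime_of_values[of "mconst :: 'k \<Rightarrow> (nat, 'k) mpoly" S chart_value q'])
    show "comm_ring_hom (mconst :: 'k \<Rightarrow> (nat, 'k) mpoly)" by (rule comm_ring_hom_mconst)
  qed (use mpoly_ideal_closed[OF ideal] mpoly_prime_closed[OF prime] chart_value_closed in \<open>auto intro: mpoly_closed\<close>)
  note p_iff = p_iff[folded dehom_def]
  have "F \<subseteq> p"
  proof
    fix f assume f: "f \<in> F"
    then obtain d where "f \<in> hom d" using F_hom by blast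
    moreover have "dehom f \<in> q'" using f J' mpoly_genideal(2)[OF dehom_F_carrier] by blast
    ultimately show "f \<in> p" using p_iff by blast
  qed
  then have Jp: "J \<subseteq> p" by (rule mpoly_genideal(3)[OF F_carrier mpoly_prime_closed(1)[OF p(1)]])
  have "mvar (v, bv v) \<notin> p" if "v \<in> V" for v
    using p_iff[OF mvar_hom[OF that bv[OF that]]] mpoly_prime_closed(2)[OF prime] by (simp add: dehom_mvar_bv)
  then have cp: "p \<in> chart_points"
    unfolding chart_points_def points_def using p Jp bv by blast
  have "chart_map p = q'"
  proof
    show "chart_map p \<subseteq> q'" using p_iff by (auto simp: chart_map_def)
    show "q' \<subseteq> chart_map p"
    proof
      fix g assume g: "g \<in> q'"
      then obtain f d where f: "f \<in> hom d" "dehom f = g"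
        using dehom_surj[of g] mpoly_ideal_closed(1)[OF ideal] by blast
      then have "f \<in> p" using p_iff g by blast
      then show "g \<in> chart_map p" using f by (auto simp: chart_map_def)
    qed
  qed
  then show thesis using cp that by blast
qed

lemma chart_map_image: "chart_map ` chart_points = Q"
proof
  show "chart_map ` chart_points \<subseteq> Q" using chart_map_prime by blast
  show "Q \<subseteq> chart_map ` chart_points"
  proof
    fix q' assume "q' \<in> Q"
    then obtain q where "q \<in> chart_points" "chart_map q = q'" by (rule chart_map_surj)
    then show "q' \<in> chart_map ` chart_points" by blast
  qed
qed

lemma openin_chart_preimage:
  assumes "openin Y.T W"
  shows "openin X.T {q \<in> chart_points. chart_map q \<in> W}"
  unfolding X.openin_T_iff
proof (intro conjI ballI)
  show "{q \<in> chart_points. chart_map q \<in> W} \<subseteq> points F" using chart_pointsD(1) by blast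
  fix q assume "q \<in> {q \<in> chart_points. chart_map q \<in> W}"
  then have q: "q \<in> chart_points" "chart_map q \<in> W" by auto
  then obtain g where g: "g \<in> S" "g \<notin> chart_map q" "{q' \<in> Q. g \<notin> q'} \<subseteq> W"
    using assms unfolding Y.openin_T_iff by meson
  obtain f d where f: "f \<in> hom d" "dehom f = g" using dehom_surj[OF g(1)] by blast
  have fq: "f \<notin> q" using dehom_in_chart_map_iff[OF q(1) f(1)] f(2) g(2) by simp
  \<comment> \<open>The factor \<open>mon (\<lambda>_. 1)\<close> confines the basic open set to the chart.\<close>
  let ?f = "f * mon (\<lambda>_. 1)"
  have "{q' \<in> points F. ?f \<notin> q'} \<subseteq> {q \<in> chart_points. chart_map q \<in> W}"
  proof safe
    fix q' assume q': "q' \<in> points F" "?f \<notin> q'"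
    have ideal: "ideal q' (mpoly_ring (V \<times> B))"
      using mpoly_prime_closed(1) q'(1) by (auto simp: points_def)
    have "mvar (v, bv v) \<notin> q'" if v: "v \<in> V" for v
    proof
      assume "mvar (v, bv v) \<in> q'"
      then have *: "mvar (v, bv v) * (\<Prod>u\<in>V - {v}. mvar (u, bv u)) \<in> q'"
        by (rule mpoly_ideal_closed(5)[OF ideal]) (auto intro!: mpoly_closed_prod mvar_bv_closed)
      have "mon (\<lambda>_. 1) = mvar (v, bv v) * (\<Prod>u\<in>V - {v}. mvar (u, bv u))"
        unfolding mon_def using finite_V v by (subst prod.remove[of V v]) auto
      then have "mon (\<lambda>_. 1) \<in> q'" using * by simp
      then show False using q'(2) mpoly_ideal_closed(4)[OF ideal _ hom_carrier[OF f(1)]] by blast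
    qed
    then show cp: "q' \<in> chart_points" using q'(1) by (auto simp: chart_points_def)
    have "f \<notin> q'" using q'(2) mult_mon_in_iff[OF cp hom_carrier[OF f(1)]] by blast
    then have "g \<notin> chart_map q'" using dehom_in_chart_map_iff[OF cp f(1)] f(2) by simp
    then show "chart_map q' \<in> W" using g(3) chart_map_prime[OF cp] by blast
  qed
  moreover have "?f \<notin> q" using fq mult_mon_in_iff[OF q(1) hom_carrier[OF f(1)]] by blast
  moreover have "?f \<in> R" using hom_carrier[OF f(1)] mon_closed by (rule mpoly_closed_mult)
  ultimately show "\<exists>f\<in>R. f \<notin> q \<and> {q' \<in> points F. f \<notin> q'} \<subseteq> {q \<in> chart_points. chart_map q \<in> W}" by blast
qed

lemma openin_chart_points: "openin X.T chart_points"
proof -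
  have "{q \<in> chart_points. chart_map q \<in> Q} = chart_points" using chart_map_prime by blast
  then show ?thesis using openin_chart_preimage[OF openin_topspace[of Y.T]] by (simp add: Y.topspace_T)
qed

text \<open>Basic open sets are defined by arbitrary polynomials, but on the spectrum of homogeneous ideals a
  polynomial may be replaced by a component that does not vanish at the given point.\<close>

lemma openin_chart_image:
  assumes "openin X.T W" "W \<subseteq> chart_points"
  shows "openin Y.T (chart_map ` W)"
  unfolding Y.openin_T_iff
proof (intro conjI ballI)
  show "chart_map ` W \<subseteq> Q" using chart_map_image assms(2) by blast
  fix q' assume "q' \<in> chart_map ` W"
  then obtain q where q: "q \<in> W" "q' = chart_map q" by blast
  then have cp: "q \<in> chart_points" using assms by blast
  obtain f where f: "f \<in> R" "f \<notin> q" "{q \<in> points F. f \<notin> q} \<subseteq> W"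
    using assms(1) q(1) unfolding X.openin_T_iff by meson
  have "\<exists>\<delta>. component B \<delta> f \<notin> q"
  proof (rule ccontr)
    assume "\<not> ?thesis"
    then have "(\<Sum>\<delta>\<in>multidegree B ` Poly_Mapping.keys f. component B \<delta> f) \<in> q"
      by (intro mpoly_ideal_sum[OF chart_pointsD(3)[OF cp]]) blast
    then show False using f(2) by (simp flip: sum_components)
  qed
  then obtain \<delta> where \<delta>: "component B \<delta> f \<notin> q" by blast
  let ?f = "component B \<delta> f"
  have fh: "?f \<in> hom \<delta>" by (rule component_hom[OF f(1)])
  have "{p \<in> Q. dehom ?f \<notin> p} \<subseteq> chart_map ` W"
  proof safe
    fix p assume p: "primeideal p (mpoly_ring {..<n})" "J' \<subseteq> p" "dehom ?f \<notin> p"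
    then have "p \<in> Q" by blast
    then obtain q1 where q1: "q1 \<in> chart_points" "chart_map q1 = p" by (rule chart_map_surj)
    then have "?f \<notin> q1" using dehom_in_chart_map_iff[OF q1(1) fh] p(3) by simp
    then have "f \<notin> q1" using homogeneous_ideal_component[OF chart_pointsD(3,4)[OF q1(1)]] by blast
    then have "q1 \<in> W" using f(3) chart_pointsD(1)[OF q1(1)] by blast
    then show "p \<in> chart_map ` W" using q1(2) by blast
  qed
  moreover have "dehom ?f \<notin> q'" using dehom_in_chart_map_iff[OF cp fh] \<delta> q(2) by simp
  moreover have "dehom ?f \<in> S" by (rule dehom_closed[OF hom_carrier[OF fh]])
  ultimately show "\<exists>f\<in>S. f \<notin> q' \<and> {q' \<in> Q. f \<notin> q'} \<subseteq> chart_map ` W" by blast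
qed

lemma chart_homeomorphism: "homeomorphic_map (subtopology X.T chart_points) Y.T chart_map"
proof (rule bijective_open_imp_homeomorphic_map)
  have top: "topspace (subtopology X.T chart_points) = chart_points"
    using openin_subset[OF openin_chart_points] by auto
  show "continuous_map (subtopology X.T chart_points) Y.T chart_map"
    unfolding continuous_map_def top Y.topspace_T
    using chart_map_prime openin_chart_preimage
    by (auto simp: openin_open_subtopology[OF openin_chart_points])
  show "open_map (subtopology X.T chart_points) Y.T chart_map"
    using openin_chart_image by (auto simp: open_map_def openin_open_subtopology[OF openin_chart_points])
  show "chart_map ` topspace (subtopology X.T chart_points) = topspace Y.T"
    unfolding top Y.topspace_T by (rule chart_map_image)
  show "inj_on chart_map (topspace (subtopology X.T chart_points))"
    unfolding top by (rule chart_map_inj)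
qed

end

section \<open>The isomorphism of structure sheaves\<close>

context chart
begin

text \<open>The map of stalks at \<open>q\<close> that is induced by the chart, as a preimage of classes. It involves no choice
  of representatives.\<close>

definition pull where
  "pull q c = {(a, b). X.valid q a b \<and> (dehom a, dehom b) \<in> c}"

lemma valid_dehom_iff:
  assumes q: "q \<in> chart_points" and ab: "a \<in> hom d" "b \<in> hom d"
  shows "Y.valid (chart_map q) (dehom a) (dehom b) \<longleftrightarrow> X.valid q a b"
  using dehom_in_chart_map_iff[OF q ab(2)] ab dehom_closed hom_carrier by (auto simp: Y.valid_iff X.valid_def)

lemma valid_dehom: "q \<in> chart_points \<Longrightarrow> X.valid q a b \<Longrightarrow> Y.valid (chart_map q) (dehom a) (dehom b)"
  using valid_dehom_iff by (auto simp: X.valid_def)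

text \<open>A homogeneous witness \<open>t\<close> that two fractions are equal becomes the witness \<open>dehom t\<close>. Conversely, a witness
  on the affine side is lifted to a homogeneous polynomial, which is a witness after multiplication by
  a suitable monomial \<open>mon e'\<close>.\<close>

lemma mem_frac_dehom:
  assumes q: "q \<in> chart_points" and ab: "X.valid q a b" and cd: "X.valid q c d"
  shows "(dehom c, dehom d) \<in> Y.frac (chart_map q) (dehom a) (dehom b) \<longleftrightarrow> (c, d) \<in> X.frac q a b"
proof
  assume "(dehom c, dehom d) \<in> Y.frac (chart_map q) (dehom a) (dehom b)"
  then obtain t' where t': "t' \<in> S" "t' \<notin> chart_map q" "t' * (dehom a * dehom d - dehom c * dehom b) \<in> J'"
    by (auto simp: Y.mem_frac)
  obtain t e where t: "t \<in> hom e" "dehom t = t'" using dehom_surj[OF t'(1)] by blast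
  have tq: "t \<notin> q" using dehom_in_chart_map_iff[OF q t(1)] t(2) t'(2) by simp
  obtain d1 d2 where h: "a \<in> hom d1" "b \<in> hom d1" "c \<in> hom d2" "d \<in> hom d2" using ab cd by (auto simp: X.valid_def)
  have "a * d - c * b \<in> hom (\<lambda>v. d1 v + d2 v)"
    using hom_mult[OF h(1,4)] hom_mult[OF h(2,3)] by (intro hom_diff) (simp_all add: mult.commute)
  then have "t * (a * d - c * b) \<in> hom (\<lambda>v. e v + (d1 v + d2 v))" by (rule hom_mult[OF t(1)])
  moreover have "dehom (t * (a * d - c * b)) \<in> J'"
    using t'(3) by (simp add: dehom.hom_mult dehom.hom_minus t(2))
  ultimately obtain e' where e': "t * (a * d - c * b) * mon e' \<in> J" by (rule dehom_in_J'_imp)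
  have "t * mon e' \<in> \<Union> (range hom)" using hom_mult_mon[OF t(1)] by blast
  moreover have "t * mon e' \<notin> q" using tq mult_mon_in_iff[OF q hom_carrier[OF t(1)]] by blast
  moreover have "(t * mon e') * (a * d - c * b) \<in> J" using e' by (simp add: ac_simps)
  ultimately show "(c, d) \<in> X.frac q a b" using cd by (auto simp: X.mem_frac)
next
  assume "(c, d) \<in> X.frac q a b"
  then obtain t e where t: "t \<in> hom e" "t \<notin> q" "t * (a * d - c * b) \<in> J" by (auto simp: X.mem_frac)
  have "dehom t \<in> S" "dehom t \<notin> chart_map q"
    using dehom_closed[OF hom_carrier[OF t(1)]] dehom_in_chart_map_iff[OF q t(1)] t(2) by auto
  moreover have "dehom t * (dehom a * dehom d - dehom c * dehom b) \<in> J'"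
    using dehom_J[OF t(3)] by (simp add: dehom.hom_mult dehom.hom_minus)
  ultimately show "(dehom c, dehom d) \<in> Y.frac (chart_map q) (dehom a) (dehom b)"
    using valid_dehom[OF q cd] by (auto simp: Y.mem_frac)
qed

lemma pull_frac:
  assumes "q \<in> chart_points" "X.valid q a b"
  shows "pull q (Y.frac (chart_map q) (dehom a) (dehom b)) = X.frac q a b"
  using mem_frac_dehom[OF assms] by (auto simp: pull_def X.mem_frac)

lemma frac_eq_if_dehom:
  assumes q: "q \<in> chart_points" and ab: "X.valid q a b" and cd: "X.valid q c d"
  shows "X.frac q a b = X.frac q c d \<longleftrightarrow>
    Y.frac (chart_map q) (dehom a) (dehom b) = Y.frac (chart_map q) (dehom c) (dehom d)"
proof
  assume "X.frac q a b = X.frac q c d"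
  then have "(c, d) \<in> X.frac q a b" using X.frac_self[OF chart_pointsD(1)[OF q] cd] by simp
  then have "(dehom c, dehom d) \<in> Y.frac (chart_map q) (dehom a) (dehom b)" using mem_frac_dehom[OF assms] by simp
  then show "Y.frac (chart_map q) (dehom a) (dehom b) = Y.frac (chart_map q) (dehom c) (dehom d)"
    by (rule Y.frac_eqI[OF chart_map_prime[OF q] valid_dehom[OF q ab]])
next
  assume "Y.frac (chart_map q) (dehom a) (dehom b) = Y.frac (chart_map q) (dehom c) (dehom d)"
  then show "X.frac q a b = X.frac q c d" using pull_frac[OF q ab] pull_frac[OF q cd] by simp
qed

lemma lift_fraction:
  assumes "a' \<in> S" "b' \<in> S"
  obtains d a b where "a \<in> hom d" "b \<in> hom d" "a' = dehom a" "b' = dehom b"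
  using dehom_surj2[OF assms] by metis

end


context chart
begin

definition preimage where "preimage W = {q \<in> chart_points. chart_map q \<in> W}"

definition pull_section where
  "pull_section W s = (\<lambda>q\<in>preimage W. pull q (s (chart_map q)))"

lemma preimageD: "q \<in> preimage W \<Longrightarrow> q \<in> chart_points" "q \<in> preimage W \<Longrightarrow> chart_map q \<in> W"
  by (auto simp: preimage_def)

lemma section_at_preimage:
  assumes "s \<in> Y.sections W" "q \<in> preimage W"
  obtains a b where "X.valid q a b" "s (chart_map q) = Y.frac (chart_map q) (dehom a) (dehom b)"
    "pull_section W s q = X.frac q a b"
proof -
  note q = preimageD[OF assms(2)]
  obtain a' b' where ab': "Y.valid (chart_map q) a' b'" "s (chart_map q) = Y.frac (chart_map q) a' b'"
    by (rule Y.section_at[OF assms(1) q(2)])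
  then have "a' \<in> S" "b' \<in> S" by (auto simp: Y.valid_iff)
  then obtain d a b where ab: "a \<in> hom d" "b \<in> hom d" "a' = dehom a" "b' = dehom b" by (rule lift_fraction)
  have v: "X.valid q a b" using valid_dehom_iff[OF q(1) ab(1,2)] ab'(1) ab(3,4) by simp
  show thesis
    by (rule that[OF v]) (use ab' ab assms(2) pull_frac[OF q(1) v] in \<open>auto simp: pull_section_def\<close>)
qed

lemma pull_section_closed:
  assumes W: "openin Y.T W" and s: "s \<in> Y.sections W"
  shows "pull_section W s \<in> X.sections (preimage W)"
proof (rule X.sectionI)
  show "pull_section W s \<in> extensional (preimage W)" by (simp add: pull_section_def)
  fix q assume "q \<in> preimage W"
  note q = preimageD[OF this]
  obtain W' h a' b' where W': "openin Y.T W'" "chart_map q \<in> W'" "W' \<subseteq> W" and h: "h \<in> {S}" "a' \<in> h" "b' \<in> h"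
    and ab': "\<And>p. p \<in> W' \<Longrightarrow> b' \<notin> p" "\<And>p. p \<in> W' \<Longrightarrow> s p = Y.frac p a' b'"
    by (rule Y.section_local[OF s q(2)]) (rule that)
  have "a' \<in> S" "b' \<in> S" using h by auto
  then obtain d a b where ab: "a \<in> hom d" "b \<in> hom d" "a' = dehom a" "b' = dehom b" by (rule lift_fraction)
  have "b \<notin> p \<and> pull_section W s p = X.frac p a b" if p: "p \<in> preimage W'" for p
  proof
    note p' = preimageD[OF p]
    show b: "b \<notin> p" using dehom_in_chart_map_iff[OF p'(1) ab(2)] ab'(1)[OF p'(2)] ab(4) by simp
    have v: "X.valid p a b" by (rule X.validI[of "hom d"]) (use ab b in auto)
    have "p \<in> preimage W" using p W'(3) by (auto simp: preimage_def)
    then show "pull_section W s p = X.frac p a b"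
      using pull_frac[OF p'(1) v] ab'(2)[OF p'(2)] ab(3,4) by (simp add: pull_section_def)
  qed
  moreover have "openin X.T (preimage W')" unfolding preimage_def by (rule openin_chart_preimage[OF W'(1)])
  moreover have "q \<in> preimage W'" "preimage W' \<subseteq> preimage W" using q W' by (auto simp: preimage_def)
  ultimately show "\<exists>W' h a b. openin X.T W' \<and> q \<in> W' \<and> W' \<subseteq> preimage W \<and> h \<in> range hom \<and> a \<in> h \<and> b \<in> h \<and>
      (\<forall>p\<in>W'. b \<notin> p \<and> pull_section W s p = X.frac p a b)"
    using ab(1,2)
    by - (rule exI[where x = "preimage W'"], rule exI[where x = "hom d"], rule exI[where x = a],
        rule exI[where x = b], simp)
qed

lemma image_preimage: "openin Y.T W \<Longrightarrow> chart_map ` preimage W = W"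
proof -
  assume "openin Y.T W"
  then have "W \<subseteq> chart_map ` chart_points" unfolding chart_map_image Y.openin_T_iff by (rule conjunct1)
  then show ?thesis unfolding preimage_def by blast
qed

lemma pull_section_inj:
  assumes W: "openin Y.T W" and s: "s \<in> Y.sections W" and t: "t \<in> Y.sections W"
    and eq: "pull_section W s = pull_section W t"
  shows "s = t"
proof (rule extensionalityI)
  show "s \<in> extensional W" "t \<in> extensional W" using s t by (auto intro: Y.section_extensional)
  fix p assume "p \<in> W"
  then obtain q where q: "q \<in> preimage W" "p = chart_map q" using image_preimage[OF W] by blast
  obtain a b where ab: "X.valid q a b" "s (chart_map q) = Y.frac (chart_map q) (dehom a) (dehom b)"
    "pull_section W s q = X.frac q a b" by (rule section_at_preimage[OF s q(1)])
  obtain c d where cd: "X.valid q c d" "t (chart_map q) = Y.frac (chart_map q) (dehom c) (dehom d)"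
    "pull_section W t q = X.frac q c d" by (rule section_at_preimage[OF t q(1)])
  show "s p = t p"
    using frac_eq_if_dehom[OF preimageD(1)[OF q(1)] ab(1) cd(1)] ab cd eq q(2) by simp
qed

text \<open>The preimage is defined pointwise from arbitrary numerators and denominators. That it is a section
  depends on the class of the dehomogenised fraction only, and near each point these classes are given by
  a single fraction.\<close>

lemma pull_section_surj:
  assumes W: "openin Y.T W" and t: "t \<in> X.sections (preimage W)"
  obtains s where "s \<in> Y.sections W" "pull_section W s = t"
proof -
  have "\<exists>a b. X.valid q a b \<and> t q = X.frac q a b" if "q \<in> preimage W" for q
    using X.section_at[OF t that] by blast
  then obtain num den where nd: "\<And>q. q \<in> preimage W \<Longrightarrow> X.valid q (num q) (den q) \<and> t q = X.frac q (num q) (den q)"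
    by metis
  define pre where "pre p = inv_into (preimage W) chart_map p" for p
  define s where "s = (\<lambda>p\<in>W. Y.frac p (dehom (num (pre p))) (dehom (den (pre p))))"
  have inj: "inj_on chart_map (preimage W)"
    using chart_map_inj by (rule inj_on_subset) (auto simp: preimage_def)
  have pre: "pre (chart_map q) = q" if "q \<in> preimage W" for q
    unfolding pre_def by (rule inv_into_f_f[OF inj that])
  have s_at: "s (chart_map q) = Y.frac (chart_map q) (dehom a) (dehom b)"
    if q: "q \<in> preimage W" and ab: "X.valid q a b" "t q = X.frac q a b" for q a b
    using frac_eq_if_dehom[OF preimageD(1)[OF q] ab(1), of "num q" "den q"] nd[OF q] ab(2) pre[OF q] preimageD(2)[OF q]
    by (simp add: s_def)
  have s: "s \<in> Y.sections W"
  proof (rule Y.sectionI)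
    show "s \<in> extensional W" by (simp add: s_def)
    fix p assume "p \<in> W"
    then obtain q where q: "q \<in> preimage W" "p = chart_map q" using image_preimage[OF W] by blast
    obtain W' h a b where W': "openin X.T W'" "q \<in> W'" "W' \<subseteq> preimage W" and h: "h \<in> range hom" "a \<in> h" "b \<in> h"
      and ab: "\<And>p. p \<in> W' \<Longrightarrow> b \<notin> p" "\<And>p. p \<in> W' \<Longrightarrow> t p = X.frac p a b"
      by (rule X.section_local[OF t q(1)]) (rule that)
    obtain d where d: "a \<in> hom d" "b \<in> hom d" using h by blast
    have cp: "W' \<subseteq> chart_points" using W'(3) by (auto simp: preimage_def)
    have "dehom b \<notin> p' \<and> s p' = Y.frac p' (dehom a) (dehom b)" if p': "p' \<in> chart_map ` W'" for p'
    proof -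
      obtain q' where q': "q' \<in> W'" "p' = chart_map q'" using p' by blast
      then have q'W: "q' \<in> preimage W" using W'(3) by blast
      have v: "X.valid q' a b" by (rule X.validI[OF h]) (rule ab(1)[OF q'(1)])
      show ?thesis
        using s_at[OF q'W v ab(2)[OF q'(1)]] dehom_in_chart_map_iff[OF preimageD(1)[OF q'W] d(2)] ab(1)[OF q'(1)] q'(2)
        by simp
    qed
    moreover have "openin Y.T (chart_map ` W')" by (rule openin_chart_image[OF W'(1) cp])
    moreover have "p \<in> chart_map ` W'" "chart_map ` W' \<subseteq> W"
      using q W' preimageD(2) by auto
    moreover have "dehom a \<in> S" "dehom b \<in> S" using dehom_closed hom_carrier d by auto
    ultimately show "\<exists>W' h a b. openin Y.T W' \<and> p \<in> W' \<and> W' \<subseteq> W \<and> h \<in> {S} \<and> a \<in> h \<and> b \<in> h \<and>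
        (\<forall>q\<in>W'. b \<notin> q \<and> s q = Y.frac q a b)"
      by - (rule exI[where x = "chart_map ` W'"], rule exI[where x = S], rule exI[where x = "dehom a"],
          rule exI[where x = "dehom b"], simp)
  qed
  have "pull_section W s = t"
  proof (rule extensionalityI)
    show "pull_section W s \<in> extensional (preimage W)" by (simp add: pull_section_def)
    show "t \<in> extensional (preimage W)" by (rule X.section_extensional[OF t])
    fix q assume q: "q \<in> preimage W"
    then show "pull_section W s q = t q"
      using nd[OF q] s_at[OF q, of "num q" "den q"] pull_frac[OF preimageD(1)[OF q], of "num q" "den q"]
      by (simp add: pull_section_def)
  qed
  then show thesis using s that by blast
qed

lemma pull_section_const:
  assumes "openin Y.T W"
  shows "pull_section W (Y.frac_section W (mconst c) 1) = X.frac_section (preimage W) (mconst c) 1"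
  unfolding pull_section_def X.frac_section_def
proof (rule restrict_ext)
  fix q assume q: "q \<in> preimage W"
  have v: "X.valid q (mconst c) 1" by (rule X.valid_const[OF chart_pointsD(1)[OF preimageD(1)[OF q]]])
  show "pull q (Y.frac_section W (mconst c) 1 (chart_map q)) = X.frac q (mconst c) 1"
    using pull_frac[OF preimageD(1)[OF q] v] by (simp add: Y.frac_section_apply[OF preimageD(2)[OF q]] dehom_mconst)
qed

lemma pull_section_ring_iso:
  assumes W: "openin Y.T W"
  shows "pull_section W \<in> ring_iso (Sec Y.space W) (Sec X.space (preimage W))"
proof -
  have PX: "q \<in> points F" if "q \<in> preimage W" for q using chart_pointsD(1) preimageD(1)[OF that] by blast
  have PY: "chart_map q \<in> Q" if "q \<in> preimage W" for q using chart_map_prime preimageD(1)[OF that] by blast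
  have mult: "pull_section W (s \<otimes>\<^bsub>Sec Y.space W\<^esub> t) = pull_section W s \<otimes>\<^bsub>Sec X.space (preimage W)\<^esub> pull_section W t"
    and add: "pull_section W (s \<oplus>\<^bsub>Sec Y.space W\<^esub> t) = pull_section W s \<oplus>\<^bsub>Sec X.space (preimage W)\<^esub> pull_section W t"
    if s: "s \<in> Y.sections W" and t: "t \<in> Y.sections W" for s t
  proof -
    have "pull q ((s \<otimes>\<^bsub>Sec Y.space W\<^esub> t) (chart_map q)) = fraction_mult (range hom) J q (pull_section W s q) (pull_section W t q) \<and>
        pull q ((s \<oplus>\<^bsub>Sec Y.space W\<^esub> t) (chart_map q)) = fraction_add (range hom) J q (pull_section W s q) (pull_section W t q)"
      if q: "q \<in> preimage W" for q
    proof -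
      note cp = preimageD(1)[OF q]
      obtain a b where ab: "X.valid q a b" "s (chart_map q) = Y.frac (chart_map q) (dehom a) (dehom b)"
        "pull_section W s q = X.frac q a b" by (rule section_at_preimage[OF s q])
      obtain c d where cd: "X.valid q c d" "t (chart_map q) = Y.frac (chart_map q) (dehom c) (dehom d)"
        "pull_section W t q = X.frac q c d" by (rule section_at_preimage[OF t q])
      note v = valid_dehom[OF cp ab(1)] valid_dehom[OF cp cd(1)]
      have "(s \<otimes>\<^bsub>Sec Y.space W\<^esub> t) (chart_map q) = Y.frac (chart_map q) (dehom (a * c)) (dehom (b * d))"
        using preimageD(2)[OF q] Y.frac_mult[OF PY[OF q] v] by (simp add: ab cd dehom.hom_mult)
      moreover have "(s \<oplus>\<^bsub>Sec Y.space W\<^esub> t) (chart_map q) =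
          Y.frac (chart_map q) (dehom (a * d + c * b)) (dehom (b * d))"
        using preimageD(2)[OF q] Y.frac_add[OF PY[OF q] v] by (simp add: ab cd dehom.hom_mult dehom.hom_add)
      ultimately show ?thesis
        using pull_frac[OF cp X.valid_mult[OF PX[OF q] ab(1) cd(1)]] pull_frac[OF cp X.valid_add[OF PX[OF q] ab(1) cd(1)]]
          X.frac_mult[OF PX[OF q] ab(1) cd(1)] X.frac_add[OF PX[OF q] ab(1) cd(1)] ab(3) cd(3) by simp
    qed
    then show "pull_section W (s \<otimes>\<^bsub>Sec Y.space W\<^esub> t) = pull_section W s \<otimes>\<^bsub>Sec X.space (preimage W)\<^esub> pull_section W t"
      "pull_section W (s \<oplus>\<^bsub>Sec Y.space W\<^esub> t) = pull_section W s \<oplus>\<^bsub>Sec X.space (preimage W)\<^esub> pull_section W t"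
      unfolding pull_section_def[of W "s \<otimes>\<^bsub>Sec Y.space W\<^esub> t"] pull_section_def[of W "s \<oplus>\<^bsub>Sec Y.space W\<^esub> t"] X.space_simps(3,4)
      by (auto intro!: restrict_ext)
  qed
  have one: "pull_section W (\<one>\<^bsub>Sec Y.space W\<^esub>) = \<one>\<^bsub>Sec X.space (preimage W)\<^esub>"
    using pull_section_const[of W 1] W by simp
  have bij: "bij_betw (pull_section W) (Y.sections W) (X.sections (preimage W))"
    unfolding bij_betw_def
  proof
    show "inj_on (pull_section W) (Y.sections W)" by (intro inj_onI pull_section_inj[OF W])
    show "pull_section W ` Y.sections W = X.sections (preimage W)"
    proof
      show "pull_section W ` Y.sections W \<subseteq> X.sections (preimage W)" using pull_section_closed[OF W] by blast
      show "X.sections (preimage W) \<subseteq> pull_section W ` Y.sections W"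
      proof
        fix t assume "t \<in> X.sections (preimage W)"
        then obtain s where "s \<in> Y.sections W" "pull_section W s = t" by (rule pull_section_surj[OF W])
        then show "t \<in> pull_section W ` Y.sections W" by blast
      qed
    qed
  qed
  show ?thesis
    unfolding ring_iso_def Ring.ring_hom_def
    using pull_section_closed[OF W] mult add one bij by (simp del: X.space_simps(3-) Y.space_simps(3-))
qed

theorem chart_isomorphism:
  assumes Y': "openin Y.T Y'"
  shows "openin X.T (preimage Y')"
    "isomorphic_spaces (open_subspace X.space (preimage Y')) (open_subspace Y.space Y')"
proof -
  show pre: "openin X.T (preimage Y')" unfolding preimage_def by (rule openin_chart_preimage[OF Y'])
  have top: "topspace (subtopology X.T (preimage Y')) = preimage Y'"
    using openin_subset[OF pre] by auto
  have pre_V: "{x \<in> preimage Y'. chart_map x \<in> V} = preimage V" if "V \<subseteq> Y'" for V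
    using that by (auto simp: preimage_def)
  have "homeomorphic_map (subtopology (subtopology X.T chart_points) (preimage Y')) (subtopology Y.T Y') chart_map"
    by (rule homeomorphic_map_subtopologies_alt[OF chart_homeomorphism])
      (use openin_subset[OF openin_chart_points] in \<open>auto simp: preimage_def\<close>)
  moreover have "subtopology (subtopology X.T chart_points) (preimage Y') = subtopology X.T (preimage Y')"
    by (simp add: subtopology_subtopology Int_absorb1 preimage_def Collect_subset)
  ultimately have homeo: "homeomorphic_map (subtopology X.T (preimage Y')) (subtopology Y.T Y') chart_map" by simp
  show "isomorphic_spaces (open_subspace X.space (preimage Y')) (open_subspace Y.space Y')"
    unfolding isomorphic_spaces_def
  proof (intro exI[of _ chart_map] exI[of _ pull_section] conjI allI impI)
    show "homeomorphic_map (Top (open_subspace X.space (preimage Y'))) (Top (open_subspace Y.space Y')) chart_map"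
      using homeo by simp
    fix V assume "openin (Top (open_subspace Y.space Y')) V"
    then have V: "openin Y.T V" "V \<subseteq> Y'" using Y' by (auto simp: openin_open_subtopology)
    have eq: "{x \<in> topspace (Top (open_subspace X.space (preimage Y'))). chart_map x \<in> V'} = preimage V'"
      if "V' \<subseteq> Y'" for V' using pre_V[OF that] top by simp
    show "pull_section V \<in> ring_iso (Sec (open_subspace Y.space Y') V)
        (Sec (open_subspace X.space (preimage Y')) {x \<in> topspace (Top (open_subspace X.space (preimage Y'))). chart_map x \<in> V})"
      unfolding eq[OF V(2)] open_subspace_simps(1-3) by (rule pull_section_ring_iso[OF V(1)])
    show "pull_section V (Sca (open_subspace Y.space Y') V c) =
        Sca (open_subspace X.space (preimage Y')) {x \<in> topspace (Top (open_subspace X.space (preimage Y'))). chart_map x \<in> V} c" for c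
      unfolding eq[OF V(2)] open_subspace_simps(1-3) using pull_section_const[of V c] V(1) by simp
    fix V' s
    assume "openin (Top (open_subspace Y.space Y')) V' \<and> V' \<subseteq> V \<and> s \<in> carrier (Sec (open_subspace Y.space Y') V)"
    then have V': "V' \<subseteq> V" by blast
    then have "V' \<subseteq> Y'" using V(2) by blast
    show "pull_section V' (Res (open_subspace Y.space Y') V V' s) =
        Res (open_subspace X.space (preimage Y'))
          {x \<in> topspace (Top (open_subspace X.space (preimage Y'))). chart_map x \<in> V}
          {x \<in> topspace (Top (open_subspace X.space (preimage Y'))). chart_map x \<in> V'} (pull_section V s)"
      unfolding eq[OF V(2)] eq[OF \<open>V' \<subseteq> Y'\<close>] open_subspace_simps(1-3)
      using V' by (auto simp: pull_section_def preimage_def restrict_def fun_eq_iff)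
  qed
qed

end


section \<open>Forests\<close>

text \<open>The first vertex of a longest path is a leaf: by maximality all of its neighbours are on the path, and
  a neighbour other than the second vertex would close a cycle.\<close>

lemma forest_leaf:
  assumes G: "simple_graph V E" and forest: "forest E" and "E \<noteq> {}"
  obtains v u where "{v, u} \<in> E" "v \<noteq> u" "\<And>w. {v, w} \<in> E \<Longrightarrow> w = u"
proof -
  have edge: "v \<in> V" "u \<in> V" "v \<noteq> u" if "{v, u} \<in> E" for v u
    using G that by (fastforce simp: simple_graph_def)+
  have finite_V: "finite V" using G by (simp add: simple_graph_def)
  define path where "path xs \<longleftrightarrow> 2 \<le> length xs \<and> distinct xs \<and> set xs \<subseteq> V \<and>
      (\<forall>i. Suc i < length xs \<longrightarrow> {xs ! i, xs ! Suc i} \<in> E)" for xs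
  obtain e where e: "e \<in> E" using assms(3) by blast
  then have "card e = 2" using G by (simp add: simple_graph_def)
  then obtain a b where ab: "e = {a, b}" "a \<noteq> b" by (auto simp: card_2_iff)
  have "path [a, b]" using e ab edge[of a b] by (auto simp: path_def less_Suc_eq)
  moreover have bound: "length xs \<le> card V" if "path xs" for xs
  proof -
    have "card (set xs) \<le> card V" by (rule card_mono[OF finite_V]) (use that in \<open>simp add: path_def\<close>)
    then show ?thesis using that by (simp add: path_def distinct_card)
  qed
  ultimately obtain xs where xs: "path xs" and max: "\<And>ys. path ys \<Longrightarrow> length ys \<le> length xs"
    using ex_has_greatest_nat[of path "[a, b]" length "Suc (card V)"] by (meson le_imp_less_Suc)
  obtain v u ys where vu: "xs = v # u # ys"
    using xs by (cases xs; cases "tl xs") (auto simp: path_def)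
  have vu_edge: "{v, u} \<in> E" using xs vu by (force simp: path_def)
  have "w = u" if w: "{v, w} \<in> E" for w
  proof -
    have wv: "w \<noteq> v" "w \<in> V" using edge[OF w] by auto
    have "w \<in> set xs"
    proof (rule ccontr)
      assume "w \<notin> set xs"
      moreover have "{(w # xs) ! i, (w # xs) ! Suc i} \<in> E" if "Suc i < length (w # xs)" for i
        using that w xs vu by (cases i) (auto simp: path_def insert_commute)
      ultimately have "path (w # xs)" using xs wv by (auto simp: path_def)
      then show False using max by fastforce
    qed
    then obtain j where j: "j < length xs" "xs ! j = w" by (auto simp: in_set_conv_nth)
    have "j \<noteq> 0" using j(2) wv(1) vu by (metis nth_Cons_0)
    moreover have "\<not> 2 \<le> j"
    proof
      assume j2: "2 \<le> j"
      let ?c = "take (Suc j) xs"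
      have len: "length ?c = Suc j" using j by simp
      have "{?c ! i, ?c ! (Suc i mod Suc j)} \<in> E" if i: "i < Suc j" for i
      proof (cases "i = j")
        case True
        moreover have "?c ! j = w" using j by simp
        moreover have "?c ! 0 = v" using vu by simp
        ultimately show ?thesis using w by (simp only: mod_self insert_commute)
      next
        case False
        then have "Suc i < length xs" "i < j" using i j by auto
        then show ?thesis using xs by (simp add: path_def)
      qed
      then have "is_cycle E ?c" using j2 xs unfolding is_cycle_def len by (simp add: path_def)
      then show False using forest by (auto simp: forest_def)
    qed
    ultimately have "j = 1" by linarith
    then show ?thesis using j vu by simp
  qed
  then show thesis using that vu_edge edge[OF vu_edge] by blast
qed

text \<open>Leaves are removed one after the other, and the edge of the leaf that is removed first comes last.
  Thus \<open>child j\<close> is in no edge with a smaller index; for this, \<open>child j \<noteq> par i\<close> suffices because \<open>child\<close> is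
  injective.\<close>

lemma forest_enumeration:
  assumes "simple_graph V E" "forest E"
  shows "\<exists>c child par. inj_on child {..<c} \<and> (\<lambda>i::nat. {child i, par i}) ` {..<c} = E \<and>
    (\<forall>i<c. child i \<noteq> par i) \<and> (\<forall>i<c. \<forall>j<c. i < j \<longrightarrow> child j \<noteq> par i)"
proof -
  have "E \<subseteq> Pow V" "finite V" using assms by (auto simp: simple_graph_def)
  then have "finite E" by (meson finite_Pow_iff finite_subset)
  then show ?thesis using assms
  proof (induction E rule: finite_psubset_induct)
    case (psubset E)
    show ?case
    proof (cases "E = {}")
      case True
      then show ?thesis by (intro exI[of _ 0]) simp
    next
      case False
      obtain v u where vu: "{v, u} \<in> E" "v \<noteq> u" and leaf: "\<And>w. {v, w} \<in> E \<Longrightarrow> w = u"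
        by (rule forest_leaf[OF psubset.prems False]) (rule that)
      let ?E = "E - {{v, u}}"
      have 1: "simple_graph V ?E" using psubset.prems by (auto simp: simple_graph_def)
      have 2: "forest ?E" using psubset.prems unfolding forest_def is_cycle_def by blast
      have "?E \<subset> E" using vu by blast
      from psubset.IH[OF this 1 2] obtain c child par where IH: "inj_on child {..<c}" "(\<lambda>i::nat. {child i, par i}) ` {..<c} = ?E"
        "\<forall>i<c. child i \<noteq> par i" "\<forall>i<c. \<forall>j<c. i < j \<longrightarrow> child j \<noteq> par i"
        by (elim exE conjE)
      have v: "child i \<noteq> v" "par i \<noteq> v" if "i < c" for i
      proof -
        have e: "{child i, par i} \<in> ?E" using IH(2) that by blast
        show "child i \<noteq> v" using e leaf[of "par i"] by auto
        show "par i \<noteq> v" using e leaf[of "child i"] by (auto simp: insert_commute)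
      qed
      let ?child = "child(c := v)" and ?par = "par(c := u)"
      have "inj_on ?child {..<Suc c}"
        using IH(1) v(1) unfolding lessThan_Suc by (fastforce simp: inj_on_def)
      moreover have "(\<lambda>i. {?child i, ?par i}) ` {..<Suc c} = E"
      proof -
        have "(\<lambda>i. {?child i, ?par i}) ` {..<Suc c} = insert {v, u} ((\<lambda>i. {child i, par i}) ` {..<c})"
          unfolding lessThan_Suc image_insert by (intro arg_cong2[of _ _ _ _ insert] image_cong) auto
        then show ?thesis using IH(2) vu(1) by auto
      qed
      moreover have "\<forall>i<Suc c. ?child i \<noteq> ?par i" using IH(3) vu(2) by (auto simp: less_Suc_eq)
      moreover have "\<forall>i<Suc c. \<forall>j<Suc c. i < j \<longrightarrow> ?child j \<noteq> ?par i"
        using IH(4) v by (auto simp: less_Suc_eq)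
      ultimately show ?thesis by blast
    qed
  qed
qed

text \<open>Here \<open>g\<close> lists the variables that are to become the columns of the Jacobian minor.\<close>

lemma enumeration_with_prefix:
  fixes g :: "nat \<Rightarrow> 'x"
  assumes "finite N" "inj_on g {..<c}" "g ` {..<c} \<subseteq> N"
  obtains idx n where "bij_betw idx N {..<n}" "c \<le> n" "\<And>i. i < c \<Longrightarrow> idx (g i) = i"
proof -
  let ?G = "g ` {..<c}"
  obtain h where h: "bij_betw h (N - ?G) {0..<card (N - ?G)}"
    using ex_bij_betw_finite_nat[of "N - ?G"] assms(1) by auto
  define idx where "idx x = (if x \<in> ?G then inv_into {..<c} g x else c + h x)" for x
  have G: "bij_betw idx ?G {..<c}"
    using bij_betw_inv_into[OF inj_on_imp_bij_betw[OF assms(2)]]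
    by (rule bij_betw_cong[THEN iffD1, rotated]) (simp add: idx_def)
  have "bij_betw (\<lambda>x. c + x) {0..<card (N - ?G)} {c..<c + card (N - ?G)}"
    by (rule bij_betw_byWitness[of _ "\<lambda>x. x - c"]) auto
  with h have "bij_betw ((\<lambda>x. c + x) \<circ> h) (N - ?G) {c..<c + card (N - ?G)}" by (rule bij_betw_trans)
  then have "bij_betw idx (N - ?G) {c..<c + card (N - ?G)}"
    by (rule bij_betw_cong[THEN iffD1, rotated]) (simp add: idx_def)
  with G have "bij_betw idx (?G \<union> (N - ?G)) ({..<c} \<union> {c..<c + card (N - ?G)})"
    by (rule bij_betw_combine) auto
  moreover have "?G \<union> (N - ?G) = N" "{..<c} \<union> {c..<c + card (N - ?G)} = {..<c + card (N - ?G)}"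
    using assms(3) by auto
  ultimately have "bij_betw idx N {..<c + card (N - ?G)}" by simp
  moreover have "idx (g i) = i" if "i < c" for i
    using that assms(2) by (simp add: idx_def)
  ultimately show thesis using that le_add1 by blast
qed

section \<open>The Jacobian of a forest\<close>

lemma mconst_uminus: "mconst (- a) = - mconst a"
  by (simp add: mconst_def single_uminus)

lemma edge_equation_swap:
  assumes "\<And>b c. form c b = - form b c"
  shows "edge_equation B form u v = - edge_equation B form v u"
proof -
  have "edge_equation B form u v = (\<Sum>c\<in>B. \<Sum>b\<in>B. mconst (form b c) * mvar (u, b) * mvar (v, c))"
    unfolding edge_equation_def by (rule sum.swap)
  also have "\<dots> = (\<Sum>c\<in>B. \<Sum>b\<in>B. - (mconst (form c b) * mvar (v, c) * mvar (u, b)))"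
    by (intro sum.cong refl, subst (1) assms) (simp add: mconst_uminus ac_simps)
  finally show ?thesis by (simp add: edge_equation_def sum_negf)
qed

lemma genideal_eq_up_to_sign:
  assumes F: "F \<subseteq> carrier (mpoly_ring N)" and "G \<subseteq> F" "\<And>f. f \<in> F \<Longrightarrow> f \<in> G \<or> - f \<in> G"
  shows "genideal (mpoly_ring N) F = genideal (mpoly_ring N) G"
proof
  have G: "G \<subseteq> carrier (mpoly_ring N)" using assms by blast
  note I = mpoly_genideal(1)[OF G]
  have "F \<subseteq> genideal (mpoly_ring N) G"
  proof
    fix f assume "f \<in> F"
    then show "f \<in> genideal (mpoly_ring N) G"
      using assms(3)[of f] mpoly_genideal(2)[OF G] mpoly_ideal_closed(6)[OF I, of "- f"] by auto
  qed
  then show "genideal (mpoly_ring N) F \<subseteq> genideal (mpoly_ring N) G" by (rule mpoly_genideal(3)[OF F I])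
  show "genideal (mpoly_ring N) G \<subseteq> genideal (mpoly_ring N) F"
    by (rule mpoly_genideal(3)[OF G mpoly_genideal(1)[OF F]]) (use assms(2) mpoly_genideal(2)[OF F] in blast)
qed

context multigraded
begin

text \<open>The \<open>b\<close>-coordinate of the linear functional \<open>\<langle>-, w(u)\<rangle>\<close>, which is the derivative of the equation of an edge
  \<open>{v, u}\<close> with respect to the \<open>b\<close>-coordinate of \<open>w(v)\<close>.\<close>

definition edge_functional :: "('b \<Rightarrow> 'b \<Rightarrow> 'k) \<Rightarrow> 'v \<Rightarrow> 'b \<Rightarrow> ('v \<times> 'b, 'k) mpoly" where
  "edge_functional form u b = (\<Sum>c\<in>B. mconst (form b c) * mvar (u, c))"

lemma edge_functional_hom: "u \<in> V \<Longrightarrow> edge_functional form u b \<in> hom (unit_degree u)"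
  unfolding edge_functional_def
  using hom_mult[OF hom_mconst mvar_hom] by (intro hom_sum) simp

lemma edge_equation_functional:
  "edge_equation B form v u = (\<Sum>b\<in>B. mvar (v, b) * edge_functional form u b)"
  by (simp add: edge_equation_def edge_functional_def sum_distrib_left ac_simps)

text \<open>Since \<open>w(u) \<noteq> 0\<close> and the form is non-degenerate, the functional \<open>\<langle>-, w(u)\<rangle>\<close> does not vanish at the point \<open>p\<close>.
  If it were zero on all basis vectors other than \<open>b1\<close>, then its value on \<open>w(v)\<close> would be the product of its
  value on \<open>b1\<close> and the \<open>b1\<close>-coordinate of \<open>w(v)\<close>, both of which are nonzero; but this value is zero by the equation
  of the edge. The case \<open>b = b1\<close> is to be avoided because the \<open>b1\<close>-coordinate of \<open>w(v)\<close> is constant on a chart.\<close>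

lemma edge_functional_not_in_prime:
  assumes p: "primeideal p (mpoly_ring (V \<times> B))" and vu: "v \<in> V" "u \<in> V"
    and eq: "edge_equation B form v u \<in> p" and b1: "b1 \<in> B" "mvar (v, b1) \<notin> p"
    and b2: "b2 \<in> B" "mvar (u, b2) \<notin> p"
    and \<xi>: "\<And>c. c \<in> B \<Longrightarrow> (\<Sum>b\<in>B. \<xi> b * form b c) = (if c = b2 then 1 else 0)"
  shows "\<exists>b\<in>B. b \<noteq> b1 \<and> edge_functional form u b \<notin> p"
proof (rule ccontr)
  assume contra: "\<not> (\<exists>b\<in>B. b \<noteq> b1 \<and> edge_functional form u b \<notin> p)"
  note I = mpoly_ideal_closed[OF mpoly_prime_closed(1)[OF p]]
  have L: "edge_functional form u b \<in> R" for b by (rule hom_carrier[OF edge_functional_hom[OF vu(2)]])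
  have M: "mvar (x, b) \<in> R" if "x \<in> V" "b \<in> B" for x b using that by (intro mpoly_closed_mvar) auto
  have other: "edge_functional form u b \<in> p" if "b \<in> B" "b \<noteq> b1" for b using contra that by blast
  have "edge_equation B form v u =
      mvar (v, b1) * edge_functional form u b1 + (\<Sum>b\<in>B - {b1}. mvar (v, b) * edge_functional form u b)"
    unfolding edge_equation_functional using finite_B b1(1) by (rule sum.remove)
  moreover have "(\<Sum>b\<in>B - {b1}. mvar (v, b) * edge_functional form u b) \<in> p"
    using other M[OF vu(1)] by (intro mpoly_ideal_sum[OF mpoly_prime_closed(1)[OF p]] I(4)) auto
  ultimately have "mvar (v, b1) * edge_functional form u b1 \<in> p" using eq I(7) by fastforce
  then have "edge_functional form u b1 \<in> p"
    using mpoly_prime_closed(3)[OF p _ M[OF vu(1) b1(1)] L] b1(2) by blast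
  with other have all: "edge_functional form u b \<in> p" if "b \<in> B" for b using that by (cases "b = b1") auto
  have "(\<Sum>b\<in>B. mconst (\<xi> b) * edge_functional form u b) =
      (\<Sum>b\<in>B. \<Sum>c\<in>B. mconst (\<xi> b * form b c) * mvar (u, c))"
    by (simp add: edge_functional_def sum_distrib_left mconst_mult ac_simps)
  also have "\<dots> = (\<Sum>c\<in>B. mconst (\<Sum>b\<in>B. \<xi> b * form b c) * mvar (u, c))"
  proof -
    interpret mc: comm_ring_hom "mconst :: 'k \<Rightarrow> ('v \<times> 'b, 'k) mpoly" by (rule comm_ring_hom_mconst)
    show ?thesis by (subst sum.swap) (simp add: mc.hom_sum sum_distrib_right)
  qed
  also have "\<dots> = (\<Sum>c\<in>B. if c = b2 then mvar (u, c) else 0)"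
    by (rule sum.cong) (auto simp: \<xi>)
  also have "\<dots> = mvar (u, b2)" using finite_B b2(1) by simp
  finally have *: "(\<Sum>b\<in>B. mconst (\<xi> b) * edge_functional form u b) = mvar (u, b2)" .
  have "(\<Sum>b\<in>B. mconst (\<xi> b) * edge_functional form u b) \<in> p"
    by (intro mpoly_ideal_sum[OF mpoly_prime_closed(1)[OF p]] I(4) all mpoly_closed_mconst)
  then have "mvar (u, b2) \<in> p" unfolding * .
  then show False using b2(2) by blast
qed

end


text \<open>For each point \<open>p\<close>, the chart is chosen such that it contains \<open>p\<close> and that its first variables are the
  coordinates with index \<open>(child i, bb i)\<close>, where \<open>edge_functional_not_in_prime\<close> provides \<open>bb i\<close>. The \<open>i\<close>-th equation
  does not involve \<open>w(child j)\<close> for \<open>j > i\<close>, so the Jacobian matrix is triangular. One orientation of each edge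
  suffices as the two equations of an edge differ by a sign.\<close>

lemma (in multigraded) smooth_if_forest:
  fixes form :: "'b \<Rightarrow> 'b \<Rightarrow> 'k" and E :: "'v set set"
  assumes antisym: "\<And>b c. form c b = - form b c"
    and inverse: "\<And>a. a \<in> B \<Longrightarrow> \<exists>\<xi>. \<forall>c\<in>B. (\<Sum>b\<in>B. \<xi> b * form b c) = (if c = a then 1 else 0)"
    and G: "simple_graph V E" and forest: "forest E"
  shows "smooth (projective_graph_variety V E B form)"
proof -
  obtain c child par where child_inj: "inj_on child {..<c}" and E_eq: "(\<lambda>i::nat. {child i, par i}) ` {..<c} = E"
    and child_par: "\<And>i. i < c \<Longrightarrow> child i \<noteq> par i" and later: "\<And>i j. i < c \<Longrightarrow> j < c \<Longrightarrow> i < j \<Longrightarrow> child j \<noteq> par i"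
    using forest_enumeration[OF G forest] by (elim exE conjE) simp
  have edge: "v \<in> V" "u \<in> V" if "{v, u} \<in> E" for v u
    using G that by (auto simp: simple_graph_def)
  have cV: "child i \<in> V" "par i \<in> V" if "i < c" for i
    using edge[of "child i" "par i"] E_eq that by blast+
  let ?eq = "edge_equation B form"
  define F where "F = {?eq v u | v u. {v, u} \<in> E}"
  define F0 where "F0 = (\<lambda>i. ?eq (child i) (par i)) ` {..<c}"
  have F0_hom: "?eq (child i) (par i) \<in> hom (\<lambda>x. unit_degree (child i) x + unit_degree (par i) x)" if "i < c" for i
    by (intro edge_equation_hom cV that)
  have FR: "F \<subseteq> R" unfolding F_def using edge_equation_hom edge hom_carrier by blast
  have "F0 \<subseteq> F" unfolding F0_def F_def using E_eq by blast
  moreover have "f \<in> F0 \<or> - f \<in> F0" if "f \<in> F" for f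
  proof -
    obtain v u where vu: "f = ?eq v u" "{v, u} \<in> E" using \<open>f \<in> F\<close> by (auto simp: F_def)
    then obtain i where i: "i < c" "{v, u} = {child i, par i}" using E_eq by blast
    then consider "v = child i" "u = par i" | "v = par i" "u = child i" by (auto simp: doubleton_eq_iff)
    then show ?thesis
    proof cases
      case 2
      then have "- f = ?eq (child i) (par i)" using vu(1) edge_equation_swap[of form B "par i" "child i", OF antisym] by simp
      then show ?thesis using i(1) by (auto simp: F0_def)
    qed (use vu i in \<open>auto simp: F0_def\<close>)
  qed
  ultimately have ideals: "genideal (mpoly_ring (V \<times> B)) F = genideal (mpoly_ring (V \<times> B)) F0"
    by (intro genideal_eq_up_to_sign[OF FR])
  then have pts: "points F = points F0" by (simp add: points_def)
  have F0R: "F0 \<subseteq> R" using FR \<open>F0 \<subseteq> F\<close> by blast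
  let ?X = "fraction_space (mpoly_ring (V \<times> B)) (range hom) (genideal (mpoly_ring (V \<times> B)) F0) (points F0)"
  have X_eq: "projective_graph_variety V E B form = ?X"
    by (simp add: projective_graph_variety_def multiprojective_scheme_eq F_def[symmetric] ideals pts)
  interpret X: graded_fractions "V \<times> B" "range hom" "genideal (mpoly_ring (V \<times> B)) F0" "points F0"
    by (rule multiprojective_graded_fractions[OF F0R])
  show ?thesis
    unfolding X_eq smooth_def
  proof (rule ballI)
    fix p assume "p \<in> topspace (Top ?X)"
    then have p: "p \<in> points F0" using X.topspace_T by simp
    then have prime: "primeideal p (mpoly_ring (V \<times> B))" and Jp: "genideal (mpoly_ring (V \<times> B)) F0 \<subseteq> p"
      and "\<forall>v\<in>V. \<exists>b\<in>B. mvar (v, b) \<notin> p" by (auto simp: points_def)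
    then obtain bv where bv: "\<And>v. v \<in> V \<Longrightarrow> bv v \<in> B" "\<And>v. v \<in> V \<Longrightarrow> mvar (v, bv v) \<notin> p" by metis
    have "\<exists>b\<in>B. b \<noteq> bv (child i) \<and> edge_functional form (par i) b \<notin> p" if i: "i < c" for i
    proof -
      obtain \<xi> where \<xi>: "\<forall>c\<in>B. (\<Sum>b\<in>B. \<xi> b * form b c) = (if c = bv (par i) then 1 else 0)"
        using inverse[OF bv(1)[OF cV(2)[OF i]]] by blast
      have "?eq (child i) (par i) \<in> p"
        using Jp mpoly_genideal(2)[OF F0R] i by (auto simp: F0_def)
      then show ?thesis
        by (rule edge_functional_not_in_prime[where \<xi> = \<xi>, OF prime cV[OF i] _ bv(1)[OF cV(1)[OF i]] bv(2)[OF cV(1)[OF i]]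
              bv(1)[OF cV(2)[OF i]] bv(2)[OF cV(2)[OF i]]]) (use \<xi> in blast)
    qed
    then obtain bb where bb: "\<And>i. i < c \<Longrightarrow> bb i \<in> B" "\<And>i. i < c \<Longrightarrow> bb i \<noteq> bv (child i)"
      "\<And>i. i < c \<Longrightarrow> edge_functional form (par i) (bb i) \<notin> p" by metis
    define g where "g i = (child i, bb i)" for i
    let ?N = "{(v, b). v \<in> V \<and> b \<in> B \<and> b \<noteq> bv v}"
    have finN: "finite ?N" using finite_V finite_B by (auto intro: finite_subset[of _ "V \<times> B"])
    have g_inj: "inj_on g {..<c}" using child_inj by (auto simp: inj_on_def g_def)
    have gN': "g j \<in> ?N" if "j < c" for j using cV bb that by (simp add: g_def)
    then have gN: "g ` {..<c} \<subseteq> ?N" by (simp add: image_subset_iff)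
    obtain idx n where idx: "bij_betw idx ?N {..<n}" and cn: "c \<le> n" and idx_g: "\<And>i. i < c \<Longrightarrow> idx (g i) = i"
      by (rule enumeration_with_prefix[OF finN g_inj gN]) (rule that)
    interpret C: chart V B "TYPE('k)" F0 bv idx n
    proof
      show "\<exists>d. f \<in> hom d" if "f \<in> F0" for f using that F0_hom by (auto simp: F0_def)
    qed (use bv idx in auto)
    define f where "f i = C.dehom (?eq (child i) (par i))" for i
    have f_image: "C.dehom ` F0 = f ` {..<c}" by (auto simp: F0_def f_def)
    have f_closed: "f i \<in> carrier (mpoly_ring {..<n})" if "i < c" for i
      unfolding f_def by (rule C.dehom_closed[OF hom_carrier[OF F0_hom[OF that]]])
    have d_value: "mpderiv j (C.chart_value x) = (if x = g j then 1 else 0)" if j: "j < c" for j x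
    proof (cases "x \<in> ?N")
      case True
      have "idx x = idx (g j) \<longleftrightarrow> x = g j" by (rule inj_on_eq_iff[OF C.idx_inj True gN'[OF j]])
      then have "idx x = j \<longleftrightarrow> x = g j" by (simp only: idx_g[OF j])
      then show ?thesis using True by (auto simp: C.chart_value_def mpderiv_mvar)
    next
      case False
      then have "x \<noteq> g j" using gN'[OF j] by metis
      then show ?thesis using False by (simp add: C.chart_value_def)
    qed
    have entry: "mpderiv j (f i) = (if i = j then C.dehom (edge_functional form (par i) (bb i)) else 0)"
      if ij: "i < c" "j < c" "i \<le> j" for i j
    proof -
      have par_j: "child j \<noteq> par i" using child_par[OF ij(1)] later[OF ij(1,2)] ij(3) by (cases "i = j") auto
      have d_fun: "mpderiv j (C.dehom (edge_functional form (par i) b)) = 0" for b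
        using par_j
        by (simp add: edge_functional_def C.dehom.hom_sum C.dehom.hom_mult C.dehom_mvar C.dehom_mconst mpderiv_sum
            mpderiv_mult d_value[OF ij(2)] g_def)
      have "mpderiv j (f i) = (\<Sum>b\<in>B. (if (child i, b) = g j then 1 else 0) * C.dehom (edge_functional form (par i) b))"
        by (simp add: f_def edge_equation_functional C.dehom.hom_sum C.dehom.hom_mult C.dehom_mvar mpderiv_sum
            mpderiv_mult d_value[OF ij(2)] d_fun)
      also have "\<dots> = (if i = j then C.dehom (edge_functional form (par i) (bb i)) else 0)"
      proof (cases "i = j")
        case True
        have "(\<Sum>b\<in>B. (if (child i, b) = g j then 1 else 0) * C.dehom (edge_functional form (par i) b)) =
            (\<Sum>b\<in>B. if b = bb i then C.dehom (edge_functional form (par i) b) else 0)"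
          by (rule sum.cong) (use True in \<open>auto simp: g_def\<close>)
        then show ?thesis using True finite_B bb(1)[OF ij(1)] by simp
      next
        case False
        then have "child i \<noteq> child j" using child_inj ij by (auto simp: inj_on_def)
        then show ?thesis using False by (simp add: g_def)
      qed
      finally show ?thesis .
    qed
    have cp: "p \<in> C.chart_points" using p bv(2) by (simp add: C.chart_points_def)
    have prime': "primeideal (C.chart_map p) (mpoly_ring {..<n})" using C.chart_map_prime[OF cp] by simp
    let ?A = "mat c c (\<lambda>(i, j). mpderiv j (f i))"
    have "jacobian_minor c f = prod_list (diag_mat ?A)"
      unfolding jacobian_minor_def by (rule det_lower_triangular[of c]) (auto simp: entry)
    also have "\<dots> = (\<Prod>i<c. C.dehom (edge_functional form (par i) (bb i)))"
      by (simp add: prod_list_diag_prod atLeast0LessThan entry)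
    also have "\<dots> \<notin> C.chart_map p"
    proof (rule mpoly_prime_prod[OF prime'])
      fix i assume "i \<in> {..<c}"
      then have i: "i < c" by simp
      note L = edge_functional_hom[OF cV(2)[OF i], of form "bb i"]
      show "C.dehom (edge_functional form (par i) (bb i)) \<in> carrier (mpoly_ring {..<n})"
        by (rule C.dehom_closed[OF hom_carrier[OF L]])
      show "C.dehom (edge_functional form (par i) (bb i)) \<notin> C.chart_map p"
        using C.dehom_in_chart_map_iff[OF cp L] bb(3)[OF i] by simp
    qed
    finally have minor: "jacobian_minor c f \<notin> C.chart_map p" .
    define Y' where "Y' = {q \<in> C.Q. jacobian_minor c f \<notin> q}"
    have Y'_open: "openin C.Y.T Y'"
      unfolding Y'_def by (rule C.Y.openin_basic[OF jacobian_minor_closed[OF f_closed]])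
    have "p \<in> C.preimage Y'"
      using cp minor C.chart_map_prime[OF cp] by (simp add: C.preimage_def Y'_def)
    moreover have aff: "affine_scheme {..<n} (f ` {..<c}) = C.Y.space"
      using C.Y.affine_scheme_eq by (simp add: f_image)
    ultimately show "\<exists>U. openin (Top ?X) U \<and> p \<in> U \<and>
        (\<exists>n c f. c \<le> n \<and> (\<forall>i<c. f i \<in> carrier (mpoly_ring {..<n})) \<and>
           (let Y = (affine_scheme {..<n} (f ` {..<c}) :: (nat, 'k) mpoly_space)
            in \<exists>Y'. openin (Top Y) Y' \<and> (\<forall>q\<in>Y'. jacobian_minor c f \<notin> q) \<and>
                 isomorphic_spaces (open_subspace ?X U) (open_subspace Y Y')))"
      using C.chart_isomorphism[OF Y'_open] Y'_open cn f_closed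
      by (intro exI[of _ "C.preimage Y'"] conjI exI[of _ n] exI[of _ c] exI[of _ f])
        (auto simp: Let_def Y'_def simp del: C.Y.space_simps(2-))
  qed
qed

theorem theoremB:
  fixes scale :: "'k::field \<Rightarrow> 'w::ab_group_add \<Rightarrow> 'w"
    and Basis :: "'w set"
    and form :: "'w \<Rightarrow> 'w \<Rightarrow> 'k"
    and V :: "'v set"
    and E :: "'v set set"
    and d D :: nat
  assumes "symplectic_space scale Basis form"
    and "simple_graph V E"
    and "degenerate d V E"
    and "D = max_degree V E"
    and "vector_space.dim scale (UNIV :: 'w set) \<ge> D + d"
  shows "smooth (projective_graph_variety V E Basis form) \<longleftrightarrow> forest E"
proof -
  interpret W: symplectic_space scale Basis form by fact
  interpret M: multigraded V Basis "TYPE('k)"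
    using assms(2) W.finite_Basis by unfold_locales (auto simp: simple_graph_def)
  show ?thesis
  proof
    assume "forest E"
    show "smooth (projective_graph_variety V E Basis form)"
    proof (rule M.smooth_if_forest[OF W.form_antisym _ assms(2) \<open>forest E\<close>])
      fix a assume "a \<in> Basis"
      then obtain \<xi> where "\<And>c. c \<in> Basis \<Longrightarrow> (\<Sum>b\<in>Basis. \<xi> b * form b c) = (if c = a then 1 else 0)"
        by (rule W.form_matrix_inverse) (rule that)
      then show "\<exists>\<xi>. \<forall>c\<in>Basis. (\<Sum>b\<in>Basis. \<xi> b * form b c) = (if c = a then 1 else 0)" by blast
    qed
  next
    assume smooth: "smooth (projective_graph_variety V E Basis form)"
    show "forest E"
      unfolding forest_def
    proof
      assume "\<exists>us. is_cycle E us"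
      then obtain us where us: "is_cycle E us" by blast
      have "3 \<le> vector_space.dim scale (UNIV :: 'w set)"
        using degenerate_cycle[OF assms(2,3) us] max_degree_cycle[OF assms(2) us] assms(4,5) by linarith
      then obtain b0 x y where coords: "b0 \<in> Basis" "x b0 = 0" "(\<Sum>c\<in>Basis. form b0 c * x c) = 0"
        "y b0 = 0" "(\<Sum>c\<in>Basis. form b0 c * y c) = 0" "(\<Sum>b\<in>Basis. \<Sum>c\<in>Basis. form b c * x b * y c) = 1"
        by (rule W.symplectic_coordinates) (rule that)
      have "v \<in> V \<and> u \<in> V" if "{v, u} \<in> E" for v u
        using assms(2) that by (auto simp: simple_graph_def)
      then show False
        using M.not_smooth_if_cycle[OF W.form_antisym W.alternating coords(1-6) _ us] smooth by blast
    qed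
  qed
qed

end
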